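(* Let $\rho,EI\in C^4[0,1]$ be strictly positive, let $m,J>0$ and $a,b>0$. Assume there exist $\varepsilon>0$, $\delta>0$ and $\zeta\in C^2[0,1]$ with $\zeta(0)=0$ such that for all $x\in[0,1]$ $$2(1-\varepsilon)\rho(x)-(\rho\zeta)'(x)<-\delta,\qquad EI(x)\bigl[(1-\varepsilon)-2\zeta'(x)\bigr]+\tfrac12(EI\zeta)'(x)<-\delta.$$ Consider the closed-loop wind turbine tower model $$\rho(x)w_{tt}=-(EI\,w_{xx})_{xx}\ \text{on }(0,1)\times[0,\infty),\quad w(0,t)=w_x(0,t)=0,$$ $$m w_{tt}(1,t)-(EIw_{xx})_x(1,t)=-a w_t(1,t),\qquad J w_{xtt}(1,t)+EI(1)w_{xx}(1,t)=-b w_{xt}(1,t),$$ formulated as $\dot z=Az$ on $X$ (see context). Then for every $z_0\in X$ the energy $E(t)=\frac12\|T(t)z_0\|_X^2$ satisfies $E(t)\to0$ as $t\to\infty$, and for every $z_0\in D(A)$ (classical solutions) $E(t)=o(t^{-1})$ as $t\to\infty$.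
   Context: $H^2_l(0,1)=\{f\in H^2(0,1): f(0)=f'(0)=0\}$. The state space is $X=H^2_l(0,1)\times L^2(0,1)\times\mathbb{C}^2$ with norm $\|(f,g,\xi,\eta)\|_X^2=\int_0^1[EI|f''|^2+\rho|g|^2]dx+m|\xi|^2+J|\eta|^2$; the state is $z(t)=(w(\cdot,t),w_t(\cdot,t),w_t(1,t),w_{xt}(1,t))$. The operator is $A(f,g,\xi,\eta)=\bigl(g,\,-\tfrac1\rho(EIf'')'',\,\tfrac1m[(EIf'')'(1)-a\xi],\,\tfrac1J[-(EIf'')(1)-b\eta]\bigr)$ with $D(A)=\{(f,g,\xi,\eta)\in(H^4(0,1)\cap H^2_l(0,1))\times H^2_l(0,1)\times\mathbb{C}^2:\ \xi=g(1),\ \eta=g'(1)\}$; $A$ generates a $C_0$-semigroup $(T(t))_{t\ge0}$ on $X$ and solutions are $z(t)=T(t)z_0$. The quantity $E(t)$ is the physical energy $\frac12\int_0^1[EI|w_{xx}|^2+\rho|w_t|^2]dx+\frac m2|w_t(1,t)|^2+\frac J2|w_{xt}(1,t)|^2$. *)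

theory Defs
  imports "HOL-Analysis.Analysis" "HOL-Library.Landau_Symbols"
begin

type_synonym cfun = "real \<Rightarrow> complex"
type_synonym state = "cfun \<times> cfun \<times> complex \<times> complex"

definition dw :: "(real \<Rightarrow> 'a::real_normed_vector) \<Rightarrow> real \<Rightarrow> 'a" where
  "dw f x = vector_derivative f (at x within {0..1})"

definition L2 :: "cfun \<Rightarrow> bool" where
  "L2 g \<longleftrightarrow> set_borel_measurable lborel {0..1} g
             \<and> set_integrable lborel {0..1} (\<lambda>x. (cmod (g x))^2)"

definition is_L2_antideriv :: "cfun \<Rightarrow> cfun \<Rightarrow> bool" where
  "is_L2_antideriv f g \<longleftrightarrow> L2 g \<and> (\<forall>x\<in>{0..1}. f x = f 0 + (LINT s:{0..x}|lborel. g s))"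

text \<open>H^1(0,1), continuous representative.\<close>
definition H1 :: "cfun \<Rightarrow> bool" where
  "H1 f \<longleftrightarrow> (\<exists>g. is_L2_antideriv f g)"

text \<open>The (a.e. unique) weak derivative of an H^1 function.\<close>
definition wd :: "cfun \<Rightarrow> cfun" where
  "wd f = (SOME g. is_L2_antideriv f g)"

text \<open>Sobolev space H^k(0,1), continuous (C^(k-1)) representatives.\<close>
fun Hs :: "nat \<Rightarrow> cfun \<Rightarrow> bool" where
  "Hs 0 f = L2 f"
| "Hs (Suc 0) f = H1 f"
| "Hs (Suc (Suc k)) f = ((\<forall>x\<in>{0..1}. f differentiable (at x within {0..1})) \<and> Hs (Suc k) (dw f))"

fun Ck :: "nat \<Rightarrow> (real \<Rightarrow> real) \<Rightarrow> bool" where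
  "Ck 0 f = continuous_on {0..1} f"
| "Ck (Suc k) f = ((\<forall>x\<in>{0..1}. f differentiable (at x within {0..1})) \<and> Ck k (dw f))"

definition H2l :: "cfun \<Rightarrow> bool" where
  "H2l f \<longleftrightarrow> Hs 2 f \<and> f 0 = 0 \<and> dw f 0 = 0"

definition stateX :: "state set" where
  "stateX = {(f, g, \<xi>, \<eta>). H2l f \<and> L2 g}"

definition domA :: "state set" where
  "domA = {(f, g, \<xi>, \<eta>). Hs 4 f \<and> f 0 = 0 \<and> dw f 0 = 0 \<and> H2l g \<and> \<xi> = g 1 \<and> \<eta> = dw g 1}"

definition opA :: "(real \<Rightarrow> real) \<Rightarrow> (real \<Rightarrow> real) \<Rightarrow> real \<Rightarrow> real \<Rightarrow> real \<Rightarrow> real \<Rightarrow> state \<Rightarrow> state" where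
  "opA rho EI m J a b z = (case z of (f, g, \<xi>, \<eta>) \<Rightarrow>
     (let M = (\<lambda>x. complex_of_real (EI x) * dw (dw f) x) in
      (g,
       \<lambda>x. - wd (dw M) x / complex_of_real (rho x),
       (dw M 1 - complex_of_real a * \<xi>) / complex_of_real m,
       (- M 1 - complex_of_real b * \<eta>) / complex_of_real J)))"

text \<open>Squared norm of X (a seminorm on representatives).\<close>
definition sqnorm :: "(real \<Rightarrow> real) \<Rightarrow> (real \<Rightarrow> real) \<Rightarrow> real \<Rightarrow> real \<Rightarrow> state \<Rightarrow> real" where
  "sqnorm rho EI m J z = (case z of (f, g, \<xi>, \<eta>) \<Rightarrow>
     (LINT x:{0..1}|lborel. EI x * (cmod (wd (dw f) x))^2 + rho x * (cmod (g x))^2)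
     + m * (cmod \<xi>)^2 + J * (cmod \<eta>)^2)"

definition st_add :: "state \<Rightarrow> state \<Rightarrow> state" where
  "st_add z1 z2 = (case z1 of (f1, g1, x1, y1) \<Rightarrow> case z2 of (f2, g2, x2, y2) \<Rightarrow>
     (\<lambda>x. f1 x + f2 x, \<lambda>x. g1 x + g2 x, x1 + x2, y1 + y2))"

definition st_diff :: "state \<Rightarrow> state \<Rightarrow> state" where
  "st_diff z1 z2 = (case z1 of (f1, g1, x1, y1) \<Rightarrow> case z2 of (f2, g2, x2, y2) \<Rightarrow>
     (\<lambda>x. f1 x - f2 x, \<lambda>x. g1 x - g2 x, x1 - x2, y1 - y2))"

definition st_scale :: "complex \<Rightarrow> state \<Rightarrow> state" where
  "st_scale c z = (case z of (f, g, x1, y1) \<Rightarrow> (\<lambda>x. c * f x, \<lambda>x. c * g x, c * x1, c * y1))"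

text \<open>T is a C0-semigroup of bounded linear operators on the (seminormed) space X whose
  generator is (A, D(A)); all identities hold modulo null elements (L2 classes).\<close>
definition C0_semigroup_gen ::
  "(state \<Rightarrow> real) \<Rightarrow> state set \<Rightarrow> state set \<Rightarrow> (state \<Rightarrow> state) \<Rightarrow> (real \<Rightarrow> state \<Rightarrow> state) \<Rightarrow> bool" where
  "C0_semigroup_gen sqn X DA A T \<longleftrightarrow>
     (\<forall>t\<ge>0. \<forall>z\<in>X. T t z \<in> X)
   \<and> (\<forall>t\<ge>0. \<exists>C. \<forall>z\<in>X. sqn (T t z) \<le> C * sqn z)
   \<and> (\<forall>t\<ge>0. \<forall>z1\<in>X. \<forall>z2\<in>X. \<forall>c.
        sqn (st_diff (T t (st_add (st_scale c z1) z2)) (st_add (st_scale c (T t z1)) (T t z2))) = 0)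
   \<and> (\<forall>z\<in>X. sqn (st_diff (T 0 z) z) = 0)
   \<and> (\<forall>s\<ge>0. \<forall>t\<ge>0. \<forall>z\<in>X. sqn (st_diff (T (s + t) z) (T s (T t z))) = 0)
   \<and> (\<forall>z\<in>X. ((\<lambda>t. sqn (st_diff (T t z) z)) \<longlongrightarrow> 0) (at_right 0))
   \<and> (\<forall>z\<in>X. (\<exists>y\<in>X. ((\<lambda>h. sqn (st_diff (st_scale (complex_of_real (1 / h)) (st_diff (T h z) z)) y))
                          \<longlongrightarrow> 0) (at_right 0))
             \<longleftrightarrow> (\<exists>z'\<in>DA. sqn (st_diff z z') = 0))
   \<and> (\<forall>z\<in>DA. ((\<lambda>h. sqn (st_diff (st_scale (complex_of_real (1 / h)) (st_diff (T h z) z)) (A z)))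
                  \<longlongrightarrow> 0) (at_right 0))"

end

theory Submission
  imports Defs
begin

text \<open>The multiplier \<open>\<rho> \<zeta> w\<^sub>t w\<^sub>x\<close> with \<open>\<zeta> = exp (\<lambda> x) - 1\<close> and \<open>\<lambda>\<close> large bounds the time integral of the energy by
  boundary data at the tip and a lower-order term in the slope. For smooth data the tip moment and shear
  are linear in \<open>w\<^sub>t\<close> and \<open>w\<^sub>t\<^sub>t\<close> at the tip, which are square integrable in time by the dissipation along
  the orbits of \<open>z\<close> and \<open>A z\<close>. To remove the lower-order term, \<open>w\<close> is split into an average over a short
  time and a remainder, which is bounded by that time times the velocity. Moment and velocity are Volterra
  integrals of each other's time derivative, up to tip data; iterating this on the averages, the
  factorial decay of the Volterra operators beats the growth of the time difference quotients, so the average is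
  controlled by the tip data. Hence the energy is integrable in time with a bound in terms of \<open>z\<close> and
  \<open>A z\<close>; as it decreases, it is \<open>o(1/t)\<close> on the domain and tends to zero everywhere by density.\<close>

section \<open>The Hilbert space of square integrable functions\<close>

text \<open>States are concrete functions and the semigroup laws hold only up to null elements, so
  the semigroup is transported to a genuine Hilbert space. Its first coordinate is the curvature:
  the clamped end makes slope and deflection bounded functions of it. The obstacle is the
  lower-order term, whose coefficient is not small; the usual remedy is a compactness argument that
  excludes undamped modes, and the averages are a quantitative substitute for it. Moment and
  velocity are both integrated inwards from the tip, so that the composition of the two
  representations is again triangular; mixing the two ends would destroy the factorial decay. The
  total averaging time is fixed before the number \<open>2 * k\<close> of averages: the remainder
  depends on that time only, so \<open>k\<close> remains free to make the quotient term small.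
  Integration by parts for a state needs two powers of the domain, and the tip accelerations, being
  tip data of the orbit of \<open>A z\<close>, need a third.\<close>

abbreviation unit_measure :: "real measure"
  where "unit_measure \<equiv> restrict_space lborel {0..1}"

lemma space_unit_measure [simp]: "space unit_measure = {0..1}"
  by (simp add: space_restrict_space)

lemma finite_measure_unit: "finite_measure unit_measure"
  by (rule finite_measureI) (simp add: emeasure_restrict_space space_restrict_space)

lemma L2_iff:
  "L2 g \<longleftrightarrow> g \<in> borel_measurable unit_measure \<and> integrable unit_measure (\<lambda>x. (norm (g x))\<^sup>2)"
  unfolding L2_def set_borel_measurable_def set_integrable_def
  by (simp add: borel_measurable_restrict_space_iff integrable_restrict_space)

lemma set_integral_unit_measure:
  fixes f :: "real \<Rightarrow> 'b::{banach, second_countable_topology}"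
  shows "(LINT x:{0..1}|lborel. f x) = integral\<^sup>L unit_measure f"
  by (simp add: set_lebesgue_integral_def integral_restrict_space)

lemma L2_measurable: "L2 g \<Longrightarrow> g \<in> borel_measurable unit_measure"
  by (simp add: L2_iff)

lemma L2_integrable_norm_sq: "L2 g \<Longrightarrow> integrable unit_measure (\<lambda>x. (norm (g x))\<^sup>2)"
  by (simp add: L2_iff)

text \<open>Sums, bounded multiples, inner products and the passage to L1 are all dominated
  pointwise by a multiple of two squared norms, so for each of them measurability is all that
  remains to be checked.\<close>

lemma L2_bounded_by:
  assumes "L2 g" "L2 h" "f \<in> borel_measurable unit_measure"
    and "\<And>x. x \<in> {0..1} \<Longrightarrow> norm (f x) \<le> c * ((norm (g x))\<^sup>2 + (norm (h x))\<^sup>2)"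
  shows "integrable unit_measure (f :: real \<Rightarrow> 'b::{banach, second_countable_topology})"
proof (rule Bochner_Integration.integrable_bound[OF _ assms(3)])
  show "integrable unit_measure (\<lambda>x. c * ((norm (g x))\<^sup>2 + (norm (h x))\<^sup>2))"
    using assms(1,2) by (intro integrable_mult_right Bochner_Integration.integrable_add L2_integrable_norm_sq)
  show "AE x in unit_measure. norm (f x) \<le> norm (c * ((norm (g x))\<^sup>2 + (norm (h x))\<^sup>2))"
    using assms(4) by (intro AE_I2) (force simp: abs_le_iff)
qed

lemma L2_add:
  assumes "L2 g" "L2 h"
  shows "L2 (\<lambda>x. g x + h x)"
proof -
  have m: "(\<lambda>x. g x + h x) \<in> borel_measurable unit_measure"
    using assms by (intro borel_measurable_add L2_measurable)
  have "integrable unit_measure (\<lambda>x. (norm (g x + h x))\<^sup>2)"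
  proof (rule L2_bounded_by[OF assms, where c = 2])
    show "(\<lambda>x. (norm (g x + h x))\<^sup>2) \<in> borel_measurable unit_measure"
      using m by measurable
    fix x
    have "(norm (g x + h x))\<^sup>2 \<le> (norm (g x) + norm (h x))\<^sup>2"
      by (intro power_mono norm_triangle_ineq) simp
    also have "\<dots> \<le> 2 * ((norm (g x))\<^sup>2 + (norm (h x))\<^sup>2)"
      using sum_squares_bound[of "norm (g x)" "norm (h x)"] by (simp add: power2_sum)
    finally show "norm ((norm (g x + h x))\<^sup>2) \<le> 2 * ((norm (g x))\<^sup>2 + (norm (h x))\<^sup>2)" by simp
  qed
  with m show ?thesis by (simp add: L2_iff)
qed

lemma L2_bounded_mult:
  assumes "L2 g" "h \<in> borel_measurable unit_measure" "\<And>x. x \<in> {0..1} \<Longrightarrow> norm (h x) \<le> C"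
  shows "L2 (\<lambda>x. h x * g x)"
proof -
  have m: "(\<lambda>x. h x * g x) \<in> borel_measurable unit_measure"
    using assms L2_measurable by (intro borel_measurable_times) auto
  have "integrable unit_measure (\<lambda>x. (norm (h x * g x))\<^sup>2)"
  proof (rule L2_bounded_by[OF assms(1) assms(1), where c = "C\<^sup>2"])
    show "(\<lambda>x. (norm (h x * g x))\<^sup>2) \<in> borel_measurable unit_measure"
      using m by measurable
    fix x :: real assume x: "x \<in> {0..1}"
    have "(norm (h x * g x))\<^sup>2 = (norm (h x))\<^sup>2 * (norm (g x))\<^sup>2"
      by (simp add: norm_mult power_mult_distrib)
    also have "\<dots> \<le> C\<^sup>2 * (norm (g x))\<^sup>2"
      using assms(3)[OF x] by (intro mult_right_mono power_mono) auto
    also have "\<dots> \<le> C\<^sup>2 * ((norm (g x))\<^sup>2 + (norm (g x))\<^sup>2)"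
      by (intro mult_left_mono) auto
    finally show "norm ((norm (h x * g x))\<^sup>2) \<le> C\<^sup>2 * ((norm (g x))\<^sup>2 + (norm (g x))\<^sup>2)"
      by simp
  qed
  with m show ?thesis by (simp add: L2_iff)
qed

lemma L2_const: "L2 (\<lambda>x. c)"
  unfolding L2_iff using finite_measure.integrable_const[OF finite_measure_unit] by auto

lemma L2_cmult: "L2 g \<Longrightarrow> L2 (\<lambda>x. c * g x)"
  by (rule L2_bounded_mult[where C = "norm c"]) auto

lemma L2_minus: "L2 g \<Longrightarrow> L2 (\<lambda>x. - g x)"
  using L2_cmult[of g "-1"] by simp

lemma L2_diff: "L2 g \<Longrightarrow> L2 h \<Longrightarrow> L2 (\<lambda>x. g x - h x)"
  using L2_add[of g "\<lambda>x. - h x"] L2_minus by simp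

lemma L2_scaleR: "L2 g \<Longrightarrow> L2 (\<lambda>x. c *\<^sub>R g x)"
  using L2_cmult[of g "complex_of_real c"] by (simp add: scaleR_conv_of_real)

lemma measurable_unit_continuous:
  fixes g :: "real \<Rightarrow> 'b::{second_countable_topology, real_normed_vector}"
  assumes "continuous_on {0..1} g"
  shows "g \<in> borel_measurable unit_measure"
  using borel_measurable_continuous_on_restrict[OF assms]
  by (simp cong: measurable_cong_sets add: sets_restrict_space)

lemma L2_bounded:
  assumes "g \<in> borel_measurable unit_measure" "\<And>x. x \<in> {0..1} \<Longrightarrow> norm (g x) \<le> C"
  shows "L2 g"
  using L2_bounded_mult[OF L2_const[of 1] assms] by simp

lemma continuous_unit_bounded:
  fixes g :: "real \<Rightarrow> 'b::real_normed_vector"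
  assumes "continuous_on {0..1} g"
  obtains C where "C > 0" "\<And>x. x \<in> {0..1} \<Longrightarrow> norm (g x) \<le> C"
proof -
  have "bounded (g ` {0..1})"
    using assms by (intro compact_imp_bounded compact_continuous_image) auto
  then show ?thesis using that unfolding bounded_pos by auto
qed

lemma L2_continuous: "continuous_on {0..1} g \<Longrightarrow> L2 g"
  by (metis L2_bounded continuous_unit_bounded measurable_unit_continuous)

lemma L2_norm: "L2 g \<Longrightarrow> L2 (\<lambda>x. complex_of_real (norm (g x)))"
  unfolding L2_iff by (auto intro: borel_measurable_of_real)

lemma L2_cong_AE:
  assumes "L2 g" "h \<in> borel_measurable unit_measure" "AE x in unit_measure. g x = h x"
  shows "L2 h"
proof -
  have m: "g \<in> borel_measurable unit_measure" using assms by (simp add: L2_iff)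
  have "integrable unit_measure (\<lambda>x. (norm (h x))\<^sup>2)"
    using assms m L2_integrable_norm_sq[OF assms(1)]
    by (subst integrable_cong_AE[where g = "\<lambda>x. (norm (g x))\<^sup>2"]) (auto elim!: eventually_mono)
  then show ?thesis using assms by (simp add: L2_iff)
qed

lemma L2_inner_integrable:
  assumes "L2 g" "L2 h"
  shows "integrable unit_measure (\<lambda>x. inner (g x) (h x))"
proof (rule L2_bounded_by[OF assms, where c = 1])
  show "(\<lambda>x. inner (g x) (h x)) \<in> borel_measurable unit_measure"
    using assms L2_measurable by (intro borel_measurable_inner) auto
  fix x
  have "\<bar>inner (g x) (h x)\<bar> \<le> norm (g x) * norm (h x)" by (rule Cauchy_Schwarz_ineq2)
  also have "\<dots> \<le> (norm (g x))\<^sup>2 + (norm (h x))\<^sup>2"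
    using sum_squares_bound[of "norm (g x)" "norm (h x)"]
      mult_nonneg_nonneg[OF norm_ge_zero[of "g x"] norm_ge_zero[of "h x"]] by linarith
  finally show "norm (inner (g x) (h x)) \<le> 1 * ((norm (g x))\<^sup>2 + (norm (h x))\<^sup>2)" by simp
qed

text \<open>Reflexive only on square integrable functions; the partial quotient therefore consists
  exactly of their almost-everywhere classes.\<close>

definition l2_rel :: "cfun \<Rightarrow> cfun \<Rightarrow> bool"
  where "l2_rel g h \<longleftrightarrow> L2 g \<and> L2 h \<and> (AE x in unit_measure. g x = h x)"

lemma part_equivp_l2_rel: "part_equivp l2_rel"
proof (rule part_equivpI)
  show "\<exists>x. l2_rel x x" unfolding l2_rel_def using L2_const by auto
  show "symp l2_rel" unfolding l2_rel_def by (rule sympI) (auto elim: eventually_mono)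
  show "transp l2_rel" unfolding l2_rel_def 
  proof (rule transpI)
    fix x y z
    assume a: "L2 x \<and> L2 y \<and> (AE t in unit_measure. x t = y t)" 
       and b: "L2 y \<and> L2 z \<and> (AE t in unit_measure. y t = z t)"
    from a b have "AE t in unit_measure. x t = y t \<and> y t = z t" by auto
    then have "AE t in unit_measure. x t = z t" by (rule AE_mp) auto
    with a b show "L2 x \<and> L2 z \<and> (AE t in unit_measure. x t = z t)" by auto
  qed
qed

quotient_type l2 = "cfun" / partial: l2_rel
  by (rule part_equivp_l2_rel)

definition to_l2 :: "cfun \<Rightarrow> l2" where "to_l2 = abs_l2"
definition of_l2 :: "l2 \<Rightarrow> cfun" where "of_l2 = rep_l2"

lemma L2_of_l2: "L2 (of_l2 u)"
  unfolding of_l2_def using Quotient3_rep_reflp[OF Quotient3_l2] by (auto simp: l2_rel_def)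

lemma to_l2_of_l2 [simp]: "to_l2 (of_l2 u) = u"
  unfolding of_l2_def to_l2_def by (rule Quotient3_abs_rep[OF Quotient3_l2])

lemma to_l2_eq_iff:
  assumes "L2 g" "L2 h"
  shows "to_l2 g = to_l2 h \<longleftrightarrow> (AE x in unit_measure. g x = h x)"
proof -
  have "l2_rel g g" "l2_rel h h" using assms by (auto simp: l2_rel_def)
  then have "to_l2 g = to_l2 h \<longleftrightarrow> l2_rel g h"
    unfolding to_l2_def using Quotient3_rel[OF Quotient3_l2, of g h] by auto
  then show ?thesis using assms by (auto simp: l2_rel_def)
qed

lemma to_l2_cong:
  assumes "L2 g" "\<And>x. x \<in> {0..1} \<Longrightarrow> g x = h x"
  shows "to_l2 g = to_l2 h" "L2 h"
proof -
  show L: "L2 h"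
    using assms measurable_cong[of unit_measure g h] L2_measurable[OF assms(1)]
    by (intro L2_cong_AE[OF assms(1)] AE_I2) auto
  show "to_l2 g = to_l2 h" by (subst to_l2_eq_iff[OF assms(1) L]) (use assms(2) in \<open>auto intro!: AE_I2\<close>)
qed

lemma of_l2_to_l2:
  assumes "L2 g"
  shows "AE x in unit_measure. of_l2 (to_l2 g) x = g x"
  using to_l2_eq_iff[OF L2_of_l2[of "to_l2 g"] assms] by simp

lemma l2_cases: obtains g where "L2 g" "u = to_l2 g"
  using L2_of_l2 to_l2_of_l2 by metis

text \<open>A real Hilbert space of complex-valued functions: the pointwise product is the real
  inner product of the plane. Energies, time derivatives and the difference quotients of the
  generator involve real scalars only.\<close>

instantiation l2 :: real_inner
begin

definition zero_l2 :: l2 where "zero_l2 = to_l2 (\<lambda>x. 0)"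
definition plus_l2 :: "l2 \<Rightarrow> l2 \<Rightarrow> l2" where "plus_l2 u v = to_l2 (\<lambda>x. of_l2 u x + of_l2 v x)"
definition uminus_l2 :: "l2 \<Rightarrow> l2" where "uminus_l2 u = to_l2 (\<lambda>x. - of_l2 u x)"
definition minus_l2 :: "l2 \<Rightarrow> l2 \<Rightarrow> l2" where "minus_l2 u v = to_l2 (\<lambda>x. of_l2 u x - of_l2 v x)"
definition scaleR_l2 :: "real \<Rightarrow> l2 \<Rightarrow> l2" where "scaleR_l2 c u = to_l2 (\<lambda>x. c *\<^sub>R of_l2 u x)"
definition inner_l2 :: "l2 \<Rightarrow> l2 \<Rightarrow> real"
  where "inner_l2 u v = (LINT x|unit_measure. inner (of_l2 u x) (of_l2 v x))"
definition norm_l2 :: "l2 \<Rightarrow> real" where "norm_l2 u = sqrt (inner u u)"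
definition sgn_l2 :: "l2 \<Rightarrow> l2" where "sgn_l2 u = inverse (norm u) *\<^sub>R u"
definition dist_l2 :: "l2 \<Rightarrow> l2 \<Rightarrow> real" where "dist_l2 u v = norm (u - v)"
definition uniformity_l2 :: "(l2 \<times> l2) filter"
  where "uniformity_l2 = (INF e\<in>{0<..}. principal {(u, v). dist u v < e})"
definition open_l2 :: "l2 set \<Rightarrow> bool"
  where "open_l2 U \<longleftrightarrow> (\<forall>x\<in>U. \<forall>\<^sub>F (x', y) in uniformity. x' = x \<longrightarrow> y \<in> U)"

lemma to_l2_add: "L2 g \<Longrightarrow> L2 h \<Longrightarrow> to_l2 g + to_l2 h = to_l2 (\<lambda>x. g x + h x)"
  unfolding plus_l2_def
  by (subst to_l2_eq_iff) (use of_l2_to_l2[of g] of_l2_to_l2[of h] in \<open>auto intro!: L2_add L2_of_l2\<close>)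

lemma to_l2_diff: "L2 g \<Longrightarrow> L2 h \<Longrightarrow> to_l2 g - to_l2 h = to_l2 (\<lambda>x. g x - h x)"
  unfolding minus_l2_def
  by (subst to_l2_eq_iff) (use of_l2_to_l2[of g] of_l2_to_l2[of h] in \<open>auto intro!: L2_diff L2_of_l2\<close>)

lemma to_l2_uminus: "L2 g \<Longrightarrow> - to_l2 g = to_l2 (\<lambda>x. - g x)"
  unfolding uminus_l2_def
  by (subst to_l2_eq_iff) (use of_l2_to_l2[of g] in \<open>auto intro!: L2_minus L2_of_l2\<close>)

lemma to_l2_scaleR: "L2 g \<Longrightarrow> c *\<^sub>R to_l2 g = to_l2 (\<lambda>x. c *\<^sub>R g x)"
  unfolding scaleR_l2_def
  by (subst to_l2_eq_iff)
     (use of_l2_to_l2[of g] in \<open>auto intro!: L2_scaleR L2_of_l2 simp del: complex_scaleR\<close>)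

lemma to_l2_inner:
  assumes "L2 g" "L2 h"
  shows "inner (to_l2 g) (to_l2 h) = (LINT x|unit_measure. inner (g x) (h x))"
  unfolding inner_l2_def
proof (rule integral_cong_AE)
  show "(\<lambda>x. inner (of_l2 (to_l2 g) x) (of_l2 (to_l2 h) x)) \<in> borel_measurable unit_measure"
    by (intro borel_measurable_inner L2_measurable L2_of_l2)
  show "(\<lambda>x. inner (g x) (h x)) \<in> borel_measurable unit_measure"
    using assms by (intro borel_measurable_inner L2_measurable)
  show "AE x in unit_measure. inner (of_l2 (to_l2 g) x) (of_l2 (to_l2 h) x) = inner (g x) (h x)"
    using of_l2_to_l2[OF assms(1)] of_l2_to_l2[OF assms(2)] by auto
qed

instance
proof
  fix u v w :: l2 and a b :: real
  obtain f where f: "L2 f" "u = to_l2 f" by (rule l2_cases)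
  obtain g where g: "L2 g" "v = to_l2 g" by (rule l2_cases)
  obtain h where h: "L2 h" "w = to_l2 h" by (rule l2_cases)
  note ops = f g h to_l2_add to_l2_diff to_l2_uminus to_l2_scaleR to_l2_inner zero_l2_def
    L2_add L2_minus L2_diff L2_scaleR L2_const
  show "u + v + w = u + (v + w)" by (simp add: ops add.assoc)
  show "u + v = v + u" by (simp add: ops add.commute)
  show "0 + u = u" "- u + u = 0" "u - v = u + - v"
    by (simp_all add: ops)
  show "a *\<^sub>R (u + v) = a *\<^sub>R u + a *\<^sub>R v" "(a + b) *\<^sub>R u = a *\<^sub>R u + b *\<^sub>R u"
    "a *\<^sub>R b *\<^sub>R u = (a * b) *\<^sub>R u" "1 *\<^sub>R u = u"
    by (simp_all add: ops scaleR_add_right scaleR_add_left del: complex_scaleR)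
  show "dist u v = norm (u - v)" by (rule dist_l2_def)
  show "sgn u = inverse (norm u) *\<^sub>R u" by (simp add: sgn_l2_def)
  show "uniformity = (INF e\<in>{0<..}. principal {(u, v::l2). dist u v < e})" by (rule uniformity_l2_def)
  show "open U \<longleftrightarrow> (\<forall>x\<in>U. \<forall>\<^sub>F (x', y) in uniformity. x' = x \<longrightarrow> y \<in> U)" for U :: "l2 set"
    by (rule open_l2_def)
  show "inner u v = inner v u" unfolding inner_l2_def by (simp add: inner_commute)
  show "inner (u + v) w = inner u w + inner v w"
    by (simp add: ops inner_add_left L2_inner_integrable)
  show "inner (a *\<^sub>R u) v = a * inner u v"
    by (simp add: ops L2_inner_integrable del: complex_scaleR)
  show "inner u u \<ge> 0" unfolding inner_l2_def by (intro Bochner_Integration.integral_nonneg) simp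
  show "(inner u u = 0) = (u = 0)"
  proof -
    have "inner u u = 0 \<longleftrightarrow> (AE x in unit_measure. inner (f x) (f x) = 0)"
      using f integral_nonneg_eq_0_iff_AE[OF L2_inner_integrable[OF f(1) f(1)]] by (simp add: to_l2_inner)
    also have "\<dots> \<longleftrightarrow> u = 0"
      using f to_l2_eq_iff[OF f(1) L2_const[of 0]] by (simp add: zero_l2_def)
    finally show ?thesis .
  qed
  show "norm u = sqrt (inner u u)" by (rule norm_l2_def)
qed

end

lemma to_l2_norm_sq: "L2 g \<Longrightarrow> (norm (to_l2 g))\<^sup>2 = (LINT x|unit_measure. (norm (g x))\<^sup>2)"
  by (simp add: to_l2_inner power2_norm_eq_inner)

text \<open>Cauchy-Schwarz against the constant 1, whose norm is 1 because the interval has length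
  1.\<close>

lemma l2_L1_bound:
  assumes "L2 g"
  shows "integrable unit_measure g" "(LINT x|unit_measure. norm (g x)) \<le> norm (to_l2 g)"
proof -
  show "integrable unit_measure g"
  proof (rule L2_bounded_by[OF assms L2_const[of 1], where c = 1])
    fix x
    show "norm (g x) \<le> 1 * ((norm (g x))\<^sup>2 + (norm (1::complex))\<^sup>2)"
      using sum_squares_bound[of "norm (g x)" 1] norm_ge_zero[of "g x"] by (simp del: norm_ge_zero)
  qed (use assms in \<open>simp add: L2_iff\<close>)
  have "(LINT x|unit_measure. norm (g x))
      = inner (to_l2 (\<lambda>x. complex_of_real (norm (g x)))) (to_l2 (\<lambda>x. 1))"
    using assms by (simp add: to_l2_inner L2_norm L2_const inner_complex_def)
  also have "\<dots> \<le> norm (to_l2 (\<lambda>x. complex_of_real (norm (g x)))) * norm (to_l2 (\<lambda>x. 1))"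
    by (rule norm_cauchy_schwarz)
  also have "norm (to_l2 (\<lambda>x. complex_of_real (norm (g x)))) = norm (to_l2 g)"
    by (rule power2_eq_imp_eq) (use assms in \<open>simp_all add: to_l2_norm_sq L2_norm\<close>)
  also have "norm (to_l2 (\<lambda>x. 1)) = 1"
    by (rule power2_eq_imp_eq) (simp_all add: to_l2_norm_sq L2_const measure_restrict_space)
  finally show "(LINT x|unit_measure. norm (g x)) \<le> norm (to_l2 g)" by simp
qed

text \<open>Riesz-Fischer: a Cauchy sequence is also Cauchy in L1, which provides a subsequence
  converging almost everywhere; its limit is the limit in \<open>l2\<close>.\<close>

instance l2 :: complete_space
proof
  fix X :: "nat \<Rightarrow> l2" assume X: "Cauchy X"
  define s where "s n = of_l2 (X n)" for n
  have L: "L2 (s n)" and Xs: "X n = to_l2 (s n)" for n by (auto simp: s_def L2_of_l2)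
  have nd: "norm (X i - X j) = norm (to_l2 (\<lambda>x. s i x - s j x))" for i j
    using L by (simp add: Xs to_l2_diff)
  have "\<exists>N. \<forall>i\<ge>N. \<forall>j\<ge>N. (LINT x|unit_measure. norm (s i x - s j x)) < e" if "e > 0" for e
  proof -
    have "\<exists>N. \<forall>i\<ge>N. \<forall>j\<ge>N. norm (X i - X j) < e"
      using X that unfolding Cauchy_def dist_norm by blast
    then obtain N where N: "\<And>i j. i \<ge> N \<Longrightarrow> j \<ge> N \<Longrightarrow> norm (X i - X j) < e" by blast
    have "(LINT x|unit_measure. norm (s i x - s j x)) < e" if "i \<ge> N" "j \<ge> N" for i j
      using l2_L1_bound(2)[OF L2_diff[OF L L], of i j] N[OF that] nd[of i j] by simp
    then show ?thesis by blast
  qed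
  then obtain r where r: "strict_mono r" "AE x in unit_measure. Cauchy (\<lambda>i. s (r i) x)"
    using cauchy_L1_AE_cauchy_subseq[of unit_measure s] l2_L1_bound(1)[OF L] by blast
  define g where "g x = lim (\<lambda>i. s (r i) x)" for x
  have gm: "g \<in> borel_measurable unit_measure"
    unfolding g_def by (intro borel_measurable_lim_metric L2_measurable L)
  have conv: "AE x in unit_measure. (\<lambda>i. s (r i) x) \<longlonglongrightarrow> g x"
    using r(2) by (auto simp: g_def Cauchy_convergent_iff convergent_LIMSEQ_iff)
  \<comment> \<open>Fatou's lemma along the almost-everywhere convergent subsequence turns the
    Cauchy bound into a bound for the distance to \<open>g\<close>. Working with nonnegative
    integrals avoids presupposing that \<open>s n - g\<close> is square integrable.\<close>
  have key: "(\<integral>\<^sup>+x. ennreal ((norm (s n x - g x))\<^sup>2) \<partial>unit_measure) \<le> ennreal (e\<^sup>2)"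
    if N: "\<And>j. j \<ge> N \<Longrightarrow> norm (X n - X j) \<le> e" and "e \<ge> 0" for n N e
  proof -
    have "(\<integral>\<^sup>+x. ennreal ((norm (s n x - g x))\<^sup>2) \<partial>unit_measure)
        = (\<integral>\<^sup>+x. liminf (\<lambda>i. ennreal ((norm (s n x - s (r i) x))\<^sup>2)) \<partial>unit_measure)"
    proof (rule nn_integral_cong_AE)
      show "AE x in unit_measure. ennreal ((norm (s n x - g x))\<^sup>2)
        = liminf (\<lambda>i. ennreal ((norm (s n x - s (r i) x))\<^sup>2))"
      proof (rule AE_mp[OF conv AE_I2], rule impI)
        fix x assume "(\<lambda>i. s (r i) x) \<longlonglongrightarrow> g x"
        then have "(\<lambda>i. ennreal ((norm (s n x - s (r i) x))\<^sup>2)) \<longlonglongrightarrow> ennreal ((norm (s n x - g x))\<^sup>2)"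
          by (intro tendsto_ennrealI tendsto_intros)
        then show "ennreal ((norm (s n x - g x))\<^sup>2)
          = liminf (\<lambda>i. ennreal ((norm (s n x - s (r i) x))\<^sup>2))"
          by (rule lim_imp_Liminf[OF trivial_limit_sequentially, symmetric])
      qed
    qed
    also have "\<dots> \<le> liminf (\<lambda>i. \<integral>\<^sup>+x. ennreal ((norm (s n x - s (r i) x))\<^sup>2) \<partial>unit_measure)"
      by (intro nn_integral_liminf measurable_compose[OF L2_measurable[OF L2_diff[OF L L]]]) measurable
    also have "\<dots> \<le> ennreal (e\<^sup>2)"
    proof (rule Liminf_le)
      have "(\<integral>\<^sup>+x. ennreal ((norm (s n x - s (r i) x))\<^sup>2) \<partial>unit_measure) \<le> ennreal (e\<^sup>2)"
        if "i \<ge> N" for i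
      proof -
        have "(\<integral>\<^sup>+x. ennreal ((norm (s n x - s (r i) x))\<^sup>2) \<partial>unit_measure)
           = ennreal ((norm (X n - X (r i)))\<^sup>2)"
          unfolding nd to_l2_norm_sq[OF L2_diff[OF L L]]
          using L2_integrable_norm_sq[OF L2_diff[OF L L]] by (intro nn_integral_eq_integral) auto
        moreover have "norm (X n - X (r i)) \<le> e"
          using N that seq_suble[OF r(1), of i] by (meson order_trans)
        ultimately show ?thesis by (simp add: ennreal_leI power_mono)
      qed
      then show "\<forall>\<^sub>F i in sequentially.
        (\<integral>\<^sup>+x. ennreal ((norm (s n x - s (r i) x))\<^sup>2) \<partial>unit_measure) \<le> ennreal (e\<^sup>2)"
        by (auto simp: eventually_sequentially)
    qed simp
    finally show ?thesis .
  qed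
  have diff_m: "(\<lambda>x. s n x - g x) \<in> borel_measurable unit_measure" for n
    using L2_measurable[OF L] gm by (intro borel_measurable_diff)
  have dL: "L2 (\<lambda>x. s n x - g x) \<and> norm (to_l2 (\<lambda>x. s n x - g x)) \<le> e"
    if N: "\<And>j. j \<ge> N \<Longrightarrow> norm (X n - X j) \<le> e" and e: "e \<ge> 0" for n N e
  proof -
    have 1: "(\<integral>\<^sup>+x. ennreal ((norm (s n x - g x))\<^sup>2) \<partial>unit_measure) \<le> ennreal (e\<^sup>2)"
      by (rule key[of N]) (use that in auto)
    have "integrable unit_measure (\<lambda>x. (norm (s n x - g x))\<^sup>2)"
      using 1 diff_m[of n] by (intro integrableI_nonneg) (auto simp: le_less_trans)
    then have LL: "L2 (\<lambda>x. s n x - g x)" using diff_m by (simp add: L2_iff)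
    have "ennreal ((norm (to_l2 (\<lambda>x. s n x - g x)))\<^sup>2) \<le> ennreal (e\<^sup>2)"
      using 1 L2_integrable_norm_sq[OF LL] by (simp add: to_l2_norm_sq[OF LL] nn_integral_eq_integral)
    then have "norm (to_l2 (\<lambda>x. s n x - g x)) \<le> e"
      using e by (subst (asm) ennreal_le_iff) (auto intro: power2_le_imp_le)
    with LL show ?thesis by blast
  qed
  have ex: "\<exists>N. \<forall>i\<ge>N. \<forall>j\<ge>N. norm (X i - X j) \<le> e" if "e > 0" for e
    using X that unfolding Cauchy_def dist_norm by (meson less_imp_le)
  have gL: "L2 g"
  proof -
    obtain N where "\<And>j. j \<ge> N \<Longrightarrow> norm (X N - X j) \<le> 1" using ex[of 1] by auto
    then have "L2 (\<lambda>x. s N x - g x)" using dL[of N N 1] by simp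
    from L2_diff[OF L[of N] this] show ?thesis by simp
  qed
  have "X \<longlonglongrightarrow> to_l2 g"
  proof (rule LIMSEQ_I)
    fix e :: real assume "e > 0"
    then obtain N where N: "\<And>i j. i \<ge> N \<Longrightarrow> j \<ge> N \<Longrightarrow> norm (X i - X j) \<le> e/2"
      using ex[of "e/2"] by auto
    have "norm (X i - to_l2 g) < e" if "i \<ge> N" for i
    proof -
      have "norm (X i - to_l2 g) \<le> e/2"
        using dL[of N i "e/2"] N[OF that] \<open>e > 0\<close> L gL by (simp add: Xs to_l2_diff)
      with \<open>e > 0\<close> show ?thesis by simp
    qed
    then show "\<exists>no. \<forall>n\<ge>no. norm (X n - to_l2 g) < e" by blast
  qed
  then show "convergent X" by (auto simp: convergent_def)
qed

instance l2 :: banach ..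

section \<open>Strongly continuous semigroups\<close>

text \<open>Baire's theorem: the closed sets on which all operators are bounded by \<open>k\<close>
  cover the space, so one of them contains a ball. A vector of length \<open>e\<close>, the radius,
  is a difference of two points of that ball, which gives the constant
  \<open>2 * k / e\<close>.\<close>

lemma uniform_boundedness:
  fixes L :: "nat \<Rightarrow> 'a::banach \<Rightarrow> 'b::real_normed_vector"
  assumes lin: "\<And>n. bounded_linear (L n)" and bdd: "\<And>x. \<exists>K. \<forall>n. norm (L n x) \<le> K"
  obtains K where "\<And>n x. norm (L n x) \<le> K * norm x"
proof -
  define F where "F k = {x. \<forall>n. norm (L n x) \<le> real k}" for k
  have cl: "closed (F k)" for k
  proof -
    have "closed {x. norm (L n x) \<le> real k}" for n
      by (intro closed_Collect_le continuous_intros linear_continuous_on lin)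
    then have "closed (\<Inter>n. {x. norm (L n x) \<le> real k})" by (intro closed_INT) auto
    moreover have "(\<Inter>n. {x. norm (L n x) \<le> real k}) = F k" by (auto simp: F_def)
    ultimately show ?thesis by simp
  qed
  have un: "\<Union>(range F) = UNIV"
  proof -
    have "x \<in> \<Union>(range F)" for x
    proof -
      obtain K where K: "\<forall>n. norm (L n x) \<le> K" using bdd by blast
      obtain k where "K \<le> real k" using real_arch_simple by blast
      with K have "x \<in> F k" unfolding F_def by (auto intro: order_trans)
      then show ?thesis by blast
    qed
    then show ?thesis by blast
  qed
  have "\<exists>k. interior (F k) \<noteq> {}"
  proof (rule ccontr)
    assume "\<not> ?thesis"
    then have "euclidean interior_of \<Union>(range F) = ({}::'a set)"
      using cl by (intro Baire_category_alt disjI1 completely_metrizable_space_euclidean)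
        (auto simp: interior_of_eq)
    with un show False by (simp add: interior_of_eq)
  qed
  then obtain k x e where e: "e > 0" "cball x e \<subseteq> F k"
    by (metis all_not_in_conv mem_interior_cball)
  have *: "norm (L n y) \<le> (2 * real k / e) * norm y" for n y
  proof (cases "y = 0")
    case True
    then show ?thesis using linear_0[OF bounded_linear.linear[OF lin]] by simp
  next
    case False
    define z where "z = (e / norm y) *\<^sub>R y"
    have nz: "norm z = e" using False e by (simp add: z_def)
    have "x + z \<in> F k" "x \<in> F k" using e nz by (auto simp: dist_norm subset_eq)
    then have "norm (L n (x + z)) \<le> real k" "norm (L n x) \<le> real k" by (auto simp: F_def)
    moreover have "L n z = L n (x + z) - L n x"
      using linear_add[OF bounded_linear.linear[OF lin]] by simp
    ultimately have "norm (L n z) \<le> 2 * real k"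
      using norm_triangle_ineq4[of "L n (x + z)" "L n x"] by simp
    moreover have "norm (L n z) = (e / norm y) * norm (L n y)"
      using linear_scale[OF bounded_linear.linear[OF lin]] e by (simp add: z_def)
    ultimately show ?thesis using False e by (simp add: field_simps)
  qed
  show ?thesis by (rule that[OF *])
qed

locale c0_semigroup =
  fixes S :: "real \<Rightarrow> 'a::banach \<Rightarrow> 'a"
  assumes lin: "\<And>t. t \<ge> 0 \<Longrightarrow> bounded_linear (S t)"
    and S_0 [simp]: "\<And>h. S 0 h = h"
    and S_add: "\<And>s t h. s \<ge> 0 \<Longrightarrow> t \<ge> 0 \<Longrightarrow> S (s + t) h = S s (S t h)"
    and S_tendsto: "\<And>h. ((\<lambda>t. S t h) \<longlongrightarrow> h) (at_right 0)"
begin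

text \<open>The graph of the infinitesimal generator. As a relation it states membership in the
  domain and the value at once, and powers of the domain become chains \<open>generates h y\<close>,
  \<open>generates y w\<close>.\<close>

definition generates :: "'a \<Rightarrow> 'a \<Rightarrow> bool"
  where "generates h y \<longleftrightarrow> ((\<lambda>r. (1 / r) *\<^sub>R (S r h - h)) \<longlongrightarrow> y) (at_right 0)"

lemma S_diff: "t \<ge> 0 \<Longrightarrow> S t (h - k) = S t h - S t k"
  using linear_diff[OF bounded_linear.linear[OF lin]] .

lemma S_scaleR: "t \<ge> 0 \<Longrightarrow> S t (c *\<^sub>R h) = c *\<^sub>R S t h"
  using linear_scale[OF bounded_linear.linear[OF lin]] .

lemma S_near_0:
  assumes "e > 0"
  obtains d where "d > 0" "\<And>r. 0 \<le> r \<Longrightarrow> r < d \<Longrightarrow> norm (S r h - h) < e"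
proof -
  from S_tendsto[of h] assms have "eventually (\<lambda>t. dist (S t h) h < e) (at_right 0)"
    by (rule tendstoD)
  then obtain d where d: "d > 0" "\<And>r. 0 < r \<Longrightarrow> r < d \<Longrightarrow> dist (S r h) h < e"
    by (auto simp: eventually_at_right_field)
  show ?thesis
  proof (rule that[OF d(1)])
    fix r assume "0 \<le> r" "r < d"
    then show "norm (S r h - h) < e"
      using d(2)[of r] assms by (cases "r = 0") (auto simp: dist_norm)
  qed
qed

text \<open>Otherwise there are times tending to 0 along which the operator norms are unbounded.
  Orbits converge at time 0, hence are bounded along these times at every point, and uniform
  boundedness gives a contradiction.\<close>

lemma locally_bounded_0:
  obtains d K where "d > 0" "\<And>t h. 0 \<le> t \<Longrightarrow> t \<le> d \<Longrightarrow> norm (S t h) \<le> K * norm h"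
proof (rule ccontr)
  assume "\<not> thesis"
  then have "\<exists>t h. 0 \<le> t \<and> t \<le> inverse (real (Suc n)) \<and> norm (S t h) > real n * norm h" for n
    using that[of "inverse (real (Suc n))" "real n"] by (force simp: not_le)
  then obtain t h where th: "\<And>n. 0 \<le> t n" "\<And>n. t n \<le> inverse (real (Suc n))"
    "\<And>n. norm (S (t n) (h n)) > real n * norm (h n)"
    by metis
  have "\<exists>K. \<forall>n. norm (S (t n) x) \<le> K" for x
  proof -
    obtain d where d: "d > 0" "\<And>r. 0 \<le> r \<Longrightarrow> r < d \<Longrightarrow> norm (S r x - x) < 1"
      using S_near_0[of 1 x] by auto
    obtain N where N: "inverse (real (Suc N)) < d" using reals_Archimedean d(1) by blast
    have "norm (S (t n) x - x) < 1" if "n \<ge> N" for n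
    proof -
      have "inverse (real (Suc n)) \<le> inverse (real (Suc N))" using that by simp
      with N th(2)[of n] have "t n < d" by linarith
      with d(2) th(1) show ?thesis by blast
    qed
    then have "\<forall>\<^sub>F n in sequentially. norm (S (t n) x) \<le> norm x + 1"
      unfolding eventually_sequentially
      by (intro exI[of _ N]) (smt (verit) norm_triangle_ineq2)
    then have "Bseq (\<lambda>n. S (t n) x)" by (rule BfunI)
    then show ?thesis unfolding Bseq_def by blast
  qed
  then obtain K where K: "\<And>n x. norm (S (t n) x) \<le> K * norm x"
    using uniform_boundedness[of "\<lambda>n. S (t n)"] lin th(1) by metis
  obtain n where "K \<le> real n" using real_arch_simple by blast
  then have "norm (S (t n) (h n)) \<le> real n * norm (h n)"
    using K[of n "h n"] by (meson mult_right_mono norm_ge_zero order_trans)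
  with th(3)[of n] show False by simp
qed

lemma locally_bounded:
  obtains K where "K > 0" "\<And>t h. 0 \<le> t \<Longrightarrow> t \<le> T \<Longrightarrow> norm (S t h) \<le> K * norm h"
proof -
  obtain d K0 where d: "d > 0" and K0: "\<And>t h. 0 \<le> t \<Longrightarrow> t \<le> d \<Longrightarrow> norm (S t h) \<le> K0 * norm h"
    using locally_bounded_0 by metis
  \<comment> \<open>A constant of at least 1 makes \<open>K ^ n\<close> increase with
    \<open>n\<close>, so the bound for \<open>n\<close> steps also covers shorter times.\<close>
  define K where "K = max K0 1"
  have K: "K \<ge> 1" "norm (S t h) \<le> K * norm h" if "0 \<le> t" "t \<le> d" for t h
    using K0[OF that, of h] mult_right_mono[of K0 K "norm h"] by (auto simp: K_def)
  have *: "norm (S t h) \<le> K ^ n * norm h" if "0 \<le> t" "t \<le> real n * d" for n t h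
    using that
  proof (induction n arbitrary: t h)
    case 0
    then show ?case by simp
  next
    case (Suc n)
    show ?case
    proof (cases "t \<le> d")
      case True
      have "norm (S t h) \<le> K * norm h" using K Suc True by blast
      also have "\<dots> \<le> K * (K ^ n * norm h)"
        using K(1)[of 0] d by (intro mult_left_mono mult_le_cancel_right1[THEN iffD2]) auto
      finally show ?thesis by (simp add: mult.assoc)
    next
      case False
      have "S t h = S d (S (t - d) h)" using S_add[of d "t - d" h] d False by simp
      then have "norm (S t h) \<le> K * norm (S (t - d) h)" using K(2)[of d] d by simp
      also have "norm (S (t - d) h) \<le> K ^ n * norm h"
        using Suc False by (intro Suc.IH) (auto simp: algebra_simps)
      finally show ?thesis using K(1)[of 0] d by (simp add: mult.assoc)
    qed
  qed
  obtain n where n: "T / d \<le> real n" using real_arch_simple by blast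
  then have "T \<le> real n * d" using d by (simp add: field_simps)
  then show ?thesis using * K(1)[of 0] d by (intro that[of "K ^ n"]) auto
qed

lemma continuous_orbit: "continuous_on {0..} (\<lambda>t. S t h)"
  unfolding continuous_on_iff
proof (intro ballI allI impI)
  fix t e :: real assume t: "t \<in> {0..}" and e: "e > 0"
  obtain K where K: "K > 0" "\<And>s h. 0 \<le> s \<Longrightarrow> s \<le> t + 1 \<Longrightarrow> norm (S s h) \<le> K * norm h"
    using locally_bounded[of "t + 1"] by blast
  obtain d where d: "d > 0" "\<And>r. 0 \<le> r \<Longrightarrow> r < d \<Longrightarrow> norm (S r h - h) < e / K"
    using S_near_0[of "e / K" h] e K(1) by auto
  have *: "norm (S v h - S u h) < e" if "0 \<le> u" "u \<le> v" "v - u < d" "u \<le> t + 1" for u v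
  proof -
    have "S v h - S u h = S u (S (v - u) h - h)"
      using S_add[of u "v - u" h] that by (simp add: S_diff)
    then have "norm (S v h - S u h) \<le> K * norm (S (v - u) h - h)" using K(2) that by simp
    also have "\<dots> < K * (e / K)" using d(2)[of "v - u"] that K(1) by (intro mult_strict_left_mono) auto
    finally show ?thesis using K(1) by simp
  qed
  show "\<exists>d>0. \<forall>s\<in>{0..}. dist s t < d \<longrightarrow> dist (S s h) (S t h) < e"
  proof (intro exI conjI ballI impI)
    show "min d 1 > 0" using d by simp
    fix s :: real assume "s \<in> {0..}" "dist s t < min d 1"
    then show "dist (S s h) (S t h) < e"
      using *[of s t] *[of t s] t by (cases "s \<le> t") (auto simp: dist_norm abs_if norm_minus_commute split: if_splits)
  qed
qed

lemma continuous_orbit_Icc: "0 \<le> u \<Longrightarrow> continuous_on {u..v} (\<lambda>t. S t h)"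
  by (rule continuous_on_subset[OF continuous_orbit]) auto

lemma generatesD:
  assumes "generates h y" "e > 0"
  obtains d where "d > 0" "\<And>r. 0 \<le> r \<Longrightarrow> r < d \<Longrightarrow> norm (S r h - h - r *\<^sub>R y) \<le> e * r"
proof -
  have "eventually (\<lambda>r. dist ((1 / r) *\<^sub>R (S r h - h)) y < e) (at_right 0)"
    using assms unfolding generates_def by (rule tendstoD)
  then obtain d where d: "d > 0" "\<And>r. 0 < r \<Longrightarrow> r < d \<Longrightarrow> dist ((1 / r) *\<^sub>R (S r h - h)) y < e"
    by (auto simp: eventually_at_right_field)
  show ?thesis
  proof (rule that[OF d(1)])
    fix r assume r: "0 \<le> r" "r < d"
    show "norm (S r h - h - r *\<^sub>R y) \<le> e * r"
    proof (cases "r = 0")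
      case False
      have "S r h - h - r *\<^sub>R y = r *\<^sub>R ((1 / r) *\<^sub>R (S r h - h) - y)"
        using False by (simp add: scaleR_diff_right)
      then have "norm (S r h - h - r *\<^sub>R y) = r * dist ((1 / r) *\<^sub>R (S r h - h)) y"
        using r by (simp add: dist_norm)
      also have "\<dots> \<le> r * e" using d(2)[of r] r False by (intro mult_left_mono) auto
      finally show ?thesis by (simp add: mult.commute)
    qed simp
  qed
qed

text \<open>The generator only provides a derivative from the right at time 0. For both one-sided
  derivatives at \<open>t\<close> the increment is factored at its earlier time \<open>u\<close>, as
  \<open>S u\<close> applied to an increment starting at time 0; the value \<open>S u y\<close> is
  then compared with \<open>S t y\<close> by continuity of the orbit.\<close>

lemma orbit_has_vector_derivative:
  assumes h: "generates h y" and t: "t \<ge> 0"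
  shows "((\<lambda>t. S t h) has_vector_derivative S t y) (at t within {0..})"
  unfolding has_vector_derivative_def has_derivative_within_alt
proof (intro conjI allI impI)
  show "bounded_linear (\<lambda>x. x *\<^sub>R S t y)" by (rule bounded_linear_scaleR_left)
  fix e :: real assume e: "e > 0"
  obtain K where K: "K > 0" "\<And>s h. 0 \<le> s \<Longrightarrow> s \<le> t + 1 \<Longrightarrow> norm (S s h) \<le> K * norm h"
    using locally_bounded[of "t + 1"] by blast
  obtain d1 where d1: "d1 > 0" "\<And>r. 0 \<le> r \<Longrightarrow> r < d1 \<Longrightarrow> norm (S r h - h - r *\<^sub>R y) \<le> (e / (2 * K)) * r"
    using generatesD[OF h, of "e / (2 * K)"] e K(1) by auto
  obtain d2 where d2: "d2 > 0" "\<And>s. s \<in> {0..} \<Longrightarrow> dist s t < d2 \<Longrightarrow> dist (S s y) (S t y) < e / 2"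
    using continuous_orbit[of y] t e unfolding continuous_on_iff by (metis atLeast_iff half_gt_zero)
  have *: "norm (S v h - S u h - (v - u) *\<^sub>R S t y) \<le> e * (v - u)"
    if "0 \<le> u" "u \<le> v" "v - u < d1" "dist u t < d2" "u \<le> t + 1" for u v
  proof -
    have "S v h - S u h - (v - u) *\<^sub>R S t y
        = S u (S (v - u) h - h - (v - u) *\<^sub>R y) + (v - u) *\<^sub>R (S u y - S t y)"
      using S_add[of u "v - u" h] that by (simp add: S_diff S_scaleR scaleR_diff_right)
    then have "norm (S v h - S u h - (v - u) *\<^sub>R S t y)
        \<le> norm (S u (S (v - u) h - h - (v - u) *\<^sub>R y)) + (v - u) * norm (S u y - S t y)"
      using norm_triangle_ineq that by (metis abs_of_nonneg diff_ge_0_iff_ge norm_scaleR)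
    also have "\<dots> \<le> K * norm (S (v - u) h - h - (v - u) *\<^sub>R y) + (v - u) * norm (S u y - S t y)"
      using K(2) that by simp
    also have "\<dots> \<le> K * ((e / (2 * K)) * (v - u)) + (v - u) * (e / 2)"
      using d1(2)[of "v - u"] d2(2)[of u] that K(1)
      by (intro add_mono mult_left_mono) (auto simp: dist_norm)
    also have "\<dots> = e * (v - u)" using K(1) by (simp add: field_simps)
    finally show ?thesis .
  qed
  show "\<exists>d>0. \<forall>s\<in>{0..}. norm (s - t) < d \<longrightarrow>
    norm (S s h - S t h - (s - t) *\<^sub>R S t y) \<le> e * norm (s - t)"
  proof (intro exI conjI ballI impI)
    show "min (min d1 d2) 1 > 0" using d1 d2 by simp
    fix s :: real assume s: "s \<in> {0..}" "norm (s - t) < min (min d1 d2) 1"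
    show "norm (S s h - S t h - (s - t) *\<^sub>R S t y) \<le> e * norm (s - t)"
    proof (cases "s \<le> t")
      case True
      have "S s h - S t h - (s - t) *\<^sub>R S t y = - (S t h - S s h - (t - s) *\<^sub>R S t y)"
        by (simp add: algebra_simps)
      then have "norm (S s h - S t h - (s - t) *\<^sub>R S t y) = norm (S t h - S s h - (t - s) *\<^sub>R S t y)"
        by (metis norm_minus_cancel)
      also have "\<dots> \<le> e * (t - s)" using s True d1(1) by (intro *) (auto simp: dist_norm)
      finally show ?thesis using True by simp
    next
      case False
      then show ?thesis using *[of t s] s t d2(1) by (auto simp: dist_norm)
    qed
  qed
qed

lemma generates_orbit:
  assumes "generates h y" "t \<ge> 0"
  shows "generates (S t h) (S t y)"
proof -
  have "((\<lambda>r. S t ((1 / r) *\<^sub>R (S r h - h))) \<longlongrightarrow> S t y) (at_right 0)"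
    using assms unfolding generates_def by (intro bounded_linear.tendsto[OF lin])
  moreover have "\<forall>\<^sub>F r in at_right 0. S t ((1 / r) *\<^sub>R (S r h - h)) = (1 / r) *\<^sub>R (S r (S t h) - S t h)"
    unfolding eventually_at_right_field
    using assms(2) S_add[of t _ h] S_add[of _ t h]
    by (intro exI[of _ 1]) (auto simp: S_diff S_scaleR add.commute)
  ultimately show ?thesis unfolding generates_def by (rule Lim_transform_eventually)
qed

lemma orbit_increment:
  assumes "generates h y" "0 \<le> u" "u \<le> v"
  shows "((\<lambda>t. S t y) has_integral (S v h - S u h)) {u..v}"
  using assms(2,3)
  by (intro fundamental_theorem_of_calculus
      has_vector_derivative_within_subset[OF orbit_has_vector_derivative[OF assms(1)]]) auto

section \<open>Regularisation of states by averaging along their orbits\<close>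

definition avg :: "real \<Rightarrow> 'a \<Rightarrow> 'a"
  where "avg r h = (1 / r) *\<^sub>R integral {0..r} (\<lambda>s. S s h)"

lemma avg_generated:
  assumes "generates h y" "r > 0"
  shows "avg r y = (1 / r) *\<^sub>R (S r h - h)"
  unfolding avg_def using orbit_increment[OF assms(1), of 0 r] assms(2) by (simp add: integral_unique)

lemma integral_orbit_derivative:
  assumes "t \<ge> 0"
  shows "((\<lambda>t. integral {0..t} (\<lambda>s. S s h)) has_vector_derivative S t h) (at t within {t..})"
proof -
  have "((\<lambda>u. integral {0..u} (\<lambda>s. S s h)) has_vector_derivative S t h) (at t within {0..t+1})"
    using assms by (intro integral_has_vector_derivative continuous_orbit_Icc) auto
  then have "((\<lambda>u. integral {0..u} (\<lambda>s. S s h)) has_vector_derivative S t h) (at t within {t..t+1})"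
    by (rule has_vector_derivative_within_subset) (use assms in auto)
  moreover have "at t within {t..t+1} = at t within {t..}"
    by (rule at_within_nhd[of _ "{t-1<..<t+1}"]) auto
  ultimately show ?thesis by simp
qed

lemma right_derivative_at_0:
  assumes "(f has_vector_derivative y) (at (0::real) within {0..})"
  shows "((\<lambda>r. (1 / r) *\<^sub>R (f r - f 0)) \<longlongrightarrow> y) (at_right 0)"
proof -
  have "(f has_vector_derivative y) (at 0 within {0<..})"
    by (rule has_vector_derivative_within_subset[OF assms]) auto
  then have "((\<lambda>r. (f r - f 0 - (r - 0) *\<^sub>R y) /\<^sub>R norm (r - 0)) \<longlongrightarrow> 0) (at_right 0)"
    unfolding has_vector_derivative_def has_derivative_at_within by blast
  then have "((\<lambda>r. (f r - f 0 - (r - 0) *\<^sub>R y) /\<^sub>R norm (r - 0) + y) \<longlongrightarrow> 0 + y) (at_right 0)"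
    by (intro tendsto_intros)
  moreover have "\<forall>\<^sub>F r in at_right 0. (f r - f 0 - (r - 0) *\<^sub>R y) /\<^sub>R norm (r - 0) + y = (1 / r) *\<^sub>R (f r - f 0)"
    unfolding eventually_at_right_field
    by (intro exI[of _ 1]) (auto simp: scaleR_diff_right divide_inverse)
  ultimately show ?thesis using Lim_transform_eventually by fastforce
qed

text \<open>With \<open>F\<close> the primitive of the orbit, the shift gives
  \<open>S q (F r) = F (r + q) - F q\<close>, and the right-hand side is differentiable at
  \<open>q = 0\<close> for every \<open>h\<close>. Averages thus lie in the domain even when
  \<open>h\<close> does not.\<close>

lemma generates_avg:
  assumes "r > 0"
  shows "generates (avg r h) ((1 / r) *\<^sub>R (S r h - h))"
proof -
  define F where "F t = integral {0..t} (\<lambda>s. S s h)" for t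
  have SF: "S q (F r) = F (r + q) - F q" if "q \<ge> 0" for q
  proof -
    have "S q (F r) = integral {0..r} (\<lambda>s. S q (S s h))"
      unfolding F_def using integral_linear[OF integrable_continuous_real[OF continuous_orbit_Icc] lin[OF that]]
      by (simp add: o_def)
    also have "\<dots> = integral {0..r} (\<lambda>s. S (s + q) h)"
      by (rule integral_cong) (use that in \<open>simp_all add: S_add[symmetric] add.commute\<close>)
    also have "\<dots> = integral {0+q..r+q} (\<lambda>s. S s h)"
      using integral_shift_Icc_real[of 0 r "\<lambda>s. S s h" q] by (simp add: o_def add.commute)
    also have "\<dots> = F (r + q) - F q"
    proof -
      have "integral {0..q} (\<lambda>s. S s h) + integral {q..r+q} (\<lambda>s. S s h) = integral {0..r+q} (\<lambda>s. S s h)"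
        using that assms
        by (intro Henstock_Kurzweil_Integration.integral_combine integrable_continuous_real continuous_orbit_Icc) auto
      then show ?thesis unfolding F_def by (simp add: algebra_simps)
    qed
    finally show ?thesis .
  qed
  have d1: "((\<lambda>q. F (r + q)) has_vector_derivative S r h) (at 0 within {0..})"
  proof -
    have "(F has_vector_derivative S r h) (at (r + 0) within {r..})"
      using integral_orbit_derivative[of r h] assms unfolding F_def by simp
    then have "((F \<circ> (\<lambda>q. r + q)) has_vector_derivative 1 *\<^sub>R S r h) (at 0 within {0..})"
      by (intro vector_diff_chain_within)
         (auto intro!: derivative_eq_intros has_vector_derivative_within_subset[of F _ _ "{r..}"])
    then show ?thesis by (simp add: o_def)
  qed
  have d2: "(F has_vector_derivative h) (at 0 within {0..})"
    using integral_orbit_derivative[of 0 h] unfolding F_def by simp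
  have "((\<lambda>q. F (r + q) - F q) has_vector_derivative S r h - h) (at 0 within {0..})"
    by (rule has_vector_derivative_diff[OF d1 d2])
  from right_derivative_at_0[OF this]
  have "((\<lambda>q. (1 / r) *\<^sub>R ((1 / q) *\<^sub>R (F (r + q) - F q - (F r - F 0)))) \<longlongrightarrow> (1 / r) *\<^sub>R (S r h - h)) (at_right 0)"
    by (intro tendsto_intros) simp
  moreover have "\<forall>\<^sub>F q in at_right 0. (1 / r) *\<^sub>R ((1 / q) *\<^sub>R (F (r + q) - F q - (F r - F 0)))
      = (1 / q) *\<^sub>R (S q (avg r h) - avg r h)"
    unfolding eventually_at_right_field
  proof (intro exI[of _ 1] conjI allI impI)
    fix q :: real assume q: "q > 0" 
    have "avg r h = (1 / r) *\<^sub>R F r" "F 0 = 0" by (simp_all add: avg_def F_def)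
    then show "(1 / r) *\<^sub>R ((1 / q) *\<^sub>R (F (r + q) - F q - (F r - F 0)))
      = (1 / q) *\<^sub>R (S q (avg r h) - avg r h)"
      using q SF[of q] by (simp add: S_scaleR scaleR_diff_right mult.commute)
  qed simp
  ultimately show ?thesis unfolding generates_def by (rule Lim_transform_eventually)
qed

lemma avg_tendsto: "((\<lambda>r. avg r h) \<longlongrightarrow> h) (at_right 0)"
  using right_derivative_at_0[OF integral_orbit_derivative[of 0 h, simplified]] by (simp add: avg_def)

lemma generates_avg_avg:
  assumes "generates h y" "r > 0"
  shows "generates (avg r h) (avg r y)" "\<exists>w. generates (avg r y) w"
  using generates_avg[OF assms(2), of h] generates_avg[OF assms(2), of y] avg_generated[OF assms] by auto

lemma orbit_tendsto_initial: 
  assumes "t \<ge> 0" "(X \<longlongrightarrow> h) F"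
  shows "((\<lambda>r. S t (X r)) \<longlongrightarrow> S t h) F"
  by (rule bounded_linear.tendsto[OF lin[OF assms(1)] assms(2)])

end

section \<open>Dissipative semigroups: decay rates from integrability of the energy\<close>

locale dissipative_semigroup = c0_semigroup S
  for S :: "real \<Rightarrow> 'a::banach \<Rightarrow> 'a" +
  fixes B :: "'a \<Rightarrow> 'a \<Rightarrow> real" and D :: "'a \<Rightarrow> real"
  assumes bil: "bounded_bilinear B"
    and B_sym: "\<And>h k. B h k = B k h"
    and B_nonneg: "\<And>h. B h h \<ge> 0"
    and D_nonneg: "\<And>h. D h \<ge> 0"
    and dissipation: "\<And>h y w. generates h y \<Longrightarrow> generates y w \<Longrightarrow> 2 * B h y = - D h"
begin

lemma continuous_B:
  "continuous_on A u \<Longrightarrow> continuous_on A v \<Longrightarrow> continuous_on A (\<lambda>t. B (u t) (v t))"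
  by (rule bounded_bilinear.continuous_on[OF bil])

lemma B_add_le: "B (h + k) (h + k) \<le> 2 * B h h + 2 * B k k"
proof -
  have "B (h - k) (h - k) \<ge> 0" by (rule B_nonneg)
  then show ?thesis
    by (simp add: bounded_bilinear.add_left[OF bil] bounded_bilinear.add_right[OF bil]
        bounded_bilinear.diff_left[OF bil] bounded_bilinear.diff_right[OF bil] B_sym[of k h])
qed

text \<open>The domain of the square is invariant under the semigroup, so the dissipation identity,
  assumed only there, holds along the whole orbit and can be integrated.\<close>

lemma energy_balance:
  assumes hy: "generates h y" "generates y w" and uv: "0 \<le> u" "u \<le> v"
  shows "((\<lambda>t. D (S t h)) has_integral (B (S u h) (S u h) - B (S v h) (S v h))) {u..v}"
proof -
  have "((\<lambda>t. - D (S t h)) has_integral (B (S v h) (S v h) - B (S u h) (S u h))) {u..v}"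
  proof (rule fundamental_theorem_of_calculus[OF uv(2)])
    fix t assume t: "t \<in> {u..v}"
    then have t0: "t \<ge> 0" using uv by simp
    have d: "((\<lambda>t. S t h) has_vector_derivative S t y) (at t within {u..v})"
      by (rule has_vector_derivative_within_subset[OF orbit_has_vector_derivative[OF hy(1) t0]]) (use uv in auto)
    have "2 * B (S t h) (S t y) = - D (S t h)"
      using dissipation generates_orbit[OF hy(1) t0] generates_orbit[OF hy(2) t0] by blast
    with bounded_bilinear.has_vector_derivative[OF bil d d]
    show "((\<lambda>t. B (S t h) (S t h)) has_vector_derivative - D (S t h)) (at t within {u..v})"
      by (simp add: B_sym[of "S t y" "S t h"])
  qed
  from has_integral_neg[OF this] show ?thesis by simp
qed

lemma domain2_dense:
  assumes "e > 0"
  obtains h' y w where "generates h' y" "generates y w" "norm (h' - h) < e"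
proof -
  have ev: "\<forall>\<^sub>F r in at_right 0. norm (avg r k - k) < e / 2" for k
    using tendstoD[OF avg_tendsto[of k], of "e/2"] assms by (simp add: dist_norm)
  obtain r where r: "r > 0" "norm (avg r h - h) < e / 2"
    using ev[of h] unfolding eventually_at_right_field by (metis dense)
  obtain r' where r': "r' > 0" "norm (avg r' (avg r h) - avg r h) < e / 2"
    using ev[of "avg r h"] unfolding eventually_at_right_field by (metis dense)
  have "norm (avg r' (avg r h) - h) < e"
    using norm_triangle_ineq[of "avg r' (avg r h) - avg r h" "avg r h - h"] r r' by simp
  with generates_avg_avg[OF generates_avg[OF r(1), of h] r'(1)] that show ?thesis by metis
qed

text \<open>The balance is available on the domain of the square only; the inequality itself
  involves no derivative, both sides are continuous in the state, and so it passes to the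
  closure.\<close>

lemma energy_decreasing_0:
  assumes "t \<ge> 0"
  shows "B (S t h) (S t h) \<le> B h h"
proof -
  have "\<exists>h'. B (S t h') (S t h') \<le> B h' h' \<and> norm (h' - h) < inverse (real (Suc n))" for n
  proof -
    obtain h' y w where h': "generates h' y" "generates y w" "norm (h' - h) < inverse (real (Suc n))"
      by (rule domain2_dense[of "inverse (real (Suc n))" h]) auto
    have "B h' h' - B (S t h') (S t h') \<ge> 0"
      using has_integral_nonneg[OF energy_balance[OF h'(1,2) order_refl assms]] D_nonneg by simp
    with h'(3) show ?thesis by auto
  qed
  then obtain X where X: "\<And>n. B (S t (X n)) (S t (X n)) \<le> B (X n) (X n)"
    "\<And>n. norm (X n - h) < inverse (real (Suc n))" by metis
  have lim: "X \<longlonglongrightarrow> h"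
    by (rule LIM_zero_cancel, rule Lim_null_comparison[OF _ LIMSEQ_inverse_real_of_nat])
       (use X(2) in \<open>auto intro!: always_eventually less_imp_le\<close>)
  have "(\<lambda>n. B (S t (X n)) (S t (X n))) \<longlonglongrightarrow> B (S t h) (S t h)" "(\<lambda>n. B (X n) (X n)) \<longlonglongrightarrow> B h h"
    by (intro bounded_bilinear.tendsto[OF bil] orbit_tendsto_initial assms lim)+
  then show ?thesis using X(1) by (intro LIMSEQ_le) auto
qed

lemma energy_decreasing:
  assumes "0 \<le> u" "u \<le> v"
  shows "B (S v h) (S v h) \<le> B (S u h) (S u h)"
  using energy_decreasing_0[of "v - u" "S u h"] S_add[of "v - u" u h] assms by simp

lemma continuous_energy: "0 \<le> u \<Longrightarrow> continuous_on {u..v} (\<lambda>t. B (S t h) (S t h))"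
  by (intro continuous_B continuous_orbit_Icc)

lemma integrable_energy: "0 \<le> u \<Longrightarrow> (\<lambda>t. B (S t h) (S t h)) integrable_on {u..v}"
  by (intro integrable_continuous_real continuous_energy)

text \<open>Averaging an orbit over a short time commutes with the generator and gains one power of its
  domain, so an estimate on a smaller domain extends to a larger one.\<close>

lemma integral_energy_extend:
  assumes C: "\<And>r. r > 0 \<Longrightarrow> integral {0..T} (\<lambda>t. B (S t (avg r h)) (S t (avg r h)))
      \<le> C * (B (avg r h) (avg r h) + B (avg r y) (avg r y))"
    and T: "T \<ge> 0"
  shows "integral {0..T} (\<lambda>t. B (S t h) (S t h)) \<le> 2 * C * (B h h + B y y)"
proof -
  \<comment> \<open>The remainder \<open>h - avg r h\<close> contributes a term proportional to
    \<open>T\<close>. This is harmless: \<open>T\<close> is fixed while \<open>r\<close> tends to 0,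
    and the surviving constant \<open>2 * C\<close> does not depend on \<open>T\<close>.\<close>
  have le: "integral {0..T} (\<lambda>t. B (S t h) (S t h))
    \<le> 2 * (C * (B (avg r h) (avg r h) + B (avg r y) (avg r y))) + 2 * T * B (h - avg r h) (h - avg r h)"
    if r: "r > 0" for r
  proof -
    have "integral {0..T} (\<lambda>t. B (S t h) (S t h))
      \<le> integral {0..T} (\<lambda>t. 2 * B (S t (avg r h)) (S t (avg r h)) + 2 * B (h - avg r h) (h - avg r h))"
    proof (rule integral_le)
      show "(\<lambda>t. 2 * B (S t (avg r h)) (S t (avg r h)) + 2 * B (h - avg r h) (h - avg r h)) integrable_on {0..T}"
        by (intro integrable_continuous_real continuous_intros continuous_energy) simp
      fix t assume t: "t \<in> {0..T}"
      have "S t h = S t (avg r h) + S t (h - avg r h)" using t by (simp add: S_diff)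
      then have "B (S t h) (S t h) \<le> 2 * B (S t (avg r h)) (S t (avg r h)) + 2 * B (S t (h - avg r h)) (S t (h - avg r h))"
        using B_add_le by metis
      with energy_decreasing_0[of t "h - avg r h"] t
      show "B (S t h) (S t h) \<le> 2 * B (S t (avg r h)) (S t (avg r h)) + 2 * B (h - avg r h) (h - avg r h)"
        by simp
    qed (simp add: integrable_energy)
    also have "\<dots> = 2 * integral {0..T} (\<lambda>t. B (S t (avg r h)) (S t (avg r h))) + 2 * T * B (h - avg r h) (h - avg r h)"
      using T by (subst Henstock_Kurzweil_Integration.integral_add)
         (auto intro!: integrable_on_mult_right integrable_energy)
    also have "\<dots> \<le> 2 * (C * (B (avg r h) (avg r h) + B (avg r y) (avg r y))) + 2 * T * B (h - avg r h) (h - avg r h)"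
      using C[OF r] by simp
    finally show ?thesis .
  qed
  have "((\<lambda>r. 2 * (C * (B (avg r h) (avg r h) + B (avg r y) (avg r y))) + 2 * T * B (h - avg r h) (h - avg r h))
    \<longlongrightarrow> 2 * (C * (B h h + B y y)) + 2 * T * B (h - h) (h - h)) (at_right 0)"
    by (intro tendsto_intros bounded_bilinear.tendsto[OF bil] avg_tendsto)
  moreover have "\<forall>\<^sub>F r in at_right 0. integral {0..T} (\<lambda>t. B (S t h) (S t h))
    \<le> 2 * (C * (B (avg r h) (avg r h) + B (avg r y) (avg r y))) + 2 * T * B (h - avg r h) (h - avg r h)"
    unfolding eventually_at_right_field using le by (intro exI[of _ 1]) auto
  ultimately have "integral {0..T} (\<lambda>t. B (S t h) (S t h)) \<le> 2 * (C * (B h h + B y y)) + 2 * T * B (h - h) (h - h)"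
    by (intro tendsto_lowerbound) auto
  then show ?thesis by (simp add: bounded_bilinear.zero_left[OF bil])
qed

text \<open>By monotonicity, \<open>t / 2\<close> times the energy at time \<open>t\<close> is at
  most its integral over \<open>{t/2..t}\<close>, which is a piece of the tail of a convergent
  integral.\<close>

theorem energy_decay_domain:
  assumes bound: "\<And>T. T \<ge> 0 \<Longrightarrow> integral {0..T} (\<lambda>t. B (S t h) (S t h)) \<le> C"
  shows "((\<lambda>t. t * B (S t h) (S t h)) \<longlongrightarrow> 0) at_top"
proof -
  define I where "I T = integral {0..T} (\<lambda>t. B (S t h) (S t h))" for T
  have split: "I v = I u + integral {u..v} (\<lambda>t. B (S t h) (S t h))" if "0 \<le> u" "u \<le> v" for u v
    unfolding I_def using that
    by (intro Henstock_Kurzweil_Integration.integral_combine[symmetric] integrable_energy) auto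
  have mono: "I u \<le> I v" if "0 \<le> u" "u \<le> v" for u v
    using split[OF that] integral_nonneg[OF integrable_energy[OF that(1)]] B_nonneg by simp
  define L where "L = (SUP T\<in>{0..}. I T)"
  have bdd: "bdd_above (I ` {0..})" using bound unfolding I_def by (intro bdd_aboveI[of _ C]) auto
  have IL: "I u \<le> L" if "u \<ge> 0" for u unfolding L_def using bdd that by (intro cSUP_upper) auto
  have "\<exists>N. \<forall>t\<ge>N. \<bar>t * B (S t h) (S t h)\<bar> < e" if e: "e > 0" for e
  proof -
    have "\<exists>u\<in>{0..}. L - e / 2 < I u"
      using less_cSUP_iff[of "{0..}" I "L - e/2"] bdd e unfolding L_def by auto
    then obtain u where u: "u \<ge> 0" "I u > L - e / 2" by auto
    have "\<bar>t * B (S t h) (S t h)\<bar> < e" if t: "t \<ge> 2 * u" for t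
    proof -
      have t0: "t \<ge> 0" "t / 2 \<le> t" "u \<le> t / 2" using t u by auto
      have "(t - t / 2) * B (S t h) (S t h) = integral {t/2..t} (\<lambda>s. B (S t h) (S t h))"
        using t0 by simp
      also have "\<dots> \<le> integral {t/2..t} (\<lambda>s. B (S s h) (S s h))"
        using t0 by (intro integral_le integrable_energy energy_decreasing) auto
      also have "\<dots> = I t - I (t / 2)" using split[of "t/2" t] t0 by simp
      also have "\<dots> < e / 2" using IL[of t] mono[of u "t/2"] u t0 by linarith
      finally have "t * B (S t h) (S t h) < e" by (simp add: field_simps)
      moreover have "t * B (S t h) (S t h) \<ge> 0" using t0 B_nonneg by simp
      ultimately show ?thesis by simp
    qed
    then show ?thesis by blast
  qed
  then show ?thesis
    by (simp add: tendsto_iff eventually_at_top_linorder)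
qed

theorem energy_decay:
  assumes C: "\<And>h y T. generates h y \<Longrightarrow> T \<ge> 0 \<Longrightarrow>
      integral {0..T} (\<lambda>t. B (S t h) (S t h)) \<le> C h y"
  shows "((\<lambda>t. B (S t h) (S t h)) \<longlongrightarrow> 0) at_top"
proof -
  have "\<exists>N. \<forall>t\<ge>N. B (S t h) (S t h) < e" if e: "e > 0" for e
  proof -
    have "((\<lambda>r. B (h - avg r h) (h - avg r h)) \<longlongrightarrow> B (h - h) (h - h)) (at_right 0)"
      by (intro tendsto_intros bounded_bilinear.tendsto[OF bil] avg_tendsto)
    \<comment> \<open>A quarter of the tolerance for the regularised orbit and a quarter for the
      remainder, since \<open>B_add_le\<close> doubles both.\<close>
    then have "\<forall>\<^sub>F r in at_right 0. B (h - avg r h) (h - avg r h) < e / 4"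
      using e by (intro order_tendstoD(2)) (auto simp: bounded_bilinear.zero_left[OF bil])
    then obtain r where r: "r > 0" "B (h - avg r h) (h - avg r h) < e / 4"
      unfolding eventually_at_right_field by (metis dense)
    obtain y where y: "generates (avg r h) y" using generates_avg[OF r(1)] by blast
    have "((\<lambda>t. t * B (S t (avg r h)) (S t (avg r h))) \<longlongrightarrow> 0) at_top"
      using energy_decay_domain C[OF y] by blast
    then have "\<forall>\<^sub>F t in at_top. t * B (S t (avg r h)) (S t (avg r h)) < e / 4"
      using e by (intro order_tendstoD(2)) auto
    then obtain N where N: "\<And>t. t \<ge> N \<Longrightarrow> t * B (S t (avg r h)) (S t (avg r h)) < e / 4"
      by (auto simp: eventually_at_top_linorder)
    have "B (S t h) (S t h) < e" if t: "t \<ge> max N 1" for t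
    proof -
      have "S t h = S t (avg r h) + S t (h - avg r h)" using t by (simp add: S_diff)
      then have "B (S t h) (S t h) \<le> 2 * B (S t (avg r h)) (S t (avg r h)) + 2 * B (S t (h - avg r h)) (S t (h - avg r h))"
        using B_add_le by metis
      moreover have "B (S t (avg r h)) (S t (avg r h)) \<le> t * B (S t (avg r h)) (S t (avg r h))"
        using t B_nonneg[of "S t (avg r h)"] mult_right_mono[of 1 t "B (S t (avg r h)) (S t (avg r h))"] by simp
      ultimately show ?thesis
        using N[of t] energy_decreasing_0[of t "h - avg r h"] r(2) t by simp
    qed
    then show ?thesis by blast
  qed
  then show ?thesis
    using B_nonneg by (simp add: tendsto_iff eventually_at_top_linorder)
qed

end

section \<open>Volterra operators on the unit interval\<close>

lemma L2_set_integrable: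
  assumes "L2 g" "{a..b} \<subseteq> {0..1}"
  shows "set_integrable lborel {a..b} g"
proof -
  have "set_integrable lborel {0..1} g"
    using l2_L1_bound(1)[OF assms(1)] by (simp add: set_integrable_def integrable_restrict_space)
  then show ?thesis by (rule set_integrable_subset) (use assms in auto)
qed

text \<open>The bridge to the gauge integral, in which the fundamental theorem of calculus and the
  additivity over adjacent intervals are used from here on.\<close>

lemma L2_integrable:
  assumes "L2 g" "{a..b} \<subseteq> {0..1}"
  shows "g integrable_on {a..b}" "(LINT s:{a..b}|lborel. g s) = integral {a..b} g"
  using set_borel_integral_eq_integral[OF L2_set_integrable[OF assms]] by auto

lemma unit_integral_eq:
  fixes f :: "real \<Rightarrow> 'b::euclidean_space"
  assumes "integrable unit_measure f"
  shows "(LINT x|unit_measure. f x) = integral {0..1} f"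
proof -
  have "set_integrable lborel {0..1} f"
    using assms by (simp add: set_integrable_def integrable_restrict_space)
  from set_borel_integral_eq_integral(2)[OF this] show ?thesis
    by (simp add: set_integral_unit_measure)
qed

lemma L2_norm_integrable:
  assumes "L2 g" "{a..b} \<subseteq> {0..1}"
  shows "(\<lambda>x. norm (g x)) integrable_on {a..b}"
  using set_borel_integral_eq_integral(1)[OF set_integrable_norm[OF L2_set_integrable[OF assms]]] by simp

lemma L2_norm_integral_le:
  assumes "L2 g" "{a..b} \<subseteq> {0..1}"
  shows "integral {a..b} (\<lambda>x. norm (g x)) \<le> norm (to_l2 g)"
proof -
  have "integral {a..b} (\<lambda>x. norm (g x)) \<le> integral {0..1} (\<lambda>x. norm (g x))"
    using assms by (intro integral_subset_le L2_norm_integrable) auto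
  also have "\<dots> = (LINT x|unit_measure. norm (g x))"
    using l2_L1_bound(1)[OF assms(1)] by (intro unit_integral_eq[symmetric]) simp
  also have "\<dots> \<le> norm (to_l2 g)" by (rule l2_L1_bound(2)[OF assms(1)])
  finally show ?thesis .
qed

lemma L2_integral_norm_le:
  assumes "L2 g" "{a..b} \<subseteq> {0..1}"
  shows "norm (integral {a..b} g) \<le> norm (to_l2 g)"
proof -
  have "norm (integral {a..b} g) \<le> integral {a..b} (\<lambda>x. norm (g x))"
    using assms by (intro integral_norm_bound_integral L2_integrable L2_norm_integrable) auto
  also have "\<dots> \<le> norm (to_l2 g)" by (rule L2_norm_integral_le[OF assms])
  finally show ?thesis .
qed

text \<open>Makes the integral operators below independent of the representative chosen by
  \<open>of_l2\<close>.\<close>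

lemma L2_integral_cong:
  assumes "L2 g" "L2 h" "to_l2 g = to_l2 h" "{a..b} \<subseteq> {0..1}"
  shows "integral {a..b} g = integral {a..b} h"
proof -
  have "norm (integral {a..b} (\<lambda>x. g x - h x)) \<le> norm (to_l2 (\<lambda>x. g x - h x))"
    by (intro L2_integral_norm_le L2_diff assms)
  also have "\<dots> = 0" using assms to_l2_diff[of g h] by simp
  finally show ?thesis
    using assms by (simp add: Henstock_Kurzweil_Integration.integral_diff L2_integrable)
qed

lemma continuous_forward:
  "L2 g \<Longrightarrow> continuous_on {0..1} (\<lambda>x. integral {0..x} g)"
  by (intro indefinite_integral_continuous_1 L2_integrable) auto

lemma continuous_backward:
  "L2 g \<Longrightarrow> continuous_on {0..1} (\<lambda>x. integral {x..1} g)"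
  by (intro indefinite_integral_continuous_1' L2_integrable) auto

lemma norm_to_l2_le:
  assumes "L2 g" "\<And>x. x \<in> {0..1} \<Longrightarrow> norm (g x) \<le> c"
  shows "norm (to_l2 g) \<le> c"
proof (rule power2_le_imp_le)
  show c: "c \<ge> 0" using assms(2)[of 0] norm_ge_zero[of "g 0"] by (simp del: norm_ge_zero)
  have "(norm (to_l2 g))\<^sup>2 = (LINT x|unit_measure. (norm (g x))\<^sup>2)" by (rule to_l2_norm_sq[OF assms(1)])
  also have "\<dots> \<le> (LINT x|unit_measure. c\<^sup>2)"
    using assms finite_measure.integrable_const[OF finite_measure_unit]
    by (intro integral_mono L2_integrable_norm_sq power_mono) auto
  also have "\<dots> = c\<^sup>2" by (simp add: measure_restrict_space)
  finally show "(norm (to_l2 g))\<^sup>2 \<le> c\<^sup>2" .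
qed

text \<open>The clamped values vanish, so \<open>fwd\<close> inverts differentiation there without
  boundary terms; \<open>bwd\<close> starts at the tip and leaves the tip values behind as
  \<open>cst\<close> terms.\<close>

definition fwd :: "l2 \<Rightarrow> l2" where "fwd u = to_l2 (\<lambda>x. integral {0..x} (of_l2 u))"
definition bwd :: "l2 \<Rightarrow> l2" where "bwd u = to_l2 (\<lambda>x. integral {x..1} (of_l2 u))"
definition mul :: "(real \<Rightarrow> real) \<Rightarrow> l2 \<Rightarrow> l2" where "mul h u = to_l2 (\<lambda>x. h x *\<^sub>R of_l2 u x)"
definition cst :: "complex \<Rightarrow> l2" where "cst c = to_l2 (\<lambda>x. c)"

lemma fwd_to_l2: "L2 g \<Longrightarrow> fwd (to_l2 g) = to_l2 (\<lambda>x. integral {0..x} g)"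
  unfolding fwd_def
  by (rule to_l2_cong(1)[OF L2_continuous[OF continuous_forward[OF L2_of_l2]]])
     (rule L2_integral_cong, auto simp: L2_of_l2)

lemma bwd_to_l2: "L2 g \<Longrightarrow> bwd (to_l2 g) = to_l2 (\<lambda>x. integral {x..1} g)"
  unfolding bwd_def
  by (rule to_l2_cong(1)[OF L2_continuous[OF continuous_backward[OF L2_of_l2]]])
     (rule L2_integral_cong, auto simp: L2_of_l2)

lemma L2_mult_continuous:
  assumes "continuous_on {0..1} (h :: real \<Rightarrow> real)" "L2 g"
  shows "L2 (\<lambda>x. h x *\<^sub>R g x)"
proof -
  obtain C where "\<And>x. x \<in> {0..1} \<Longrightarrow> norm (h x) \<le> C" using continuous_unit_bounded[OF assms(1)] by blast
  then have "L2 (\<lambda>x. complex_of_real (h x) * g x)"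
    using assms by (intro L2_bounded_mult[where C = C] measurable_unit_continuous continuous_intros) auto
  then show ?thesis by (simp add: scaleR_conv_of_real)
qed

lemma mul_to_l2:
  assumes "continuous_on {0..1} h" "L2 g"
  shows "mul h (to_l2 g) = to_l2 (\<lambda>x. h x *\<^sub>R g x)"
  unfolding mul_def
  using of_l2_to_l2[OF assms(2)] assms
  by (subst to_l2_eq_iff) (auto intro!: L2_mult_continuous L2_of_l2 elim!: eventually_mono simp del: complex_scaleR)

lemma bounded_linear_fwd: "bounded_linear fwd"
proof (rule bounded_linear_intro[where K = 1])
  fix u v :: l2 and c :: real
  obtain f where f: "L2 f" "u = to_l2 f" by (rule l2_cases)
  obtain g where g: "L2 g" "v = to_l2 g" by (rule l2_cases)
  note [simp] = fwd_to_l2 to_l2_add to_l2_scaleR L2_add L2_scaleR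
  have L: "L2 (\<lambda>x. integral {0..x} f)" "L2 (\<lambda>x. integral {0..x} g)"
    by (intro L2_continuous continuous_forward f g)+
  show "fwd (u + v) = fwd u + fwd v"
  proof -
    have "fwd (u + v) = to_l2 (\<lambda>x. integral {0..x} (\<lambda>s. f s + g s))" using f g by simp
    also have "\<dots> = to_l2 (\<lambda>x. integral {0..x} f + integral {0..x} g)"
      by (rule to_l2_cong(1)[OF L2_continuous[OF continuous_forward[OF L2_add[OF f(1) g(1)]]]])
         (auto intro!: Henstock_Kurzweil_Integration.integral_add L2_integrable f g)
    finally show ?thesis using f g L by simp
  qed
  show "fwd (c *\<^sub>R u) = c *\<^sub>R fwd u"
    using f L by (simp del: complex_scaleR)
  show "norm (fwd u) \<le> norm u * 1"
    using f by (simp, intro norm_to_l2_le L L2_integral_norm_le) auto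
qed

lemma bounded_linear_bwd: "bounded_linear bwd"
proof (rule bounded_linear_intro[where K = 1])
  fix u v :: l2 and c :: real
  obtain f where f: "L2 f" "u = to_l2 f" by (rule l2_cases)
  obtain g where g: "L2 g" "v = to_l2 g" by (rule l2_cases)
  note [simp] = bwd_to_l2 to_l2_add to_l2_scaleR L2_add L2_scaleR
  have L: "L2 (\<lambda>x. integral {x..1} f)" "L2 (\<lambda>x. integral {x..1} g)"
    by (intro L2_continuous continuous_backward f g)+
  show "bwd (u + v) = bwd u + bwd v"
  proof -
    have "bwd (u + v) = to_l2 (\<lambda>x. integral {x..1} (\<lambda>s. f s + g s))" using f g by simp
    also have "\<dots> = to_l2 (\<lambda>x. integral {x..1} f + integral {x..1} g)"
      by (rule to_l2_cong(1)[OF L2_continuous[OF continuous_backward[OF L2_add[OF f(1) g(1)]]]])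
         (auto intro!: Henstock_Kurzweil_Integration.integral_add L2_integrable f g)
    finally show ?thesis using f g L by simp
  qed
  show "bwd (c *\<^sub>R u) = c *\<^sub>R bwd u"
    using f L by (simp del: complex_scaleR)
  show "norm (bwd u) \<le> norm u * 1"
    using f by (simp, intro norm_to_l2_le L L2_integral_norm_le) auto
qed

lemma norm_mul_le:
  assumes h: "continuous_on {0..1} h" and H: "\<And>x. x \<in> {0..1} \<Longrightarrow> \<bar>h x\<bar> \<le> H"
  shows "norm (mul h u) \<le> H * norm u"
proof -
  obtain f where f: "L2 f" "u = to_l2 f" by (rule l2_cases)
  have H0: "H \<ge> 0" using H[of 0] by simp
  have "(norm (mul h u))\<^sup>2 = (LINT x|unit_measure. (norm (h x *\<^sub>R f x))\<^sup>2)"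
    using f h by (simp add: mul_to_l2 to_l2_norm_sq L2_mult_continuous del: complex_scaleR norm_scaleR)
  also have "\<dots> \<le> (LINT x|unit_measure. H\<^sup>2 * (norm (f x))\<^sup>2)"
  proof (rule integral_mono)
    show "integrable unit_measure (\<lambda>x. (norm (h x *\<^sub>R f x))\<^sup>2)"
      by (intro L2_integrable_norm_sq L2_mult_continuous f h)
    show "integrable unit_measure (\<lambda>x. H\<^sup>2 * (norm (f x))\<^sup>2)"
      by (intro integrable_mult_right L2_integrable_norm_sq f)
    fix x assume "x \<in> space unit_measure"
    then have "\<bar>h x\<bar> * norm (f x) \<le> H * norm (f x)" using H by (intro mult_right_mono) auto
    then have "(\<bar>h x\<bar> * norm (f x))\<^sup>2 \<le> (H * norm (f x))\<^sup>2" by (intro power_mono) auto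
    then show "(norm (h x *\<^sub>R f x))\<^sup>2 \<le> H\<^sup>2 * (norm (f x))\<^sup>2"
      by (simp add: power_mult_distrib norm_mult)
  qed
  also have "\<dots> = (H * norm u)\<^sup>2" using f by (simp add: to_l2_norm_sq power_mult_distrib)
  finally show ?thesis by (rule power2_le_imp_le) (use H0 in simp)
qed

lemma bounded_linear_mul:
  assumes h: "continuous_on {0..1} h"
  shows "bounded_linear (mul h)"
proof -
  obtain C where C: "\<And>x. x \<in> {0..1} \<Longrightarrow> norm (h x) \<le> C" using continuous_unit_bounded[OF h] by blast
  show ?thesis
  proof (rule bounded_linear_intro[where K = C])
    fix u v :: l2 and c :: real
    obtain f where f: "L2 f" "u = to_l2 f" by (rule l2_cases)
    obtain g where g: "L2 g" "v = to_l2 g" by (rule l2_cases)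
    note [simp] = mul_to_l2 to_l2_add to_l2_scaleR L2_add L2_scaleR L2_mult_continuous
    show "mul h (u + v) = mul h u + mul h v"
      using f g h by (simp add: scaleR_add_right del: complex_scaleR)
    show "mul h (c *\<^sub>R u) = c *\<^sub>R mul h u"
      using f h by (simp add: mult.commute del: complex_scaleR)
    show "norm (mul h u) \<le> norm u * C"
      using norm_mul_le[OF h, of C u] C by (simp add: mult.commute)
  qed
qed

lemma inner_mul_commute:
  assumes h: "continuous_on {0..1} h"
  shows "inner (mul h u) v = inner (mul h v) u"
proof -
  obtain f where f: "L2 f" "u = to_l2 f" by (rule l2_cases)
  obtain g where g: "L2 g" "v = to_l2 g" by (rule l2_cases)
  have "inner (h x *\<^sub>R f x) (g x) = inner (h x *\<^sub>R g x) (f x)" for x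
    by (simp add: inner_commute del: complex_scaleR)
  then show ?thesis using f g h
    by (simp add: mul_to_l2 to_l2_inner L2_mult_continuous del: complex_scaleR inner_scaleR_left)
qed

lemma bounded_linear_cst: "bounded_linear cst"
proof (rule bounded_linear_intro[where K = 1])
  fix c d :: complex and r :: real
  show "cst (c + d) = cst c + cst d" by (simp add: cst_def to_l2_add L2_const)
  show "cst (r *\<^sub>R c) = r *\<^sub>R cst c" by (simp add: cst_def to_l2_scaleR L2_const)
  show "norm (cst c) \<le> norm c * 1" by (simp add: cst_def norm_to_l2_le L2_const)
qed

section \<open>Volterra representation of differentiable functions\<close>

lemma derivative_imp_continuous_on:
  assumes "\<And>x. x \<in> A \<Longrightarrow> (f has_vector_derivative f' x) (at x within A)"
  shows "continuous_on A f"
  using has_vector_derivative_continuous[OF assms] by (simp add: continuous_on_eq_continuous_within)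

lemma FTC_unit:
  fixes f :: "real \<Rightarrow> 'b::banach"
  assumes "\<And>x. x \<in> {0..1} \<Longrightarrow> (f has_vector_derivative f' x) (at x within {0..1})"
    and "0 \<le> a" "a \<le> b" "b \<le> 1"
  shows "(f' has_integral (f b - f a)) {a..b}"
  using assms(2-4)
  by (intro fundamental_theorem_of_calculus has_vector_derivative_within_subset[OF assms(1)]) auto

lemma to_l2_backward:
  assumes d: "\<And>x. x \<in> {0..1} \<Longrightarrow> (f has_vector_derivative f' x) (at x within {0..1})"
    and c: "continuous_on {0..1} f'"
  shows "to_l2 f = cst (f 1) - bwd (to_l2 f')"
proof -
  have L: "L2 f'" "L2 f"
    by (rule L2_continuous[OF c], rule L2_continuous[OF derivative_imp_continuous_on[OF d]])
  have "cst (f 1) - bwd (to_l2 f') = to_l2 (\<lambda>x. f 1 - integral {x..1} f')"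
    by (simp add: cst_def bwd_to_l2 L to_l2_diff L2_const L2_continuous continuous_backward)
  also have "\<dots> = to_l2 f"
  proof (rule to_l2_cong(1)[symmetric, OF L(2)])
    fix x :: real assume "x \<in> {0..1}"
    then show "f x = f 1 - integral {x..1} f'"
      using FTC_unit[OF d, of x 1] by (simp add: integral_unique)
  qed
  finally show ?thesis by simp
qed

lemma to_l2_forward:
  assumes d: "\<And>x. x \<in> {0..1} \<Longrightarrow> (f has_vector_derivative f' x) (at x within {0..1})"
    and c: "continuous_on {0..1} f'" and "f 0 = 0"
  shows "to_l2 f = fwd (to_l2 f')"
proof -
  have L: "L2 f'" "L2 f"
    by (rule L2_continuous[OF c], rule L2_continuous[OF derivative_imp_continuous_on[OF d]])
  show ?thesis unfolding fwd_to_l2[OF L(1)]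
  proof (rule to_l2_cong(1)[OF L(2)])
    fix x :: real assume "x \<in> {0..1}"
    then show "f x = integral {0..x} f'"
      using FTC_unit[OF d, of 0 x] assms(3) by (simp add: integral_unique)
  qed
qed

text \<open>The comparison function \<open>(1 - x) ^ n / fact n\<close> is the \<open>n\<close>-fold
  backward integral of 1. A pointwise bound is needed for the factorial, and since an element of
  \<open>l2\<close> is a class, some representative has to satisfy it.\<close>

definition tip_bounded :: "nat \<Rightarrow> real \<Rightarrow> l2 \<Rightarrow> bool"
  where "tip_bounded n c u \<longleftrightarrow>
    (\<exists>g. L2 g \<and> u = to_l2 g \<and> (\<forall>x\<in>{0..1}. norm (g x) \<le> c * (1 - x) ^ n / fact n))"

lemma tip_bounded_bwd_0: "tip_bounded 0 (norm u) (bwd u)"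
  unfolding tip_bounded_def bwd_def
proof (intro exI[of _ "\<lambda>x. integral {x..1} (of_l2 u)"] conjI refl ballI)
  show "L2 (\<lambda>x. integral {x..1} (of_l2 u))" by (intro L2_continuous continuous_backward L2_of_l2)
  fix x :: real assume "x \<in> {0..1}"
  then show "norm (integral {x..1} (of_l2 u)) \<le> norm u * (1 - x) ^ 0 / fact 0"
    using L2_integral_norm_le[OF L2_of_l2[of u], of x 1] by simp
qed

lemma tip_bounded_bwd:
  assumes "tip_bounded n c u"
  shows "tip_bounded (Suc n) c (bwd u)"
proof -
  obtain g where g: "L2 g" "u = to_l2 g" "\<And>x. x\<in>{0..1} \<Longrightarrow> norm (g x) \<le> c * (1 - x) ^ n / fact n"
    using assms unfolding tip_bounded_def by blast
  show ?thesis unfolding tip_bounded_def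
  proof (intro exI[of _ "\<lambda>x. integral {x..1} g"] conjI ballI)
    show "L2 (\<lambda>x. integral {x..1} g)" by (intro L2_continuous continuous_backward g)
    show "bwd u = to_l2 (\<lambda>x. integral {x..1} g)" by (simp add: g bwd_to_l2)
    fix x :: real assume x: "x \<in> {0..1}"
    \<comment> \<open>Primitive of the comparison function, normalised to vanish at the tip, so that
      \<open>F 1 - F x\<close> is exactly the next comparison function at \<open>x\<close>.\<close>
    define F where "F s = - (c * (1 - s) ^ Suc n / fact (Suc n))" for s
    have "(F has_vector_derivative c * (1 - s) ^ n / fact n) (at s within {x..1})" for s
    proof -
      have "((\<lambda>s. 1 - s) has_real_derivative - 1) (at s within {x..1})"
        by (auto intro!: derivative_eq_intros)
      from DERIV_power[OF this, of "Suc n"]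
      have "(F has_real_derivative - (c * (real (Suc n) * (- 1 * (1 - s) ^ n)) / fact (Suc n))) (at s within {x..1})"
        unfolding F_def by (intro DERIV_minus DERIV_cdivide DERIV_cmult) simp
      moreover have "- (c * (real (Suc n) * (- 1 * p)) / fact (Suc n)) = c * p / fact n" for p
      proof -
        have "- (c * (real (Suc n) * (- 1 * p)) / fact (Suc n)) = (real (Suc n) * (c * p)) / fact (Suc n)"
          by (simp add: mult.left_commute del: of_nat_Suc fact_Suc)
        also have "\<dots> = (real (Suc n) * (c * p)) / (real (Suc n) * fact n)" by simp
        also have "\<dots> = c * p / fact n" by (simp del: of_nat_Suc)
        finally show ?thesis .
      qed
      ultimately show ?thesis by (simp add: has_real_derivative_iff_has_vector_derivative)
    qed
    then have I: "((\<lambda>s. c * (1 - s) ^ n / fact n) has_integral (F 1 - F x)) {x..1}"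
      using x by (intro fundamental_theorem_of_calculus) auto
    have "norm (integral {x..1} g) \<le> integral {x..1} (\<lambda>s. c * (1 - s) ^ n / fact n)"
      using g(3) x I by (intro integral_norm_bound_integral L2_integrable g) auto
    also have "\<dots> = F 1 - F x" by (rule integral_unique[OF I])
    also have "\<dots> = c * (1 - x) ^ Suc n / fact (Suc n)" by (simp add: F_def)
    finally show "norm (integral {x..1} g) \<le> c * (1 - x) ^ Suc n / fact (Suc n)" .
  qed
qed

lemma tip_bounded_mul:
  assumes "tip_bounded n c u" and h: "continuous_on {0..1} h" "\<And>x. x \<in> {0..1} \<Longrightarrow> \<bar>h x\<bar> \<le> H"
  shows "tip_bounded n (H * c) (mul h u)"
proof -
  obtain g where g: "L2 g" "u = to_l2 g" "\<And>x. x\<in>{0..1} \<Longrightarrow> norm (g x) \<le> c * (1 - x) ^ n / fact n"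
    using assms unfolding tip_bounded_def by blast
  have H0: "H \<ge> 0" using h(2)[of 0] by simp
  show ?thesis unfolding tip_bounded_def
  proof (intro exI[of _ "\<lambda>x. h x *\<^sub>R g x"] conjI ballI)
    show "L2 (\<lambda>x. h x *\<^sub>R g x)" by (intro L2_mult_continuous g h)
    show "mul h u = to_l2 (\<lambda>x. h x *\<^sub>R g x)" by (simp add: g mul_to_l2 h)
    fix x :: real assume x: "x \<in> {0..1}"
    have "norm (h x *\<^sub>R g x) = \<bar>h x\<bar> * norm (g x)" by (rule norm_scaleR)
    also have "\<dots> \<le> H * (c * (1 - x) ^ n / fact n)"
      using g(3)[OF x] h(2)[OF x] H0 by (intro mult_mono) auto
    finally show "norm (h x *\<^sub>R g x) \<le> H * c * (1 - x) ^ n / fact n" by (simp add: mult.assoc)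
  qed
qed

lemma tip_bounded_uminus: "tip_bounded n c u \<Longrightarrow> tip_bounded n c (- u)"
  unfolding tip_bounded_def
  by (metis (no_types, lifting) L2_minus norm_minus_cancel to_l2_uminus)

lemma tip_bounded_mono:
  assumes "tip_bounded n c u" "c \<le> d"
  shows "tip_bounded n d u"
proof -
  obtain g where g: "L2 g" "u = to_l2 g" "\<And>x. x\<in>{0..1} \<Longrightarrow> norm (g x) \<le> c * (1 - x) ^ n / fact n"
    using assms(1) unfolding tip_bounded_def by blast
  have "norm (g x) \<le> d * (1 - x) ^ n / fact n" if "x \<in> {0..1}" for x
  proof -
    have "c * (1 - x) ^ n / fact n \<le> d * (1 - x) ^ n / fact n"
      using assms(2) that by (intro divide_right_mono mult_right_mono) auto
    with g(3)[OF that] show ?thesis by linarith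
  qed
  with g show ?thesis unfolding tip_bounded_def by blast
qed

lemma tip_bounded_norm:
  assumes "tip_bounded n c u"
  shows "norm u \<le> c / fact n"
proof -
  obtain g where g: "L2 g" "u = to_l2 g" "\<And>x. x\<in>{0..1} \<Longrightarrow> norm (g x) \<le> c * (1 - x) ^ n / fact n"
    using assms unfolding tip_bounded_def by blast
  have "norm (g 0) \<le> c / fact n" using g(3)[of 0] by simp
  then have "0 \<le> c / fact n" by (rule order_trans[OF norm_ge_zero])
  then have c: "c \<ge> 0" using fact_gt_zero[of n, where ?'a = real] by (simp only: zero_le_divide_iff) linarith
  have "norm (g x) \<le> c / fact n" if x: "x \<in> {0..1}" for x
  proof -
    have "c * (1 - x) ^ n / fact n \<le> c * 1 / fact n"
      using x c by (intro divide_right_mono mult_left_mono power_le_one) auto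
    then show ?thesis using g(3)[OF x] by simp
  qed
  then show ?thesis unfolding g(2) by (intro norm_to_l2_le g)
qed

text \<open>Each factor contains four backward integrations. The very first one is spent on passing
  from the \<open>l2\<close> norm to a pointwise bound with exponent 0, which leaves
  \<open>4 * (k + 1) - 1 = 4 * k + 3\<close> of them for the factorial; the weights contribute
  \<open>H\<^sup>2\<close> per factor.\<close>

lemma volterra_iterate_bound:
  assumes h1: "continuous_on {0..1} h1" "\<And>x. x \<in> {0..1} \<Longrightarrow> \<bar>h1 x\<bar> \<le> H"
    and h2: "continuous_on {0..1} h2" "\<And>x. x \<in> {0..1} \<Longrightarrow> \<bar>h2 x\<bar> \<le> H"
  shows "norm (((\<lambda>u. - bwd (bwd (mul h1 (bwd (bwd (mul h2 u)))))) ^^ Suc k) u)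
    \<le> (H\<^sup>2) ^ Suc k / fact (4 * k + 3) * norm u"
proof -
  define K where "K = (\<lambda>u. - bwd (bwd (mul h1 (bwd (bwd (mul h2 u))))))"
  have H0: "H \<ge> 0" using h1(2)[of 0] by simp
  have "tip_bounded (4 * k + 3) ((H\<^sup>2) ^ Suc k * norm u) ((K ^^ Suc k) u)"
  proof (induction k)
    case 0
    have "tip_bounded (Suc (Suc (Suc 0))) (H * norm (mul h2 u)) (K u)"
      unfolding K_def
      by (intro tip_bounded_uminus tip_bounded_bwd tip_bounded_mul tip_bounded_bwd_0 h1)
    moreover have "H * norm (mul h2 u) \<le> (H\<^sup>2) ^ Suc 0 * norm u"
      using norm_mul_le[OF h2] H0 by (simp add: power2_eq_square mult.assoc mult_left_mono)
    ultimately show ?case using tip_bounded_mono by (simp add: numeral_3_eq_3)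
  next
    case (Suc k)
    have "tip_bounded (Suc (Suc (Suc (Suc n)))) (H * (H * c)) (K w)" if "tip_bounded n c w" for n c w
      unfolding K_def by (intro tip_bounded_uminus tip_bounded_bwd tip_bounded_mul h1 h2 that)
    from this[OF Suc] show ?case by (simp add: power2_eq_square mult.assoc)
  qed
  from tip_bounded_norm[OF this] show ?thesis by (simp add: K_def)
qed

text \<open>Uniqueness of weak derivatives. The sets over which the difference integrates to zero
  contain the half-lines and are closed under complements and disjoint countable unions; hence they
  include all Borel sets, and the difference vanishes almost everywhere.\<close>

lemma L2_eq_if_primitives_eq:
  assumes "L2 g" "L2 h" and eq: "\<And>x. x \<in> {0..1} \<Longrightarrow> integral {0..x} g = integral {0..x} h"
  shows "to_l2 g = to_l2 h"
proof -
  define d where "d x = g x - h x" for x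
  have Ld: "L2 d" unfolding d_def by (intro L2_diff assms)
  have zero: "integral {0..x} d = 0" if "x \<in> {0..1}" for x
    unfolding d_def using that eq[OF that]
    by (subst Henstock_Kurzweil_Integration.integral_diff) (auto intro!: L2_integrable assms)
  \<comment> \<open>Extension by zero to the whole line, where the half-lines \<open>{..a}\<close>
    form an intersection-stable generator of the Borel sets.\<close>
  define D where "D x = indicator {0..1} x *\<^sub>R d x" for x
  have DI: "integrable lborel D"
    using L2_set_integrable[OF Ld, of 0 1] by (simp add: D_def[abs_def] set_integrable_def)
  have DS: "set_integrable lborel A D" if "A \<in> sets borel" for A
    unfolding set_integrable_def using that DI by (intro integrable_mult_indicator) auto
  have atMost: "(LINT x:{..a}|lborel. D x) = 0" for a
  proof -
    have "(LINT x:{..a}|lborel. D x) = (LINT x:{0..min a 1}|lborel. d x)"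
      unfolding set_lebesgue_integral_def D_def
      by (intro Bochner_Integration.integral_cong) (auto simp: indicator_def)
    also have "\<dots> = integral {0..min a 1} d" by (rule L2_integrable[OF Ld]) auto
    also have "\<dots> = 0" by (cases "a \<ge> 0") (auto intro: zero)
    finally show ?thesis .
  qed
  have total: "(LINT x:UNIV|lborel. D x) = 0"
  proof -
    have "(LINT x:UNIV|lborel. D x) = (LINT x:{..1}|lborel. D x)"
      unfolding set_lebesgue_integral_def D_def
      by (intro Bochner_Integration.integral_cong) (auto simp: indicator_def)
    then show ?thesis by (simp add: atMost)
  qed
  have sets_eq: "sets (borel :: real measure) = sigma_sets UNIV (range (\<lambda>a. {..a}))"
    by (subst borel_eq_atMost) (auto simp: sets_measure_of_conv)
  have all: "(LINT x:A|lborel. D x) = 0" if "A \<in> sigma_sets UNIV (range (\<lambda>a::real. {..a}))" for A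
  proof -
    have "Int_stable (range (\<lambda>a::real. {..a}))" by (auto simp: Int_stable_def)
    moreover have "range (\<lambda>a::real. {..a}) \<subseteq> Pow UNIV" by simp
    ultimately show ?thesis using that
  proof (induction rule: sigma_sets_induct_disjoint)
    case (basic A)
    then show ?case using atMost by auto
  next
    case empty
    then show ?case by (simp add: set_lebesgue_integral_def)
  next
    case (compl A)
    then have A: "A \<in> sets borel" by (simp add: sets_eq)
    have "(LINT x:A \<union> (UNIV - A)|lborel. D x) = (LINT x:A|lborel. D x) + (LINT x:UNIV - A|lborel. D x)"
      using A by (intro set_integral_Un DS) auto
    then show ?case using compl total by (simp add: Un_absorb1 )
  next
    case (union A)
    have "A i \<in> sets borel" for i using union(2) by (auto simp: sets_eq)
    then have "(LINT x:(\<Union>i. A i)|lborel. D x) = (\<Sum>i. LINT x:A i|lborel. D x)"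
      using union(1) by (intro lebesgue_integral_countable_add DS) (auto simp: disjoint_family_on_def)
    then show ?case using union by simp
  qed
  qed
  have "AE x in lborel. D x = 0"
    by (rule sigma_finite_measure.density_zero[OF sigma_finite_lborel DI]) (use all in \<open>simp add: sets_eq\<close>)
  then have "AE x in lborel. x \<in> {0..1} \<longrightarrow> d x = 0"
    by (rule AE_mp) (auto simp: D_def)
  then have "AE x in unit_measure. d x = 0" by (simp add: AE_restrict_space_iff)
  then have "AE x in unit_measure. g x = h x" by (rule AE_mp) (auto simp: d_def)
  then show ?thesis by (subst to_l2_eq_iff[OF assms(1,2)])
qed

text \<open>The difference of both sides has derivative zero: over an interval of length \<^term>\<open>r\<close> it grows by
  at most a multiple of \<^term>\<open>r\<close> times the integral of \<^term>\<open>norm \<circ> g\<close> over that interval.\<close>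

lemma absolutely_continuous_by_parts:
  assumes g: "L2 g" and h: "\<And>x. x \<in> {0..1} \<Longrightarrow> (h has_vector_derivative h' x) (at x within {0..1})"
    and h': "continuous_on {0..1} (h' :: real \<Rightarrow> real)" and x: "x \<in> {0..1}"
  shows "((\<lambda>s. h s *\<^sub>R g s + h' s *\<^sub>R integral {0..s} g) has_integral h x *\<^sub>R integral {0..x} g) {0..x}"
proof -
  define G where "G s = integral {0..s} g" for s
  have cG: "continuous_on {0..1} G" unfolding G_def by (rule continuous_forward[OF g])
  have ch: "continuous_on {0..1} h" by (rule derivative_imp_continuous_on[OF h])
  define k where "k s = h s *\<^sub>R g s + h' s *\<^sub>R G s" for s
  have Lk: "L2 k"
    unfolding k_def by (intro L2_add L2_mult_continuous g ch h' L2_continuous[OF cG])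
  define N where "N s = integral {0..s} (\<lambda>s. norm (g s))" for s
  have cN: "continuous_on {0..1} N"
    unfolding N_def by (intro indefinite_integral_continuous_1 L2_norm_integrable g) auto
  obtain H where H: "H > 0" "\<And>x. x \<in> {0..1} \<Longrightarrow> norm (h' x) \<le> H"
    using continuous_unit_bounded[OF h'] by blast
  define \<Phi> where "\<Phi> s = integral {0..s} k - h s *\<^sub>R G s" for s
  have hlip: "\<bar>h s - h r\<bar> \<le> H * (v - u)" if "0 \<le> u" "v \<le> 1" "s \<in> {u..v}" "r \<in> {u..v}" "r \<le> s" for s r u v
  proof -
    have "(h' has_integral (h s - h r)) {r..s}" using that by (intro FTC_unit[OF h]) auto
    then have "norm (h s - h r) \<le> H * measure lborel {r..s}"
      using that H by (intro has_integral_bound_real[OF _ finite.emptyI]) auto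
    then have "norm (h s - h r) \<le> H * (s - r)" using that by simp
    also have "\<dots> \<le> H * (v - u)" using that H by (intro mult_left_mono) auto
    finally show ?thesis by simp
  qed
  have key: "norm (\<Phi> v - \<Phi> u) \<le> 2 * H * (v - u) * (N v - N u)" if uv: "0 \<le> u" "u \<le> v" "v \<le> 1" for u v
  proof -
    have sub: "{u..v} \<subseteq> {0..1}" "{0..v} \<subseteq> {0..1}" "{0..u} \<subseteq> {0..1}" using uv by auto
    have split: "integral {0..v} w = integral {0..u} w + integral {u..v} w" if "L2 w" for w
      using uv Henstock_Kurzweil_Integration.integral_combine[of 0 u v w] L2_integrable(1)[OF that sub(2)] by simp
    have Nuv: "N v - N u = integral {u..v} (\<lambda>s. norm (g s))"
      unfolding N_def using uv Henstock_Kurzweil_Integration.integral_combine[of 0 u v "\<lambda>s. norm (g s)"]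
        L2_norm_integrable[OF g sub(2)] by simp
    have Gs: "norm (G s - G u) \<le> N v - N u" if s: "s \<in> {u..v}" for s
    proof -
      have "G s - G u = integral {u..s} g"
        unfolding G_def using s uv Henstock_Kurzweil_Integration.integral_combine[of 0 u s g]
          L2_integrable(1)[OF g, of 0 s] by (auto simp: algebra_simps)
      also have "norm \<dots> \<le> integral {u..s} (\<lambda>s. norm (g s))"
        using s uv by (intro integral_norm_bound_integral L2_integrable L2_norm_integrable g) auto
      also have "\<dots> \<le> integral {u..v} (\<lambda>s. norm (g s))"
        using s uv by (intro integral_subset_le L2_norm_integrable g) auto
      finally show ?thesis by (simp add: Nuv)
    qed
    \<comment> \<open>Freezing \<open>h\<close> at the right end and \<open>G\<close> at the left
      end gives a comparison integrand that can be integrated exactly: its integral is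
      \<open>h v *\<^sub>R G v - h u *\<^sub>R G u\<close>, the increment of the product.\<close>
    have i1: "((\<lambda>s. h v *\<^sub>R g s) has_integral h v *\<^sub>R (G v - G u)) {u..v}"
      using split[OF g] integrable_integral[OF L2_integrable(1)[OF g sub(1)]]
      by (intro has_integral_cmul) (simp add: G_def)
    have i2: "((\<lambda>s. h' s *\<^sub>R G u) has_integral (h v - h u) *\<^sub>R G u) {u..v}"
      using uv by (intro has_integral_scaleR_left FTC_unit[OF h]) auto
    have i3: "(k has_integral (integral {0..v} k - integral {0..u} k)) {u..v}"
      using split[OF Lk] integrable_integral[OF L2_integrable(1)[OF Lk sub(1)]] by simp
    have "((\<lambda>s. k s - (h v *\<^sub>R g s + h' s *\<^sub>R G u)) has_integral
        (integral {0..v} k - integral {0..u} k - (h v *\<^sub>R (G v - G u) + (h v - h u) *\<^sub>R G u))) {u..v}"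
      by (intro has_integral_diff has_integral_add i1 i2 i3)
    also have "integral {0..v} k - integral {0..u} k - (h v *\<^sub>R (G v - G u) + (h v - h u) *\<^sub>R G u) = \<Phi> v - \<Phi> u"
      by (simp add: \<Phi>_def algebra_simps)
    also have "(\<lambda>s. k s - (h v *\<^sub>R g s + h' s *\<^sub>R G u)) = (\<lambda>s. (h s - h v) *\<^sub>R g s + h' s *\<^sub>R (G s - G u))"
      by (simp add: k_def algebra_simps fun_eq_iff)
    finally have I: "((\<lambda>s. (h s - h v) *\<^sub>R g s + h' s *\<^sub>R (G s - G u)) has_integral (\<Phi> v - \<Phi> u)) {u..v}" .
    have "norm (\<Phi> v - \<Phi> u) = norm (integral {u..v} (\<lambda>s. (h s - h v) *\<^sub>R g s + h' s *\<^sub>R (G s - G u)))"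
      using I by (simp add: integral_unique)
    also have "\<dots> \<le> integral {u..v} (\<lambda>s. H * (v - u) * norm (g s) + H * (N v - N u))"
    proof (rule integral_norm_bound_integral)
      show "(\<lambda>s. (h s - h v) *\<^sub>R g s + h' s *\<^sub>R (G s - G u)) integrable_on {u..v}"
        using I by blast
      show "(\<lambda>s. H * (v - u) * norm (g s) + H * (N v - N u)) integrable_on {u..v}"
        by (intro Henstock_Kurzweil_Integration.integrable_add integrable_on_mult_right L2_norm_integrable g sub integrable_const_ivl)
      fix s assume s: "s \<in> {u..v}"
      have "norm ((h s - h v) *\<^sub>R g s + h' s *\<^sub>R (G s - G u))
          \<le> \<bar>h s - h v\<bar> * norm (g s) + \<bar>h' s\<bar> * norm (G s - G u)"
        using norm_triangle_ineq[of "(h s - h v) *\<^sub>R g s" "h' s *\<^sub>R (G s - G u)"] by (simp only: norm_scaleR)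
      also have "\<dots> \<le> H * (v - u) * norm (g s) + H * (N v - N u)"
        using hlip[of u v v s] uv s H Gs[OF s] by (intro add_mono mult_mono) (auto simp: abs_minus_commute)
      finally show "norm ((h s - h v) *\<^sub>R g s + h' s *\<^sub>R (G s - G u)) \<le> H * (v - u) * norm (g s) + H * (N v - N u)" .
    qed
    also have "\<dots> = H * (v - u) * (N v - N u) + (v - u) * (H * (N v - N u))"
      using uv by (subst Henstock_Kurzweil_Integration.integral_add)
        (auto intro!: integrable_on_mult_right L2_norm_integrable g sub simp: Nuv)
    finally show ?thesis by (simp add: algebra_simps)
  qed
  have "(\<Phi> has_derivative (\<lambda>_. 0)) (at t within {0..1})" if t: "t \<in> {0..1}" for t
    unfolding has_derivative_within_alt
  proof (intro conjI allI impI)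
    fix e :: real assume e: "e > 0"
    \<comment> \<open>Continuity of \<open>N\<close> at \<open>t\<close> makes the bound in
      \<open>key\<close> little-o of the interval length, even where \<open>g\<close> has no value
      that could serve as a derivative of \<open>G\<close>.\<close>
    obtain d where d: "d > 0" "\<And>s. s \<in> {0..1} \<Longrightarrow> dist s t < d \<Longrightarrow> dist (N s) (N t) < e / (2 * H)"
      using cN t e H(1) unfolding continuous_on_iff by (metis divide_pos_pos mult_pos_pos zero_less_numeral)
    show "\<exists>d>0. \<forall>s\<in>{0..1}. norm (s - t) < d \<longrightarrow> norm (\<Phi> s - \<Phi> t - 0) \<le> e * norm (s - t)"
    proof (intro exI[of _ d] conjI ballI impI d(1))
      fix s assume s: "s \<in> {0..1::real}" "norm (s - t) < d"
      have Nd: "\<bar>N s - N t\<bar> \<le> e / (2 * H)" using d(2)[of s] s by (auto simp: dist_norm)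
      have "norm (\<Phi> s - \<Phi> t) \<le> 2 * H * \<bar>s - t\<bar> * \<bar>N s - N t\<bar>"
      proof (cases "t \<le> s")
        case True
        have "norm (\<Phi> s - \<Phi> t) \<le> 2 * H * (s - t) * (N s - N t)" using key[of t s] True s t by auto
        also have "\<dots> \<le> 2 * H * \<bar>s - t\<bar> * \<bar>N s - N t\<bar>" using True H by (simp add: mult_left_mono)
        finally show ?thesis .
      next
        case False
        have "norm (\<Phi> s - \<Phi> t) \<le> 2 * H * (t - s) * (N t - N s)"
          using key[of s t] False s t by (auto simp: norm_minus_commute)
        also have "\<dots> \<le> 2 * H * \<bar>s - t\<bar> * \<bar>N s - N t\<bar>" using False H by (simp add: mult_left_mono)
        finally show ?thesis .
      qed
      also have "\<dots> \<le> 2 * H * \<bar>s - t\<bar> * (e / (2 * H))" using Nd H by (intro mult_left_mono) auto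
      also have "\<dots> = e * norm (s - t)" using H by simp
      finally show "norm (\<Phi> s - \<Phi> t - 0) \<le> e * norm (s - t)" by simp
    qed
  qed simp
  then have "\<exists>c. \<forall>s\<in>{0..1}. \<Phi> s = c"
    by (intro has_derivative_zero_constant) auto
  then have "\<Phi> x = \<Phi> 0" using x by force
  then have "integral {0..x} k = h x *\<^sub>R G x" by (simp add: \<Phi>_def G_def)
  moreover have "k integrable_on {0..x}" using x by (intro L2_integrable Lk) auto
  ultimately show ?thesis unfolding k_def G_def by (metis (no_types, lifting) integrable_integral)
qed

section \<open>Averages over short time windows\<close>

text \<open>Windows open forward, so functions on the half-line suffice; the price is that a bound
  up to \<open>T\<close> uses data up to \<open>T + \<tau>\<close>. The average of a derivative is
  the quotient \<open>tquot\<close>, so averaging exchanges time derivatives for differences that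
  the function itself controls.\<close>

definition tavg :: "real \<Rightarrow> (real \<Rightarrow> 'a::banach) \<Rightarrow> real \<Rightarrow> 'a"
  where "tavg \<tau> u t = (1 / \<tau>) *\<^sub>R integral {t..t + \<tau>} u"

definition tquot :: "real \<Rightarrow> (real \<Rightarrow> 'a::real_vector) \<Rightarrow> real \<Rightarrow> 'a"
  where "tquot \<tau> u t = (1 / \<tau>) *\<^sub>R (u (t + \<tau>) - u t)"

text \<open>A squared L2 norm in time, for functions with values in any normed space; the physical
  energy corresponds to the form \<open>B\<close>.\<close>

definition energy :: "real \<Rightarrow> (real \<Rightarrow> 'a::real_normed_vector) \<Rightarrow> real"
  where "energy T u = integral {0..T} (\<lambda>t. (norm (u t))\<^sup>2)"

lemma continuous_on_Icc: "continuous_on {0..} u \<Longrightarrow> 0 \<le> a \<Longrightarrow> continuous_on {a..b::real} u"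
  by (rule continuous_on_subset) auto

lemma integrable_Icc:
  "continuous_on {0..} u \<Longrightarrow> 0 \<le> a \<Longrightarrow> (u::real \<Rightarrow> 'a::banach) integrable_on {a..b}"
  by (intro integrable_continuous_real continuous_on_Icc)

lemma continuous_norm_sq:
  "continuous_on A u \<Longrightarrow> continuous_on A (\<lambda>t. (norm (u t))\<^sup>2)"
  by (intro continuous_intros)

lemma integrable_norm_sq:
  "continuous_on {0..} u \<Longrightarrow> 0 \<le> a \<Longrightarrow> (\<lambda>t. (norm (u t))\<^sup>2) integrable_on {a..b::real}"
  by (intro integrable_Icc continuous_norm_sq)

lemma integral_nonneg_real:
  assumes "\<And>x. x \<in> A \<Longrightarrow> (f x :: real) \<ge> 0"
  shows "integral A f \<ge> 0"
  using assms by (cases "f integrable_on A") (auto intro: integral_nonneg simp: not_integrable_integral)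

lemma energy_nonneg: "energy T u \<ge> 0"
  unfolding energy_def by (rule integral_nonneg_real) auto

lemma energy_cong: "(\<And>t. 0 \<le> t \<Longrightarrow> u t = v t) \<Longrightarrow> energy T u = energy T v"
  unfolding energy_def by (intro integral_cong) auto

lemma energy_mono_time:
  assumes "continuous_on {0..} u" "0 \<le> T" "T \<le> T'"
  shows "energy T u \<le> energy T' u"
  unfolding energy_def using assms
  by (intro integral_subset_le integrable_norm_sq) auto

lemma energy_le:
  assumes "continuous_on {0..} u" "continuous_on {0..} v"
    and "\<And>t. 0 \<le> t \<Longrightarrow> norm (u t) \<le> c * norm (v t)"
  shows "energy T u \<le> c\<^sup>2 * energy T v"
proof -
  have "energy T u \<le> integral {0..T} (\<lambda>t. c\<^sup>2 * (norm (v t))\<^sup>2)"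
    unfolding energy_def
  proof (rule integral_le)
    fix t assume "t \<in> {0..T}"
    then have "(norm (u t))\<^sup>2 \<le> (c * norm (v t))\<^sup>2" using assms(3) by (intro power_mono) auto
    then show "(norm (u t))\<^sup>2 \<le> c\<^sup>2 * (norm (v t))\<^sup>2" by (simp add: power_mult_distrib)
  qed (use assms in \<open>auto intro!: integrable_on_mult_right integrable_norm_sq\<close>)
  then show ?thesis by (simp add: energy_def)
qed

lemma norm_add_sq_le:
  fixes x y :: "'a::real_normed_vector"
  assumes "s > 0"
  shows "(norm (x + y))\<^sup>2 \<le> (1 + s) * (norm x)\<^sup>2 + (1 + 1 / s) * (norm y)\<^sup>2"
proof -
  have "(norm (x + y))\<^sup>2 \<le> (norm x + norm y)\<^sup>2"
    by (intro power_mono norm_triangle_ineq) simp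
  also have "\<dots> = (norm x)\<^sup>2 + (norm y)\<^sup>2 + 2 * (norm x * norm y)"
    by (simp add: power2_sum)
  also have "2 * (norm x * norm y) \<le> s * (norm x)\<^sup>2 + (norm y)\<^sup>2 / s"
  proof -
    have "0 \<le> (s * norm x - norm y)\<^sup>2 / s" using assms by simp
    also have "\<dots> = s * (norm x)\<^sup>2 + (norm y)\<^sup>2 / s - 2 * (norm x * norm y)"
      using assms by (simp add: field_simps power2_eq_square)
    finally show ?thesis by simp
  qed
  finally show ?thesis by (simp add: algebra_simps)
qed

lemma energy_add_le:
  assumes "continuous_on {0..} u" "continuous_on {0..} v" "s > 0"
  shows "energy T (\<lambda>t. u t + v t) \<le> (1 + s) * energy T u + (1 + 1 / s) * energy T v"
proof -
  have "energy T (\<lambda>t. u t + v t)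
    \<le> integral {0..T} (\<lambda>t. (1 + s) * (norm (u t))\<^sup>2 + (1 + 1 / s) * (norm (v t))\<^sup>2)"
    unfolding energy_def
    by (rule integral_le)
       (use assms norm_add_sq_le in \<open>auto intro!: Henstock_Kurzweil_Integration.integrable_add
         integrable_on_mult_right integrable_norm_sq continuous_intros\<close>)
  also have "\<dots> = (1 + s) * energy T u + (1 + 1 / s) * energy T v"
    unfolding energy_def using assms
    by (subst Henstock_Kurzweil_Integration.integral_add)
       (auto intro!: integrable_on_mult_right integrable_norm_sq)
  finally show ?thesis .
qed

lemma energy_add_le2:
  assumes "continuous_on {0..} u" "continuous_on {0..} v"
  shows "energy T (\<lambda>t. u t + v t) \<le> 2 * energy T u + 2 * energy T v"
  using energy_add_le[OF assms, of 1] by simp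

lemma continuous_on_halfline:
  assumes "\<And>t. 0 \<le> t \<Longrightarrow> (u has_vector_derivative u' t) (at t within {0..})"
  shows "continuous_on {0..} (u :: real \<Rightarrow> 'a::real_normed_vector)"
  unfolding continuous_on_eq_continuous_within
  by (intro ballI has_vector_derivative_continuous[OF assms]) simp

lemma continuous_primitive:
  assumes "continuous_on {0..} (u :: real \<Rightarrow> 'a::banach)"
  shows "continuous_on {0..} (\<lambda>t. integral {0..t} u)"
  unfolding continuous_on_eq_continuous_within
proof
  fix t :: real assume t: "t \<in> {0..}"
  have "((\<lambda>v. integral {0..v} u) has_vector_derivative u t) (at t within {0..t+1})"
    using t by (intro integral_has_vector_derivative continuous_on_Icc assms) auto
  then have "continuous (at t within {0..t+1}) (\<lambda>v. integral {0..v} u)"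
    by (rule has_vector_derivative_continuous)
  moreover have "at t within {0..t+1} = at t within {0..}"
    by (rule at_within_nhd[of _ "{t-1<..<t+1}"]) auto
  ultimately show "continuous (at t within {0..}) (\<lambda>v. integral {0..v} u)" by simp
qed

lemma integral_window:
  assumes "continuous_on {0..} (u :: real \<Rightarrow> 'a::banach)" "0 \<le> a" "a \<le> b"
  shows "integral {a..b} u = integral {0..b} u - integral {0..a} u"
  using Henstock_Kurzweil_Integration.integral_combine[of 0 a b u] integrable_Icc[OF assms(1), of 0 b] assms
  by (simp add: algebra_simps)

text \<open>Both the bending moment and the velocity of the beam are, up to boundary data at the tip, Volterra
  integrals of the time derivative of the other; iterating this coupling on time averages
  bounds the low frequencies by the boundary data.\<close>

definition coupled ::
  "('a \<Rightarrow> 'a) \<Rightarrow> ('a \<Rightarrow> 'a) \<Rightarrow> (real \<Rightarrow> 'a::banach) \<Rightarrow> (real \<Rightarrow> 'a) \<Rightarrow> (real \<Rightarrow> 'a) \<Rightarrow> (real \<Rightarrow> 'a) \<Rightarrow>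
    (real \<Rightarrow> 'a) \<Rightarrow> (real \<Rightarrow> 'a) \<Rightarrow> bool"
  where "coupled A1 A2 u u' v v' p q \<longleftrightarrow>
    (\<forall>t\<ge>0. (u has_vector_derivative u' t) (at t within {0..})) \<and> continuous_on {0..} u' \<and>
    (\<forall>t\<ge>0. (v has_vector_derivative v' t) (at t within {0..})) \<and> continuous_on {0..} v' \<and>
    continuous_on {0..} p \<and> continuous_on {0..} q \<and>
    (\<forall>t\<ge>0. u t = p t - A1 (v' t)) \<and> (\<forall>t\<ge>0. v t = q t + A2 (u' t))"

lemma coupledD:
  assumes "coupled A1 A2 u u' v v' p q"
  shows "t \<ge> 0 \<Longrightarrow> (u has_vector_derivative u' t) (at t within {0..})" "continuous_on {0..} u'"
    "t \<ge> 0 \<Longrightarrow> (v has_vector_derivative v' t) (at t within {0..})" "continuous_on {0..} v'"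
    "continuous_on {0..} p" "continuous_on {0..} q"
    "t \<ge> 0 \<Longrightarrow> u t = p t - A1 (v' t)" "t \<ge> 0 \<Longrightarrow> v t = q t + A2 (u' t)"
  using assms unfolding coupled_def by blast+

section \<open>Averages and difference quotients with a fixed step\<close>

context
  fixes \<tau> :: real
  assumes \<tau>: "\<tau> > 0"
begin

lemma continuous_shift:
  assumes "continuous_on {0..} u" 
  shows "continuous_on {0..} (\<lambda>t. u (t + \<tau>))"
  by (rule continuous_on_compose2[OF assms]) (use \<tau> in \<open>auto intro!: continuous_intros\<close>)

lemma continuous_tavg:
  assumes "continuous_on {0..} (u :: real \<Rightarrow> 'a::banach)"
  shows "continuous_on {0..} (tavg \<tau> u)"
proof -
  have "continuous_on {0..} (\<lambda>t. (1 / \<tau>) *\<^sub>R (integral {0..t+\<tau>} u - integral {0..t} u))"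
    using continuous_shift[OF continuous_primitive[OF assms]] continuous_primitive[OF assms]
    by (intro continuous_intros)
  moreover have "(1 / \<tau>) *\<^sub>R (integral {0..t+\<tau>} u - integral {0..t} u) = tavg \<tau> u t" if "t \<in> {0..}" for t
    using integral_window[OF assms, of t "t + \<tau>"] that \<tau> by (simp add: tavg_def)
  ultimately show ?thesis by (rule continuous_on_eq) 
qed

lemma continuous_tquot:
  assumes "continuous_on {0..} (u :: real \<Rightarrow> 'a::real_normed_vector)"
  shows "continuous_on {0..} (tquot \<tau> u)"
  unfolding tquot_def using continuous_shift[OF assms] assms by (intro continuous_intros)

lemma continuous_tavg_iterate:
  "continuous_on {0..} (u :: real \<Rightarrow> 'a::banach) \<Longrightarrow> continuous_on {0..} ((tavg \<tau> ^^ n) u)"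
  by (induction n) (auto intro: continuous_tavg)

lemma continuous_tquot_iterate:
  "continuous_on {0..} (u :: real \<Rightarrow> 'a::real_normed_vector) \<Longrightarrow> continuous_on {0..} ((tquot \<tau> ^^ n) u)"
  by (induction n) (auto intro: continuous_tquot)

text \<open>Each time lies in windows whose starting points fill a set of length at most
  \<open>\<tau>\<close>. Instead of exchanging integrals, window integrals are written as increments
  of a monotone primitive \<open>F\<close>, whose shifted integrals telescope.\<close>

lemma integral_window_average:
  assumes c: "continuous_on {0..} \<phi>" and pos: "\<And>t. 0 \<le> t \<Longrightarrow> (\<phi> t :: real) \<ge> 0" and T: "T \<ge> 0"
  shows "integral {0..T} (\<lambda>t. integral {t..t+\<tau>} \<phi>) \<le> \<tau> * integral {0..T+\<tau>} \<phi>"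
proof -
  define F where "F t = integral {0..t} \<phi>" for t
  have cF: "continuous_on {0..} F" unfolding F_def by (rule continuous_primitive[OF c])
  have F0: "F t \<ge> 0" if "t \<ge> 0" for t
    unfolding F_def using pos by (intro integral_nonneg integrable_Icc c) auto
  have Fm: "F s \<le> F t" if "0 \<le> s" "s \<le> t" for s t
    unfolding F_def using that pos by (intro integral_subset_le integrable_Icc c) auto
  have "integral {0..T} (\<lambda>t. integral {t..t+\<tau>} \<phi>) = integral {0..T} (\<lambda>t. F (t + \<tau>) - F t)"
  proof (rule integral_cong)
    fix t assume "t \<in> {0..T}"
    then show "integral {t..t+\<tau>} \<phi> = F (t + \<tau>) - F t"
      using integral_window[OF c, of t "t + \<tau>"] \<tau> unfolding F_def by simp
  qed
  also have "\<dots> = integral {0..T} (\<lambda>t. F (t + \<tau>)) - integral {0..T} F"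
    by (intro Henstock_Kurzweil_Integration.integral_diff integrable_Icc continuous_shift cF) auto
  also have "integral {0..T} (\<lambda>t. F (t + \<tau>)) = integral {\<tau>..T+\<tau>} F"
    using integral_shift_Icc_real[of 0 T F \<tau>] by (simp add: o_def add.commute)
  also have "integral {\<tau>..T+\<tau>} F = integral {0..T+\<tau>} F - integral {0..\<tau>} F"
    using integral_window[OF cF, of \<tau> "T+\<tau>"] \<tau> T by simp
  also have "integral {0..T+\<tau>} F = integral {0..T} F + integral {T..T+\<tau>} F"
    using integral_window[OF cF, of T "T+\<tau>"] \<tau> T by simp
  also have "integral {T..T+\<tau>} F \<le> integral {T..T+\<tau>} (\<lambda>t. F (T + \<tau>))"
    using T Fm by (intro integral_le integrable_Icc cF) auto
  also have "integral {T..T+\<tau>} (\<lambda>t. F (T + \<tau>)) = \<tau> * F (T + \<tau>)"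
    using \<tau> by simp
  finally have "integral {0..T} (\<lambda>t. integral {t..t+\<tau>} \<phi>)
    \<le> integral {0..T} F + \<tau> * F (T + \<tau>) - integral {0..\<tau>} F - integral {0..T} F" by simp
  moreover have "integral {0..\<tau>} F \<ge> 0"
    using F0 by (intro integral_nonneg integrable_Icc cF) auto
  ultimately show ?thesis unfolding F_def by simp
qed

text \<open>Nonnegativity of the variance of \<open>f\<close> about its mean \<open>m\<close> over
  the window.\<close>

lemma integral_power2_le:
  assumes "continuous_on {t..t+\<tau>} (f :: real \<Rightarrow> real)"
  shows "(integral {t..t+\<tau>} f)\<^sup>2 \<le> \<tau> * integral {t..t+\<tau>} (\<lambda>s. (f s)\<^sup>2)"
proof -
  define m where "m = integral {t..t+\<tau>} f / \<tau>"
  have i: "f integrable_on {t..t+\<tau>}" "(\<lambda>s. (f s)\<^sup>2) integrable_on {t..t+\<tau>}"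
    using assms by (auto intro!: integrable_continuous_real continuous_intros)
  have "0 \<le> integral {t..t+\<tau>} (\<lambda>s. (f s - m)\<^sup>2)"
    by (rule integral_nonneg_real) auto
  also have "\<dots> = integral {t..t+\<tau>} (\<lambda>s. ((f s)\<^sup>2 - 2 * m * f s) + m\<^sup>2)"
    by (simp add: power2_diff algebra_simps)
  also have "\<dots> = integral {t..t+\<tau>} (\<lambda>s. (f s)\<^sup>2) - 2 * m * integral {t..t+\<tau>} f + \<tau> * m\<^sup>2"
    using \<tau> i by (subst Henstock_Kurzweil_Integration.integral_add
       Henstock_Kurzweil_Integration.integral_diff; auto intro!: Henstock_Kurzweil_Integration.integrable_diff integrable_on_mult_right)+
  also have "\<dots> = integral {t..t+\<tau>} (\<lambda>s. (f s)\<^sup>2) - (integral {t..t+\<tau>} f)\<^sup>2 / \<tau>"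
    using \<tau> by (simp add: m_def power2_eq_square)
  finally show ?thesis using \<tau> by (simp add: field_simps)
qed

lemma norm_integral_power2_le:
  assumes "continuous_on {t..t+\<tau>} (u :: real \<Rightarrow> 'a::banach)"
  shows "(norm (integral {t..t+\<tau>} u))\<^sup>2 \<le> \<tau> * integral {t..t+\<tau>} (\<lambda>s. (norm (u s))\<^sup>2)"
proof -
  have "norm (integral {t..t+\<tau>} u) \<le> integral {t..t+\<tau>} (\<lambda>s. norm (u s))"
    using assms by (intro integral_norm_bound_integral integrable_continuous_real continuous_intros) auto
  then have "(norm (integral {t..t+\<tau>} u))\<^sup>2 \<le> (integral {t..t+\<tau>} (\<lambda>s. norm (u s)))\<^sup>2"
    by (intro power_mono) auto
  also have "\<dots> \<le> \<tau> * integral {t..t+\<tau>} (\<lambda>s. (norm (u s))\<^sup>2)"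
    using assms by (intro integral_power2_le continuous_intros)
  finally show ?thesis .
qed

lemma continuous_window:
  assumes "continuous_on {0..} (u :: real \<Rightarrow> 'a::banach)"
  shows "continuous_on {0..} (\<lambda>t. integral {t..t+\<tau>} u)"
proof -
  have "continuous_on {0..} (\<lambda>t. \<tau> *\<^sub>R tavg \<tau> u t)"
    by (intro continuous_intros continuous_tavg assms)
  then show ?thesis using \<tau> by (simp add: tavg_def)
qed

text \<open>Serves averages and remainders alike: both are bounded pointwise by the integral of a
  squared norm over one window.\<close>

lemma energy_window:
  assumes cu: "continuous_on {0..} (u :: real \<Rightarrow> 'a::real_normed_vector)"
    and cw: "continuous_on {0..} (w :: real \<Rightarrow> 'b::real_normed_vector)"
    and le: "\<And>t. 0 \<le> t \<Longrightarrow> (norm (w t))\<^sup>2 \<le> c * integral {t..t+\<tau>} (\<lambda>s. (norm (u s))\<^sup>2)"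
    and T: "T \<ge> 0" and c: "c \<ge> 0"
  shows "energy T w \<le> c * \<tau> * energy (T + \<tau>) u"
proof -
  have cn: "continuous_on {0..} (\<lambda>s. (norm (u s))\<^sup>2)" by (rule continuous_norm_sq[OF cu])
  have "energy T w \<le> integral {0..T} (\<lambda>t. c * integral {t..t+\<tau>} (\<lambda>s. (norm (u s))\<^sup>2))"
    unfolding energy_def using le
    by (intro integral_le integrable_norm_sq cw integrable_on_mult_right integrable_Icc
        continuous_window cn) auto
  also have "\<dots> = c * integral {0..T} (\<lambda>t. integral {t..t+\<tau>} (\<lambda>s. (norm (u s))\<^sup>2))"
    by simp
  also have "\<dots> \<le> c * (\<tau> * energy (T + \<tau>) u)"
    unfolding energy_def by (intro mult_left_mono integral_window_average cn T c) auto
  finally show ?thesis by (simp add: mult.assoc)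
qed

lemma energy_tavg:
  assumes "continuous_on {0..} (u :: real \<Rightarrow> 'a::banach)" "T \<ge> 0"
  shows "energy T (tavg \<tau> u) \<le> energy (T + \<tau>) u"
proof -
  have "energy T (tavg \<tau> u) \<le> 1 / \<tau> * \<tau> * energy (T + \<tau>) u"
  proof (rule energy_window)
    fix t :: real assume "0 \<le> t"
    then have "(norm (integral {t..t+\<tau>} u))\<^sup>2 \<le> \<tau> * integral {t..t+\<tau>} (\<lambda>s. (norm (u s))\<^sup>2)"
      by (intro norm_integral_power2_le continuous_on_Icc assms)
    then show "(norm (tavg \<tau> u t))\<^sup>2 \<le> 1 / \<tau> * integral {t..t+\<tau>} (\<lambda>s. (norm (u s))\<^sup>2)"
      using \<tau> by (simp add: tavg_def power_mult_distrib power_divide field_simps power2_eq_square)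
  qed (use assms \<tau> in \<open>auto intro: continuous_tavg\<close>)
  then show ?thesis using \<tau> by simp
qed

lemma energy_tquot:
  assumes "continuous_on {0..} (u :: real \<Rightarrow> 'a::real_normed_vector)" "T \<ge> 0"
  shows "energy T (tquot \<tau> u) \<le> (2 / \<tau>)\<^sup>2 * energy (T + \<tau>) u"
proof -
  have sh: "energy T (\<lambda>t. u (t + \<tau>)) \<le> energy (T + \<tau>) u"
  proof -
    have "energy T (\<lambda>t. u (t + \<tau>)) = integral {\<tau>..T+\<tau>} (\<lambda>t. (norm (u t))\<^sup>2)"
      unfolding energy_def
      using integral_shift_Icc_real[of 0 T "\<lambda>t. (norm (u t))\<^sup>2" \<tau>] by (simp add: o_def add.commute)
    also have "\<dots> \<le> energy (T + \<tau>) u"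
      unfolding energy_def using assms \<tau> by (intro integral_subset_le integrable_norm_sq) auto
    finally show ?thesis .
  qed
  have "energy T (tquot \<tau> u) \<le> (1 / \<tau>)\<^sup>2 * energy T (\<lambda>t. u (t + \<tau>) + (- u t))"
    by (intro energy_le continuous_tquot continuous_intros continuous_shift assms)
       (use \<tau> in \<open>simp add: tquot_def\<close>)
  also have "energy T (\<lambda>t. u (t + \<tau>) + (- u t)) \<le> 2 * energy T (\<lambda>t. u (t + \<tau>)) + 2 * energy T (\<lambda>t. - u t)"
    by (intro energy_add_le2 continuous_shift continuous_intros assms)
  also have "energy T (\<lambda>t. - u t) = energy T u" by (simp add: energy_def)
  also have "2 * energy T (\<lambda>t. u (t + \<tau>)) + 2 * energy T u \<le> 4 * energy (T + \<tau>) u"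
    using sh energy_mono_time[OF assms, of "T + \<tau>"] \<tau> by simp
  finally show ?thesis by (simp add: power_divide divide_right_mono)
qed

lemma energy_tquot_iterate:
  assumes "continuous_on {0..} (u :: real \<Rightarrow> 'a::real_normed_vector)" "T \<ge> 0"
  shows "energy T ((tquot \<tau> ^^ n) u) \<le> (2 / \<tau>) ^ (2 * n) * energy (T + real n * \<tau>) u"
  using assms(2)
proof (induction n arbitrary: T)
  case (Suc n)
  have "energy T ((tquot \<tau> ^^ Suc n) u) \<le> (2 / \<tau>)\<^sup>2 * energy (T + \<tau>) ((tquot \<tau> ^^ n) u)"
    using Suc.prems by (simp add: energy_tquot continuous_tquot_iterate assms del: power_divide)
  also have "\<dots> \<le> (2 / \<tau>)\<^sup>2 * ((2 / \<tau>) ^ (2 * n) * energy (T + \<tau> + real n * \<tau>) u)"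
    using Suc.prems \<tau> by (intro Suc.IH mult_left_mono) auto
  also have "\<dots> = (2 / \<tau>) ^ (2 * Suc n) * energy (T + \<tau> + real n * \<tau>) u"
    by (simp only: mult.assoc[symmetric] power_add[symmetric]) simp
  finally show ?case by (simp add: algebra_simps)
qed simp

lemma tavg_cong: "(\<And>s. 0 \<le> s \<Longrightarrow> u s = v s) \<Longrightarrow> 0 \<le> t \<Longrightarrow> tavg \<tau> u t = tavg \<tau> v t"
  unfolding tavg_def by (auto intro!: arg_cong[of _ _ "\<lambda>x. (1 / \<tau>) *\<^sub>R x"] integral_cong)

lemma tquot_cong: "(\<And>s. 0 \<le> s \<Longrightarrow> u s = v s) \<Longrightarrow> 0 \<le> t \<Longrightarrow> tquot \<tau> u t = tquot \<tau> v t"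
  using \<tau> unfolding tquot_def by simp

lemma tquot_iterate_cong:
  "(\<And>s. 0 \<le> s \<Longrightarrow> u s = v s) \<Longrightarrow> 0 \<le> t \<Longrightarrow> (tquot \<tau> ^^ n) u t = (tquot \<tau> ^^ n) v t"
  by (induction n arbitrary: t) (auto intro: tquot_cong)

lemma tavg_linear:
  assumes "bounded_linear L" "continuous_on {0..} u" "0 \<le> t"
  shows "tavg \<tau> (\<lambda>s. L (u s)) t = L (tavg \<tau> u t)"
  unfolding tavg_def
  using integral_linear[OF integrable_Icc[OF assms(2,3)] assms(1), of "t + \<tau>"]
    linear_scale[OF bounded_linear.linear[OF assms(1)]] by (simp add: o_def)

lemma tquot_linear: "bounded_linear L \<Longrightarrow> tquot \<tau> (\<lambda>s. L (u s)) = (\<lambda>t. L (tquot \<tau> u t))"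
  unfolding tquot_def
  by (simp add: linear_diff[OF bounded_linear.linear] linear_scale[OF bounded_linear.linear])

lemma tquot_iterate_linear: "bounded_linear L \<Longrightarrow> (tquot \<tau> ^^ n) (\<lambda>s. L (u s)) = (\<lambda>t. L ((tquot \<tau> ^^ n) u t))"
  by (induction n) (simp_all add: tquot_linear)

lemma tavg_add:
  assumes "continuous_on {0..} u" "continuous_on {0..} v" "0 \<le> t"
  shows "tavg \<tau> (\<lambda>s. u s + v s) t = tavg \<tau> u t + tavg \<tau> v t"
  unfolding tavg_def using assms
  by (simp add: integrable_Icc scaleR_add_right Henstock_Kurzweil_Integration.integral_add)

lemma tavg_diff:
  assumes "continuous_on {0..} u" "continuous_on {0..} v" "0 \<le> t"
  shows "tavg \<tau> (\<lambda>s. u s - v s) t = tavg \<tau> u t - tavg \<tau> v t"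
  unfolding tavg_def using assms
  by (simp add: integrable_Icc scaleR_diff_right Henstock_Kurzweil_Integration.integral_diff)

lemma tquot_add: "tquot \<tau> (\<lambda>s. u s + v s) = (\<lambda>t. tquot \<tau> u t + tquot \<tau> v t)"
  unfolding tquot_def by (simp add: scaleR_add_right scaleR_diff_right algebra_simps)

lemma tquot_diff: "tquot \<tau> (\<lambda>s. u s - v s) = (\<lambda>t. tquot \<tau> u t - tquot \<tau> v t)"
  unfolding tquot_def by (simp add: scaleR_diff_right algebra_simps)

lemma tquot_iterate_diff: "(tquot \<tau> ^^ n) (\<lambda>s. u s - v s) = (\<lambda>t. (tquot \<tau> ^^ n) u t - (tquot \<tau> ^^ n) v t)"
  by (induction n) (simp_all add: tquot_diff)

lemma tavg_shift: "tavg \<tau> (\<lambda>s. u (s + c)) t = tavg \<tau> u (t + c)"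
  unfolding tavg_def using integral_shift_Icc_real[of t "t + \<tau>" u c]
  by (simp add: o_def add.commute add.left_commute)

lemma tavg_tquot:
  assumes "continuous_on {0..} u" "0 \<le> t"
  shows "tavg \<tau> (tquot \<tau> u) t = tquot \<tau> (tavg \<tau> u) t"
proof -
  have "tavg \<tau> (tquot \<tau> u) t = (1 / \<tau>) *\<^sub>R tavg \<tau> (\<lambda>s. u (s + \<tau>) - u s) t"
    using tavg_linear[OF bounded_linear_scaleR_right, of "\<lambda>s. u (s + \<tau>) - u s" t "1 / \<tau>"] assms
    by (simp add: tquot_def[abs_def] continuous_on_diff continuous_shift)
  then show ?thesis
    using assms by (simp add: tavg_diff continuous_shift tavg_shift tquot_def)
qed

lemma tavg_tquot_iterate:
  assumes "continuous_on {0..} u" "0 \<le> t"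
  shows "tavg \<tau> ((tquot \<tau> ^^ n) u) t = (tquot \<tau> ^^ n) (tavg \<tau> u) t"
  using assms(2)
proof (induction n arbitrary: t)
  case (Suc n)
  have "tavg \<tau> ((tquot \<tau> ^^ Suc n) u) t = tquot \<tau> (tavg \<tau> ((tquot \<tau> ^^ n) u)) t"
    using Suc.prems by (simp add: tavg_tquot continuous_tquot_iterate assms)
  also have "\<dots> = tquot \<tau> ((tquot \<tau> ^^ n) (tavg \<tau> u)) t"
    using Suc by (intro tquot_cong) auto
  finally show ?case by simp
qed simp

lemma tavg_derivative:
  assumes "\<And>t. 0 \<le> t \<Longrightarrow> (u has_vector_derivative u' t) (at t within {0..})" "0 \<le> t"
  shows "tavg \<tau> u' t = tquot \<tau> u t"
proof -
  have "(u' has_integral (u (t + \<tau>) - u t)) {t..t+\<tau>}"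
    using \<tau> assms
    by (intro fundamental_theorem_of_calculus has_vector_derivative_within_subset[OF assms(1)]) auto
  then show ?thesis by (simp add: tavg_def tquot_def integral_unique)
qed

text \<open>The remainder is an average of increments over the window, each bounded by the integral
  of the norm of \<open>u'\<close>. Cauchy-Schwarz on the window and integration over its starting
  point yield one factor \<open>\<tau>\<close> each.\<close>

lemma energy_minus_tavg:
  assumes d: "\<And>t. 0 \<le> t \<Longrightarrow> (u has_vector_derivative u' t) (at t within {0..})"
    and c: "continuous_on {0..} (u' :: real \<Rightarrow> 'a::banach)" and T: "T \<ge> 0"
  shows "energy T (\<lambda>t. u t - tavg \<tau> u t) \<le> \<tau>\<^sup>2 * energy (T + \<tau>) u'"
proof -
  have cu: "continuous_on {0..} u"
    by (rule continuous_on_halfline[OF d])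
  have "energy T (\<lambda>t. u t - tavg \<tau> u t) \<le> \<tau> * \<tau> * energy (T + \<tau>) u'"
  proof (rule energy_window[OF c])
    fix t :: real assume t: "0 \<le> t"
    define W where "W = integral {t..t+\<tau>} (\<lambda>s. norm (u' s))"
    have cn: "continuous_on {t..t+\<tau>} (\<lambda>s. norm (u' s))"
      using t by (intro continuous_intros continuous_on_Icc c)
    have 1: "norm (u t - u s) \<le> W" if s: "s \<in> {t..t+\<tau>}" for s
    proof -
      have "(u' has_integral (u s - u t)) {t..s}"
        using s t by (intro fundamental_theorem_of_calculus has_vector_derivative_within_subset[OF d]) auto
      then have "u s - u t = integral {t..s} u'" by (simp add: integral_unique)
      also have "norm \<dots> \<le> integral {t..s} (\<lambda>s. norm (u' s))"
        using t s by (intro integral_norm_bound_integral integrable_continuous_real continuous_intros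
            continuous_on_Icc c) auto
      also have "\<dots> \<le> W" unfolding W_def using s cn
        by (intro integral_subset_le integrable_continuous_real continuous_on_subset[OF cn]) auto
      finally show ?thesis by (simp add: norm_minus_commute)
    qed
    have "u t - tavg \<tau> u t = (1 / \<tau>) *\<^sub>R integral {t..t+\<tau>} (\<lambda>s. u t - u s)"
      using \<tau> t by (simp add: tavg_def Henstock_Kurzweil_Integration.integral_diff integrable_Icc cu scaleR_diff_right)
    then have "norm (u t - tavg \<tau> u t) = (1 / \<tau>) * norm (integral {t..t+\<tau>} (\<lambda>s. u t - u s))"
      using \<tau> by simp
    also have "norm (integral {t..t+\<tau>} (\<lambda>s. u t - u s)) \<le> W * (t + \<tau> - t)"
      using \<tau> t 1 by (intro integral_bound continuous_intros continuous_on_Icc cu) auto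
    finally have "norm (u t - tavg \<tau> u t) \<le> W" using \<tau> by (simp add: divide_right_mono field_simps)
    then have "(norm (u t - tavg \<tau> u t))\<^sup>2 \<le> W\<^sup>2" by (intro power_mono) auto
    also have "\<dots> \<le> \<tau> * integral {t..t+\<tau>} (\<lambda>s. (norm (u' s))\<^sup>2)"
      unfolding W_def by (rule integral_power2_le[OF cn])
    finally show "(norm (u t - tavg \<tau> u t))\<^sup>2 \<le> \<tau> * integral {t..t+\<tau>} (\<lambda>s. (norm (u' s))\<^sup>2)" .
  qed (use \<tau> T in \<open>auto intro!: continuous_intros continuous_tavg cu\<close>)
  then show ?thesis by (simp add: power2_eq_square)
qed

text \<open>Only the total length \<open>n * \<tau>\<close> enters. A plain doubling of squares in
  every induction step would give a bound exponential in \<open>n\<close>; here the number of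
  averages can be increased at constant total length without any loss.\<close>

lemma energy_minus_tavg_iterate:
  assumes d: "\<And>t. 0 \<le> t \<Longrightarrow> (u has_vector_derivative u' t) (at t within {0..})"
    and c: "continuous_on {0..} (u' :: real \<Rightarrow> 'a::banach)" and T: "T \<ge> 0"
  shows "energy T (\<lambda>t. u t - (tavg \<tau> ^^ n) u t) \<le> (real n * \<tau>)\<^sup>2 * energy (T + real n * \<tau>) u'"
  using T
proof (induction n arbitrary: T)
  case 0
  then show ?case by (simp add: energy_def)
next
  case (Suc n)
  have cu: "continuous_on {0..} u"
    by (rule continuous_on_halfline[OF d])
  define v where "v t = u t - (tavg \<tau> ^^ n) u t" for t
  have cv: "continuous_on {0..} v" unfolding v_def by (intro continuous_intros cu continuous_tavg_iterate)
  define I where "I = energy (T + real (Suc n) * \<tau>) u'"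
  have first: "energy T (\<lambda>t. u t - tavg \<tau> u t) \<le> \<tau>\<^sup>2 * I"
  proof -
    have "energy (T + \<tau>) u' \<le> I"
      unfolding I_def using Suc.prems \<tau> by (intro energy_mono_time c) (auto simp: algebra_simps)
    then show ?thesis
      using energy_minus_tavg[OF d c Suc.prems] by (meson mult_left_mono order_trans zero_le_power2)
  qed
  show ?case
  proof (cases "n = 0")
    case True
    then show ?thesis using first by (simp add: I_def)
  next
    case False
    have eq: "u t - (tavg \<tau> ^^ Suc n) u t = (u t - tavg \<tau> u t) + tavg \<tau> v t" if "0 \<le> t" for t
    proof -
      have "tavg \<tau> v t = tavg \<tau> u t - tavg \<tau> ((tavg \<tau> ^^ n) u) t"
        unfolding v_def using that by (intro tavg_diff cu continuous_tavg_iterate)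
      then show ?thesis by simp
    qed
    have "energy T (\<lambda>t. u t - (tavg \<tau> ^^ Suc n) u t) = energy T (\<lambda>t. (u t - tavg \<tau> u t) + tavg \<tau> v t)"
      by (rule energy_cong) (rule eq)
    \<comment> \<open>The weight \<open>n\<close> in the squared triangle inequality, positive in
      this case, is the one that closes the induction:
      \<open>(1 + n) + (1 + 1 / n) * n\<^sup>2 = (n + 1)\<^sup>2\<close>.\<close>
    also have "\<dots> \<le> (1 + real n) * energy T (\<lambda>t. u t - tavg \<tau> u t) + (1 + 1 / real n) * energy T (tavg \<tau> v)"
      using False by (intro energy_add_le continuous_intros cu continuous_tavg cv) auto
    also have "\<dots> \<le> (1 + real n) * (\<tau>\<^sup>2 * I) + (1 + 1 / real n) * ((real n * \<tau>)\<^sup>2 * I)"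
    proof (intro add_mono mult_left_mono first)
      have "energy T (tavg \<tau> v) \<le> energy (T + \<tau>) v" by (rule energy_tavg[OF cv Suc.prems])
      also have "\<dots> \<le> (real n * \<tau>)\<^sup>2 * energy (T + \<tau> + real n * \<tau>) u'"
        unfolding v_def using Suc.prems \<tau> by (intro Suc.IH) auto
      also have "energy (T + \<tau> + real n * \<tau>) u' = I" by (simp add: I_def algebra_simps)
      finally show "energy T (tavg \<tau> v) \<le> (real n * \<tau>)\<^sup>2 * I" .
    qed auto
    also have "\<dots> = (real (Suc n) * \<tau>)\<^sup>2 * I"
      using False by (simp add: field_simps power2_eq_square)
    finally show ?thesis unfolding I_def .
  qed
qed

text \<open>One turn around the coupling. Averaging the first equation turns \<open>v'\<close> into
  a quotient of \<open>v\<close>; a second average allows the averaged second equation to be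
  inserted for \<open>v\<close>, whose derivative \<open>u'\<close> becomes a quotient as well. No
  time derivative is left.\<close>

lemma tavg_square_identity:
  assumes A1: "bounded_linear (A1 :: 'a::banach \<Rightarrow> 'a)" and A2: "bounded_linear A2"
    and coup: "coupled A1 A2 u u' v v' p q" and t: "0 \<le> t"
  shows "tavg \<tau> (tavg \<tau> u) t
    = (tavg \<tau> (tavg \<tau> p) t - A1 (tquot \<tau> (tavg \<tau> q) t)) - A1 (A2 (tquot \<tau> (tquot \<tau> u) t))"
proof -
  note u = coupledD(1,2)[OF coup] and v = coupledD(3,4)[OF coup] and c = coupledD(5,6)[OF coup]
    and sys = coupledD(7,8)[OF coup]
  have cA: "continuous_on {0..} (\<lambda>t. A1 (v' t))" "continuous_on {0..} (\<lambda>t. A2 (u' t))"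
    by (intro bounded_linear.continuous_on[OF A1] bounded_linear.continuous_on[OF A2] u v)+
  have cu: "continuous_on {0..} u" and cv: "continuous_on {0..} v"
    by (rule continuous_on_halfline[OF u(1)] continuous_on_halfline[OF v(1)], assumption)+
  have 1: "tavg \<tau> u s = tavg \<tau> p s - A1 (tquot \<tau> v s)" if "0 \<le> s" for s
  proof -
    have "tavg \<tau> u s = tavg \<tau> (\<lambda>t. p t - A1 (v' t)) s" by (rule tavg_cong[OF sys(1) that])
    also have "\<dots> = tavg \<tau> p s - A1 (tquot \<tau> v s)"
      using that by (simp add: tavg_diff c cA tavg_linear[OF A1] v tavg_derivative[OF v(1)])
    finally show ?thesis .
  qed
  have 2: "tavg \<tau> v s = tavg \<tau> q s + A2 (tquot \<tau> u s)" if "0 \<le> s" for s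
  proof -
    have "tavg \<tau> v s = tavg \<tau> (\<lambda>t. q t + A2 (u' t)) s" by (rule tavg_cong[OF sys(2) that])
    also have "\<dots> = tavg \<tau> q s + A2 (tquot \<tau> u s)"
      using that by (simp add: tavg_add c cA tavg_linear[OF A2] u tavg_derivative[OF u(1)])
    finally show ?thesis .
  qed
  have "tavg \<tau> (tavg \<tau> u) t = tavg \<tau> (\<lambda>s. tavg \<tau> p s - A1 (tquot \<tau> v s)) t" by (rule tavg_cong[OF 1 t])
  also have "\<dots> = tavg \<tau> (tavg \<tau> p) t - A1 (tavg \<tau> (tquot \<tau> v) t)"
    using t by (simp add: tavg_diff c continuous_tavg continuous_tquot cv bounded_linear.continuous_on[OF A1] tavg_linear[OF A1])
  also have "tavg \<tau> (tquot \<tau> v) t = tquot \<tau> (tavg \<tau> v) t" by (rule tavg_tquot[OF cv t])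
  also have "\<dots> = tquot \<tau> (\<lambda>s. tavg \<tau> q s + A2 (tquot \<tau> u s)) t" by (rule tquot_cong[OF 2 t])
  also have "\<dots> = tquot \<tau> (tavg \<tau> q) t + A2 (tquot \<tau> (tquot \<tau> u) t)"
    by (simp add: tquot_add tquot_linear[OF A2])
  finally show ?thesis by (simp add: linear_add[OF bounded_linear.linear[OF A1]])
qed

lemma bounded_linear_iterate:
  assumes "bounded_linear (K :: 'a::real_normed_vector \<Rightarrow> 'a)"
  shows "bounded_linear (K ^^ k)"
proof (induction k)
  case 0
  have "bounded_linear (\<lambda>x::'a. x)" by (rule bounded_linear_ident)
  then show ?case by (simp add: id_def)
next
  case (Suc k)
  then show ?case using bounded_linear_compose[OF assms Suc] by (simp add: o_def)
qed

text \<open>The constant precedes the functions: it depends on the step, the operators and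
  \<open>k\<close>, but neither on the orbit nor on \<open>T\<close>. In the induction two more
  averages pass through the iterated operator and commute with the quotients, so that
  \<open>tavg_square_identity\<close> can be used underneath them.\<close>

lemma tavg_iterate_expansion:
  fixes A1 A2 :: "'a::banach \<Rightarrow> 'a"
  assumes A1: "bounded_linear A1" and A2: "bounded_linear A2"
  shows "\<exists>C\<ge>0. \<forall>u u' v v' p q. coupled A1 A2 u u' v v' p q \<longrightarrow>
      (\<exists>R. continuous_on {0..} R \<and>
        (\<forall>t\<ge>0. (tavg \<tau> ^^ (2 * k)) u t = R t + (((\<lambda>x. - A1 (A2 x)) ^^ k) ((tquot \<tau> ^^ (2 * k)) u t))) \<and>
        (\<forall>T\<ge>0. energy T R \<le> C * (energy (T + real (2 * k) * \<tau>) p + energy (T + real (2 * k) * \<tau>) q)))"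
proof (induction k)
  case 0
  show ?case
    by (rule exI[of _ 0], rule conjI, simp, intro allI impI, rule exI[of _ "\<lambda>t. 0"])
       (simp add: energy_def)
next
  case (Suc k)
  then obtain C where C: "C \<ge> 0" and IH: "\<And>u u' v v' p q. coupled A1 A2 u u' v v' p q \<Longrightarrow>
      (\<exists>R. continuous_on {0..} R \<and>
        (\<forall>t\<ge>0. (tavg \<tau> ^^ (2 * k)) u t = R t + (((\<lambda>x. - A1 (A2 x)) ^^ k) ((tquot \<tau> ^^ (2 * k)) u t))) \<and>
        (\<forall>T\<ge>0. energy T R \<le> C * (energy (T + real (2 * k) * \<tau>) p + energy (T + real (2 * k) * \<tau>) q)))"
    by meson
  define K where "K = (\<lambda>x. - A1 (A2 x))"
  have K: "bounded_linear K"
    unfolding K_def by (intro bounded_linear_minus bounded_linear_compose[OF A1 A2])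
  have Kk: "bounded_linear (K ^^ k)" by (rule bounded_linear_iterate[OF K])
  obtain \<kappa> where \<kappa>: "\<And>x. norm ((K ^^ k) x) \<le> \<kappa> * norm x"
    using bounded_linear.bounded[OF Kk] by (metis mult.commute)
  obtain \<alpha> where \<alpha>: "\<And>x. norm (A1 x) \<le> \<alpha> * norm x"
    using bounded_linear.bounded[OF A1] by (metis mult.commute)
  \<comment> \<open>\<open>2 * C\<close> carries the old remainder. The rest bounds the new tip
    terms, which have gone through \<open>2 * k\<close> quotients, at
    \<open>(2 / \<tau>)\<^sup>2\<close> each in squared norm, and through \<open>K ^^ k\<close>; the
    \<open>q\<close> term has one quotient more.\<close>
  define C' where "C' = 2 * C + 2 * (\<kappa>\<^sup>2 * ((2 / \<tau>) ^ (4 * k) * (2 + 2 * (\<alpha>\<^sup>2 * (2 / \<tau>)\<^sup>2))))"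
  have C'0: "C' \<ge> 0" unfolding C'_def using C \<tau> by (intro add_nonneg_nonneg mult_nonneg_nonneg zero_le_power2 zero_le_power[of "2 / \<tau>"]) auto
  show ?case
  proof (intro exI[of _ C'] conjI C'0 allI impI)
    fix u u' v v' p q :: "real \<Rightarrow> 'a"
    assume coup: "coupled A1 A2 u u' v v' p q"
    note c = coupledD(5,6)[OF coup]
    have cu: "continuous_on {0..} u"
      by (rule continuous_on_halfline[OF coupledD(1)[OF coup]])
    from IH[OF coup] obtain R where R: "continuous_on {0..} R"
      "\<And>t. t\<ge>0 \<Longrightarrow> (tavg \<tau> ^^ (2 * k)) u t = R t + (K ^^ k) ((tquot \<tau> ^^ (2 * k)) u t)"
      "\<And>T. T\<ge>0 \<Longrightarrow> energy T R \<le> C * (energy (T + real (2 * k) * \<tau>) p + energy (T + real (2 * k) * \<tau>) q)"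
      unfolding K_def by blast
    define r where "r t = tavg \<tau> (tavg \<tau> p) t - A1 (tquot \<tau> (tavg \<tau> q) t)" for t
    have cr: "continuous_on {0..} r"
      unfolding r_def by (intro continuous_intros continuous_tavg continuous_tquot c bounded_linear.continuous_on[OF A1])
    define R' where "R' t = tavg \<tau> (tavg \<tau> R) t + (K ^^ k) ((tquot \<tau> ^^ (2 * k)) r t)" for t
    have cKr: "continuous_on {0..} (\<lambda>t. (K ^^ k) ((tquot \<tau> ^^ (2 * k)) r t))"
      by (intro bounded_linear.continuous_on[OF Kk] continuous_tquot_iterate cr)
    have cR': "continuous_on {0..} R'"
      unfolding R'_def by (intro continuous_intros continuous_tavg R(1) cKr)
    have cQ: "continuous_on {0..} ((tquot \<tau> ^^ (2 * k)) u)" by (rule continuous_tquot_iterate[OF cu])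
    have cbQ: "continuous_on {0..} ((tquot \<tau> ^^ (2 * k)) (tavg \<tau> u))"
      by (intro continuous_tquot_iterate continuous_tavg cu)
    have idt: "(tavg \<tau> ^^ (2 * Suc k)) u t = R' t + (K ^^ Suc k) ((tquot \<tau> ^^ (2 * Suc k)) u t)"
      if t: "t \<ge> 0" for t
    proof -
      have s1: "tavg \<tau> ((tavg \<tau> ^^ (2 * k)) u) s = tavg \<tau> R s + (K ^^ k) ((tquot \<tau> ^^ (2 * k)) (tavg \<tau> u) s)"
        if "0 \<le> s" for s
      proof -
        have "tavg \<tau> ((tavg \<tau> ^^ (2 * k)) u) s = tavg \<tau> (\<lambda>t. R t + (K ^^ k) ((tquot \<tau> ^^ (2 * k)) u t)) s"
          by (rule tavg_cong[OF R(2) that])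
        also have "\<dots> = tavg \<tau> R s + (K ^^ k) (tavg \<tau> ((tquot \<tau> ^^ (2 * k)) u) s)"
          using that by (simp add: tavg_add R(1) bounded_linear.continuous_on[OF Kk] cQ tavg_linear[OF Kk])
        finally show ?thesis using that by (simp add: tavg_tquot_iterate[OF cu])
      qed
      have "(tavg \<tau> ^^ (2 * Suc k)) u t = tavg \<tau> (tavg \<tau> ((tavg \<tau> ^^ (2 * k)) u)) t"
        by (simp add: numeral_2_eq_2)
      also have "\<dots> = tavg \<tau> (\<lambda>s. tavg \<tau> R s + (K ^^ k) ((tquot \<tau> ^^ (2 * k)) (tavg \<tau> u) s)) t"
        by (rule tavg_cong[OF s1 t])
      also have "\<dots> = tavg \<tau> (tavg \<tau> R) t + (K ^^ k) (tavg \<tau> ((tquot \<tau> ^^ (2 * k)) (tavg \<tau> u)) t)"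
        using t by (simp add: tavg_add R(1) continuous_tavg bounded_linear.continuous_on[OF Kk] cbQ tavg_linear[OF Kk])
      also have "tavg \<tau> ((tquot \<tau> ^^ (2 * k)) (tavg \<tau> u)) t = (tquot \<tau> ^^ (2 * k)) (tavg \<tau> (tavg \<tau> u)) t"
        by (intro tavg_tquot_iterate continuous_tavg cu t)
      also have "\<dots> = (tquot \<tau> ^^ (2 * k)) (\<lambda>t. r t - A1 (A2 (tquot \<tau> (tquot \<tau> u) t))) t"
        unfolding r_def
        by (intro tquot_iterate_cong t tavg_square_identity[OF A1 A2 coup])
      also have "\<dots> = (tquot \<tau> ^^ (2 * k)) r t - A1 (A2 ((tquot \<tau> ^^ (2 * k)) (tquot \<tau> (tquot \<tau> u)) t))"
        using tquot_iterate_linear[OF bounded_linear_compose[OF A1 A2], of "2 * k" "tquot \<tau> (tquot \<tau> u)"]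
        by (simp add: tquot_iterate_diff)
      also have "\<dots> = (tquot \<tau> ^^ (2 * k)) r t + K ((tquot \<tau> ^^ (2 * Suc k)) u t)"
        by (simp add: K_def funpow_swap1 numeral_2_eq_2)
      also have "(K ^^ k) \<dots> = (K ^^ k) ((tquot \<tau> ^^ (2 * k)) r t) + (K ^^ k) (K ((tquot \<tau> ^^ (2 * Suc k)) u t))"
        by (rule linear_add[OF bounded_linear.linear[OF Kk]])
      finally show ?thesis by (simp add: R'_def funpow_swap1 add.assoc)
    qed
    have bound: "energy T R' \<le> C' * (energy (T + real (2 * Suc k) * \<tau>) p + energy (T + real (2 * Suc k) * \<tau>) q)"
      if T: "T \<ge> 0" for T
    proof -
      define Ep where "Ep = energy (T + real (2 * Suc k) * \<tau>) p"
      define Eq where "Eq = energy (T + real (2 * Suc k) * \<tau>) q"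
      have pos: "Ep \<ge> 0" "Eq \<ge> 0" by (auto simp: Ep_def Eq_def energy_nonneg)
      have b1: "energy T (tavg \<tau> (tavg \<tau> R)) \<le> C * (Ep + Eq)"
      proof -
        have "energy T (tavg \<tau> (tavg \<tau> R)) \<le> energy (T + \<tau>) (tavg \<tau> R)"
          by (intro energy_tavg continuous_tavg R(1) T)
        also have "\<dots> \<le> energy (T + \<tau> + \<tau>) R" using T \<tau> by (intro energy_tavg R(1)) auto
        also have "\<dots> \<le> C * (energy (T + \<tau> + \<tau> + real (2 * k) * \<tau>) p + energy (T + \<tau> + \<tau> + real (2 * k) * \<tau>) q)"
          using T \<tau> by (intro R(3)) auto
        also have "T + \<tau> + \<tau> + real (2 * k) * \<tau> = T + real (2 * Suc k) * \<tau>"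
          by (simp add: algebra_simps)
        finally show ?thesis by (simp add: Ep_def Eq_def)
      qed
      have b2: "energy T (\<lambda>t. (K ^^ k) ((tquot \<tau> ^^ (2 * k)) r t))
          \<le> \<kappa>\<^sup>2 * ((2 / \<tau>) ^ (4 * k) * (2 * Ep + 2 * (\<alpha>\<^sup>2 * ((2 / \<tau>)\<^sup>2 * Eq))))"
      proof -
        define T1 where "T1 = T + real (2 * k) * \<tau>"
        have T1: "T1 \<ge> 0" "T1 + \<tau> + \<tau> = T + real (2 * Suc k) * \<tau>"
          using T \<tau> by (auto simp: T1_def algebra_simps)
        have "energy T (\<lambda>t. (K ^^ k) ((tquot \<tau> ^^ (2 * k)) r t)) \<le> \<kappa>\<^sup>2 * energy T ((tquot \<tau> ^^ (2 * k)) r)"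
          by (rule energy_le[OF cKr continuous_tquot_iterate[OF cr]]) (rule \<kappa>)
        also have "energy T ((tquot \<tau> ^^ (2 * k)) r) \<le> (2 / \<tau>) ^ (4 * k) * energy T1 r"
          using energy_tquot_iterate[OF cr T, of "2 * k"] by (simp add: T1_def)
        also have "energy T1 r \<le> 2 * Ep + 2 * (\<alpha>\<^sup>2 * ((2 / \<tau>)\<^sup>2 * Eq))"
        proof -
          have cA: "continuous_on {0..} (\<lambda>t. - A1 (tquot \<tau> (tavg \<tau> q) t))"
            by (intro continuous_intros bounded_linear.continuous_on[OF A1] continuous_tquot continuous_tavg c)
          have "energy T1 r = energy T1 (\<lambda>t. tavg \<tau> (tavg \<tau> p) t + (- A1 (tquot \<tau> (tavg \<tau> q) t)))"
            by (simp add: r_def[abs_def])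
          also have "\<dots> \<le> 2 * energy T1 (tavg \<tau> (tavg \<tau> p)) + 2 * energy T1 (\<lambda>t. - A1 (tquot \<tau> (tavg \<tau> q) t))"
            by (intro energy_add_le2 continuous_tavg c cA)
          also have "energy T1 (tavg \<tau> (tavg \<tau> p)) \<le> Ep"
          proof -
            have "energy T1 (tavg \<tau> (tavg \<tau> p)) \<le> energy (T1 + \<tau>) (tavg \<tau> p)"
              by (intro energy_tavg continuous_tavg c T1)
            also have "\<dots> \<le> energy (T1 + \<tau> + \<tau>) p" using T1 \<tau> by (intro energy_tavg c) auto
            finally show ?thesis by (simp add: T1(2) Ep_def)
          qed
          also have "energy T1 (\<lambda>t. - A1 (tquot \<tau> (tavg \<tau> q) t)) \<le> \<alpha>\<^sup>2 * ((2 / \<tau>)\<^sup>2 * Eq)"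
          proof -
            have "energy T1 (\<lambda>t. - A1 (tquot \<tau> (tavg \<tau> q) t)) \<le> \<alpha>\<^sup>2 * energy T1 (tquot \<tau> (tavg \<tau> q))"
              by (rule energy_le[OF cA]) (auto intro: continuous_tquot continuous_tavg c \<alpha>)
            also have "energy T1 (tquot \<tau> (tavg \<tau> q)) \<le> (2 / \<tau>)\<^sup>2 * energy (T1 + \<tau>) (tavg \<tau> q)"
              by (intro energy_tquot continuous_tavg c T1)
            also have "energy (T1 + \<tau>) (tavg \<tau> q) \<le> energy (T1 + \<tau> + \<tau>) q"
              using T1 \<tau> by (intro energy_tavg c) auto
            also have "\<dots> = Eq" by (simp add: T1(2) Eq_def)
            finally show ?thesis by (simp add: mult_left_mono)
          qed
          finally show ?thesis by simp
        qed
        finally show ?thesis using \<tau> by (simp add: mult_left_mono)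
      qed
      have "energy T R' \<le> 2 * energy T (tavg \<tau> (tavg \<tau> R)) + 2 * energy T (\<lambda>t. (K ^^ k) ((tquot \<tau> ^^ (2 * k)) r t))"
        unfolding R'_def by (intro energy_add_le2 continuous_tavg R(1) cKr)
      also have "\<dots> \<le> 2 * (C * (Ep + Eq)) + 2 * (\<kappa>\<^sup>2 * ((2 / \<tau>) ^ (4 * k) * (2 * Ep + 2 * (\<alpha>\<^sup>2 * ((2 / \<tau>)\<^sup>2 * Eq)))))"
        using b1 b2 by simp
      also have "\<dots> \<le> 2 * (C * (Ep + Eq)) + 2 * (\<kappa>\<^sup>2 * ((2 / \<tau>) ^ (4 * k) * ((2 + 2 * (\<alpha>\<^sup>2 * (2 / \<tau>)\<^sup>2)) * (Ep + Eq))))"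
      proof -
        define x where "x = \<alpha>\<^sup>2 * (2 / \<tau>)\<^sup>2"
        have "x * Ep \<ge> 0" unfolding x_def using pos by simp
        then have "2 * Ep + 2 * (x * Eq) \<le> (2 + 2 * x) * (Ep + Eq)"
          using pos by (simp add: algebra_simps)
        then have "2 * Ep + 2 * (\<alpha>\<^sup>2 * ((2 / \<tau>)\<^sup>2 * Eq)) \<le> (2 + 2 * (\<alpha>\<^sup>2 * (2 / \<tau>)\<^sup>2)) * (Ep + Eq)"
          by (simp only: x_def mult.assoc)
        then show ?thesis by (intro add_left_mono mult_left_mono) (use \<tau> in auto)
      qed
      also have "\<dots> = C' * (Ep + Eq)" by (simp add: C'_def algebra_simps)
      finally show ?thesis by (simp add: Ep_def Eq_def)
    qed
    show "\<exists>R. continuous_on {0..} R \<and>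
        (\<forall>t\<ge>0. (tavg \<tau> ^^ (2 * Suc k)) u t = R t + (((\<lambda>x. - A1 (A2 x)) ^^ Suc k) ((tquot \<tau> ^^ (2 * Suc k)) u t))) \<and>
        (\<forall>T\<ge>0. energy T R \<le> C' * (energy (T + real (2 * Suc k) * \<tau>) p + energy (T + real (2 * Suc k) * \<tau>) q))"
      using cR' idt bound unfolding K_def by blast
  qed
qed

text \<open>The operator bound \<open>\<kappa>\<close> is a parameter of its own, because for
  Volterra operators it lies far below the \<open>k\<close>-th power of the norm; only this gain can
  compensate the factor \<open>(2 / \<tau>) ^ (4 * k)\<close>.\<close>

lemma low_frequency_bound:
  fixes A1 A2 :: "'a::banach \<Rightarrow> 'a"
  assumes A1: "bounded_linear A1" and A2: "bounded_linear A2"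
    and \<kappa>: "\<And>x. norm (((\<lambda>x. - A1 (A2 x)) ^^ k) x) \<le> \<kappa> * norm x"
  obtains C where "C \<ge> 0" "\<And>u u' v v' p q T. coupled A1 A2 u u' v v' p q \<Longrightarrow> T \<ge> 0 \<Longrightarrow>
      energy T ((tavg \<tau> ^^ (2 * k)) u) \<le>
        C * (energy (T + real (2 * k) * \<tau>) p + energy (T + real (2 * k) * \<tau>) q)
        + 2 * (\<kappa>\<^sup>2 * (2 / \<tau>) ^ (4 * k)) * energy (T + real (2 * k) * \<tau>) u"
proof -
  define K where "K = (\<lambda>x. - A1 (A2 x))"
  have Kk: "bounded_linear (K ^^ k)"
    unfolding K_def by (intro bounded_linear_iterate bounded_linear_minus bounded_linear_compose[OF A1 A2])
  obtain C where C: "C \<ge> 0" and ex: "\<And>u u' v v' p q. coupled A1 A2 u u' v v' p q \<Longrightarrow>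
      (\<exists>R. continuous_on {0..} R \<and>
        (\<forall>t\<ge>0. (tavg \<tau> ^^ (2 * k)) u t = R t + ((K ^^ k) ((tquot \<tau> ^^ (2 * k)) u t))) \<and>
        (\<forall>T\<ge>0. energy T R \<le> C * (energy (T + real (2 * k) * \<tau>) p + energy (T + real (2 * k) * \<tau>) q)))"
    using tavg_iterate_expansion[OF A1 A2, of k] unfolding K_def by meson
  show ?thesis
  proof (rule that[of "2 * C"])
    show "2 * C \<ge> 0" using C by simp
    fix u u' v v' p q :: "real \<Rightarrow> 'a" and T :: real
    assume coup: "coupled A1 A2 u u' v v' p q" and T: "T \<ge> 0"
    have cu: "continuous_on {0..} u"
      by (rule continuous_on_halfline[OF coupledD(1)[OF coup]])
    from ex[OF coup] obtain R where R: "continuous_on {0..} R"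
      "\<And>t. t\<ge>0 \<Longrightarrow> (tavg \<tau> ^^ (2 * k)) u t = R t + (K ^^ k) ((tquot \<tau> ^^ (2 * k)) u t)"
      "energy T R \<le> C * (energy (T + real (2 * k) * \<tau>) p + energy (T + real (2 * k) * \<tau>) q)"
      using T by auto
    have cK: "continuous_on {0..} (\<lambda>t. (K ^^ k) ((tquot \<tau> ^^ (2 * k)) u t))"
      by (intro bounded_linear.continuous_on[OF Kk] continuous_tquot_iterate cu)
    have "energy T ((tavg \<tau> ^^ (2 * k)) u) = energy T (\<lambda>t. R t + (K ^^ k) ((tquot \<tau> ^^ (2 * k)) u t))"
      by (rule energy_cong) (rule R(2))
    also have "\<dots> \<le> 2 * energy T R + 2 * energy T (\<lambda>t. (K ^^ k) ((tquot \<tau> ^^ (2 * k)) u t))"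
      by (intro energy_add_le2 R(1) cK)
    also have "energy T (\<lambda>t. (K ^^ k) ((tquot \<tau> ^^ (2 * k)) u t)) \<le> \<kappa>\<^sup>2 * energy T ((tquot \<tau> ^^ (2 * k)) u)"
      by (rule energy_le[OF cK continuous_tquot_iterate[OF cu]]) (unfold K_def, rule \<kappa>)
    also have "energy T ((tquot \<tau> ^^ (2 * k)) u) \<le> (2 / \<tau>) ^ (4 * k) * energy (T + real (2 * k) * \<tau>) u"
      using energy_tquot_iterate[OF cu T, of "2 * k"] by simp
    finally show "energy T ((tavg \<tau> ^^ (2 * k)) u) \<le>
        2 * C * (energy (T + real (2 * k) * \<tau>) p + energy (T + real (2 * k) * \<tau>) q)
        + 2 * (\<kappa>\<^sup>2 * (2 / \<tau>) ^ (4 * k)) * energy (T + real (2 * k) * \<tau>) u"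
      using R(3) \<tau> by (simp add: mult_left_mono mult.assoc)
  qed
qed

end

section \<open>The beam and its multiplier\<close>

lemma young:
  fixes x y e :: real
  assumes "e > 0"
  shows "x * y \<le> e * x\<^sup>2 + 1 / (4 * e) * y\<^sup>2"
proof -
  have "0 \<le> (2 * e * x - y)\<^sup>2 / (4 * e)" using assms by simp
  also have "\<dots> = e * x\<^sup>2 + 1 / (4 * e) * y\<^sup>2 - x * y"
    using assms by (simp add: field_simps power2_eq_square)
  finally show ?thesis by simp
qed

lemma to_l2_inner_continuous:
  assumes "continuous_on {0..1} f" "continuous_on {0..1} g"
  shows "inner (to_l2 f) (to_l2 g) = integral {0..1} (\<lambda>x. inner (f x) (g x))"
  using assms by (simp add: to_l2_inner L2_continuous unit_integral_eq L2_inner_integrable)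

lemma has_vector_derivative_inner:
  fixes f g :: "real \<Rightarrow> 'a::real_inner"
  assumes "(f has_vector_derivative f') (at x within A)" "(g has_vector_derivative g') (at x within A)"
  shows "((\<lambda>x. inner (f x) (g x)) has_real_derivative inner (f x) g' + inner f' (g x)) (at x within A)"
  using bounded_bilinear.has_vector_derivative[OF bounded_bilinear_inner assms]
  by (simp add: has_real_derivative_iff_has_vector_derivative)

lemma FTC_unit_real:
  fixes f :: "real \<Rightarrow> real"
  assumes "\<And>x. x \<in> {0..1} \<Longrightarrow> (f has_real_derivative f' x) (at x within {0..1})"
  shows "(f' has_integral (f 1 - f 0)) {0..1}"
  using assms by (intro FTC_unit) (auto simp: has_real_derivative_iff_has_vector_derivative)

lemma norm_endpoint_le:
  assumes d: "\<And>x. x \<in> {0..1} \<Longrightarrow> (f has_vector_derivative f' x) (at x within {0..1})"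
    and c: "continuous_on {0..1} f'" and f0: "f 0 = 0"
  shows "norm (f 1) \<le> norm (to_l2 f')" "(norm (f 1))\<^sup>2 \<le> 2 * (norm (to_l2 f) * norm (to_l2 f'))"
proof -
  have cf: "continuous_on {0..1} f" by (rule derivative_imp_continuous_on[OF d])
  have "f 1 = integral {0..1} f'" using FTC_unit[OF d, of 0 1] f0 by (simp add: integral_unique)
  then show "norm (f 1) \<le> norm (to_l2 f')" using L2_integral_norm_le[OF L2_continuous[OF c], of 0 1] by simp
  have "((\<lambda>x. inner (f x) (f' x) + inner (f' x) (f x)) has_integral inner (f 1) (f 1) - inner (f 0) (f 0)) {0..1}"
    by (intro FTC_unit_real has_vector_derivative_inner d)
  then have "((\<lambda>x. 2 * inner (f x) (f' x)) has_integral (norm (f 1))\<^sup>2) {0..1}"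
    by (simp add: f0 inner_commute power2_norm_eq_inner)
  then have "(norm (f 1))\<^sup>2 = 2 * inner (to_l2 f) (to_l2 f')"
    using cf c by (simp add: to_l2_inner_continuous integral_unique flip: integral_mult_right)
  also have "\<dots> \<le> 2 * (norm (to_l2 f) * norm (to_l2 f'))" using norm_cauchy_schwarz by simp
  finally show "(norm (f 1))\<^sup>2 \<le> 2 * (norm (to_l2 f) * norm (to_l2 f'))" .
qed

text \<open>Integration by parts of the squared slope. Since \<open>f\<close> vanishes at one end
  only, the boundary term at 1 survives; the endpoint estimates bound it by the geometric mean of
  the slope term and the wanted right-hand side, so part of it can be absorbed.\<close>

lemma derivative_interpolation:
  assumes d: "\<And>x. x \<in> {0..1} \<Longrightarrow> (f has_vector_derivative f1 x) (at x within {0..1})"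
      "\<And>x. x \<in> {0..1} \<Longrightarrow> (f1 has_vector_derivative f2 x) (at x within {0..1})"
    and c: "continuous_on {0..1} f2" and f0: "f 0 = 0" "f1 0 = 0"
  shows "(norm (to_l2 f1))\<^sup>2 \<le> 6 * (norm (to_l2 f2) * norm (to_l2 f))"
proof -
  have cf: "continuous_on {0..1} f" "continuous_on {0..1} f1"
    by (rule derivative_imp_continuous_on[OF d(1)] derivative_imp_continuous_on[OF d(2)], assumption)+
  define A P Q where "A = norm (to_l2 f1)" and "P = norm (to_l2 f2)" and "Q = norm (to_l2 f)"
  have pos: "A \<ge> 0" "P \<ge> 0" "Q \<ge> 0" by (auto simp: A_def P_def Q_def)
  have "((\<lambda>x. inner (f x) (f2 x) + inner (f1 x) (f1 x)) has_integral inner (f 1) (f1 1) - inner (f 0) (f1 0)) {0..1}"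
    by (intro FTC_unit_real has_vector_derivative_inner d)
  then have "integral {0..1} (\<lambda>x. inner (f x) (f2 x) + inner (f1 x) (f1 x)) = inner (f 1) (f1 1)"
    by (simp add: f0 integral_unique)
  then have "inner (to_l2 f) (to_l2 f2) + A\<^sup>2 = inner (f 1) (f1 1)"
    using cf c by (simp add: A_def power2_norm_eq_inner to_l2_inner_continuous
        Henstock_Kurzweil_Integration.integral_add integrable_continuous_real continuous_on_inner)
  moreover have "- inner (to_l2 f) (to_l2 f2) \<le> P * Q"
    using Cauchy_Schwarz_ineq2[of "to_l2 f" "to_l2 f2"] by (simp add: P_def Q_def mult.commute abs_le_iff)
  moreover have "inner (f 1) (f1 1) \<le> norm (f 1) * norm (f1 1)" by (rule norm_cauchy_schwarz)
  moreover have "norm (f 1) * norm (f1 1) \<le> A\<^sup>2 / 2 + 2 * (P * Q)"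
  proof -
    have "(norm (f 1) * norm (f1 1))\<^sup>2 \<le> (2 * (Q * A)) * (2 * (A * P))"
      using norm_endpoint_le(2)[OF d(1) cf(2) f0(1)] norm_endpoint_le(2)[OF d(2) c f0(2)] pos
      unfolding power_mult_distrib A_def P_def Q_def by (intro mult_mono) auto
    \<comment> \<open>Arranged for \<open>4 * x * y \<le> (x + y)\<^sup>2\<close> with
      \<open>x = A\<^sup>2 / 2\<close>: half of \<open>A\<^sup>2\<close> is absorbed, and the
      remaining \<open>3 * P * Q\<close> doubles to the constant 6.\<close>
    also have "\<dots> = 4 * (A\<^sup>2 / 2) * (2 * (P * Q))" by (simp add: power2_eq_square)
    also have "\<dots> \<le> (A\<^sup>2 / 2 + 2 * (P * Q))\<^sup>2"
      using zero_le_power2[of "A\<^sup>2 / 2 - 2 * (P * Q)"] unfolding power2_sum power2_diff by linarith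
    finally have le: "(norm (f 1) * norm (f1 1))\<^sup>2 \<le> (A\<^sup>2 / 2 + 2 * (P * Q))\<^sup>2" .
    have "0 \<le> A\<^sup>2 / 2 + 2 * (P * Q)" using pos by simp
    with le show ?thesis by (rule power2_le_imp_le)
  qed
  ultimately have "A\<^sup>2 \<le> 6 * (P * Q)" by simp
  then show ?thesis by (simp add: A_def P_def Q_def)
qed

text \<open>Curvature, velocity and the two tip velocities. Replacing the deflection by its
  curvature removes the boundary conditions from the space, so that it is a full product of complete
  spaces.\<close>

type_synonym beam_state = "l2 \<times> l2 \<times> complex \<times> complex"

section \<open>Coefficients, classical states and the multiplier functional of the beam\<close>

locale beam =
  fixes rho rho' EI EI' :: "real \<Rightarrow> real" and m J a b :: real
  assumes rho_deriv: "\<And>x. x \<in> {0..1} \<Longrightarrow> (rho has_real_derivative rho' x) (at x within {0..1})"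
    and rho'_cont: "continuous_on {0..1} rho'"
    and EI_deriv: "\<And>x. x \<in> {0..1} \<Longrightarrow> (EI has_real_derivative EI' x) (at x within {0..1})"
    and EI'_cont: "continuous_on {0..1} EI'"
    and rho_pos: "\<And>x. x \<in> {0..1} \<Longrightarrow> rho x > 0" and EI_pos: "\<And>x. x \<in> {0..1} \<Longrightarrow> EI x > 0"
    and m_pos: "m > 0" and J_pos: "J > 0" and a_pos: "a > 0" and b_pos: "b > 0"
begin

lemma rho_cont: "continuous_on {0..1} rho"
  using rho_deriv by (meson DERIV_continuous continuous_on_eq_continuous_within)

lemma EI_cont: "continuous_on {0..1} EI"
  using EI_deriv by (meson DERIV_continuous continuous_on_eq_continuous_within)

lemma coefficient_bounds:
  obtains r0 H where "r0 > 0" "\<And>x. x \<in> {0..1} \<Longrightarrow> r0 \<le> rho x \<and> r0 \<le> EI x"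
    "\<And>x. x \<in> {0..1} \<Longrightarrow> \<bar>rho x\<bar> \<le> H \<and> \<bar>EI x\<bar> \<le> H \<and> \<bar>rho' x\<bar> \<le> H \<and> \<bar>EI' x\<bar> \<le> H \<and> \<bar>1 / EI x\<bar> \<le> H"
proof -
  obtain x1 where x1: "x1 \<in> {0..1}" "\<And>y. y \<in> {0..1} \<Longrightarrow> rho x1 \<le> rho y"
    using continuous_attains_inf[OF compact_Icc _ rho_cont] by auto
  obtain x2 where x2: "x2 \<in> {0..1}" "\<And>y. y \<in> {0..1} \<Longrightarrow> EI x2 \<le> EI y"
    using continuous_attains_inf[OF compact_Icc _ EI_cont] by auto
  have ci: "continuous_on {0..1} (\<lambda>x. 1 / EI x)"
    using EI_pos by (intro continuous_intros EI_cont) (auto simp: less_imp_neq[symmetric])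
  obtain C1 C2 C3 C4 C5 where C: "\<And>x. x \<in> {0..1} \<Longrightarrow> norm (rho x) \<le> C1" "\<And>x. x \<in> {0..1} \<Longrightarrow> norm (EI x) \<le> C2"
    "\<And>x. x \<in> {0..1} \<Longrightarrow> norm (rho' x) \<le> C3" "\<And>x. x \<in> {0..1} \<Longrightarrow> norm (EI' x) \<le> C4"
    "\<And>x. x \<in> {0..1} \<Longrightarrow> norm (1 / EI x) \<le> C5"
    using continuous_unit_bounded[OF rho_cont] continuous_unit_bounded[OF EI_cont] continuous_unit_bounded[OF rho'_cont]
      continuous_unit_bounded[OF EI'_cont] continuous_unit_bounded[OF ci] by metis
  show ?thesis
  proof (rule that[of "min (rho x1) (EI x2)" "max (max (max C1 C2) (max C3 C4)) C5"])
    show "min (rho x1) (EI x2) > 0" using rho_pos[OF x1(1)] EI_pos[OF x2(1)] by simp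
    fix x :: real assume x: "x \<in> {0..1}"
    show "min (rho x1) (EI x2) \<le> rho x \<and> min (rho x1) (EI x2) \<le> EI x"
      using x1(2)[OF x] x2(2)[OF x] by auto
    show "\<bar>rho x\<bar> \<le> max (max (max C1 C2) (max C3 C4)) C5 \<and> \<bar>EI x\<bar> \<le> max (max (max C1 C2) (max C3 C4)) C5 \<and>
      \<bar>rho' x\<bar> \<le> max (max (max C1 C2) (max C3 C4)) C5 \<and> \<bar>EI' x\<bar> \<le> max (max (max C1 C2) (max C3 C4)) C5 \<and>
      \<bar>1 / EI x\<bar> \<le> max (max (max C1 C2) (max C3 C4)) C5"
      using C[OF x] by (simp add: le_max_iff_disj del: abs_divide)
  qed
qed

text \<open>The two lower bounds make the kinetic and the elastic part of the multiplier identity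
  positive definite. A weight growing fast enough achieves both for arbitrary positive coefficients:
  with \<open>exp (L * x) - 1\<close> the derivative dominates the weight itself by the factor
  \<open>L\<close>.\<close>

lemma multiplier_exists:
  obtains z z1 z2 c where "c > 0"
    "\<And>x. (z has_real_derivative z1 x) (at x within {0..1})" "\<And>x. (z1 has_real_derivative z2 x) (at x within {0..1})"
    "continuous_on {0..1} z2" "z 0 = 0"
    "\<And>x. x \<in> {0..1} \<Longrightarrow> c \<le> rho' x * z x + rho x * z1 x"
    "\<And>x. x \<in> {0..1} \<Longrightarrow> c \<le> 3 * EI x * z1 x - EI' x * z x"
proof -
  obtain r0 H where r0: "r0 > 0" "\<And>x. x \<in> {0..1} \<Longrightarrow> r0 \<le> rho x \<and> r0 \<le> EI x"
    and H: "\<And>x. x \<in> {0..1} \<Longrightarrow> \<bar>rho x\<bar> \<le> H \<and> \<bar>EI x\<bar> \<le> H \<and> \<bar>rho' x\<bar> \<le> H \<and> \<bar>EI' x\<bar> \<le> H \<and> \<bar>1 / EI x\<bar> \<le> H"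
    using coefficient_bounds by metis
  have H0: "H \<ge> 0" using H[of 0] by auto
  \<comment> \<open>Solves \<open>r0 * L = H + r0\<close>: the part \<open>H\<close> outweighs the
    derivatives of the coefficients, and the part \<open>r0\<close> remains as the margin.\<close>
  define L where "L = (H + r0) / r0"
  have L: "r0 * L = H + r0" "L > 0" using r0(1) H0 by (auto simp: L_def field_simps)
  have est: "r0 \<le> k * (exp (L * x) - 1) + q * (L * exp (L * x))"
    if x: "x \<in> {0..1}" and q: "q \<ge> r0" and k: "\<bar>k\<bar> \<le> H" for k q x
  proof -
    have e1: "exp (L * x) \<ge> 1" using x L(2) by simp
    have "k * (exp (L * x) - 1) \<ge> - (H * exp (L * x))"
    proof -
      have "\<bar>k * (exp (L * x) - 1)\<bar> \<le> H * (exp (L * x) - 1)"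
        unfolding abs_mult using e1 k by (intro mult_mono) auto
      also have "\<dots> \<le> H * exp (L * x)" using H0 by (intro mult_left_mono) auto
      finally show ?thesis by (simp add: abs_le_iff)
    qed
    moreover have "q * (L * exp (L * x)) \<ge> r0 * (L * exp (L * x))" using q L(2) by (intro mult_right_mono) auto
    moreover have "r0 * (L * exp (L * x)) = H * exp (L * x) + r0 * exp (L * x)"
      using L(1) by (simp add: mult.assoc[symmetric] distrib_right)
    moreover have "r0 * exp (L * x) \<ge> r0 * 1" using e1 r0(1) by (intro mult_left_mono) auto
    ultimately show ?thesis by linarith
  qed
  show ?thesis
  proof (rule that[of r0 "\<lambda>x. exp (L * x) - 1" "\<lambda>x. L * exp (L * x)" "\<lambda>x. L * (L * exp (L * x))"])
    fix x :: real
    show "((\<lambda>x. exp (L * x) - 1) has_real_derivative L * exp (L * x)) (at x within {0..1})"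
      by (auto intro!: derivative_eq_intros)
    show "((\<lambda>x. L * exp (L * x)) has_real_derivative L * (L * exp (L * x))) (at x within {0..1})"
      by (auto intro!: derivative_eq_intros)
    assume x: "x \<in> {0..1}"
    show "r0 \<le> rho' x * (exp (L * x) - 1) + rho x * (L * exp (L * x))"
      using est[OF x, of "rho x" "rho' x"] r0(2)[OF x] H[OF x] by blast
    have "EI x \<ge> r0" using r0(2)[OF x] by blast
    then have "3 * EI x \<ge> r0" using r0(1) by linarith
    then show "r0 \<le> 3 * EI x * (L * exp (L * x)) - EI' x * (exp (L * x) - 1)"
      using est[OF x, of "3 * EI x" "- EI' x"] H[OF x] by simp
  qed (use r0 in \<open>auto intro!: continuous_intros\<close>)
qed

text \<open>A state \<open>Z\<close> with its time derivative \<open>Y\<close>, regular enough for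
  pointwise calculus: deflection \<open>f\<close>, moment \<open>EI *\<^sub>R f2\<close>, shear
  \<open>M1\<close>, velocity \<open>g\<close> and acceleration \<open>v\<close>. The beam equation
  is the derivative of \<open>M1\<close>, and the tip equations are the last two components of
  \<open>Y\<close>. Continuity of \<open>v\<close> is what membership in the domain of the square
  adds.\<close>

definition classical :: "beam_state \<Rightarrow> beam_state \<Rightarrow> bool"
  where "classical Z Y \<longleftrightarrow> (\<exists>f f1 f2 M1 g g1 g2 v.
    (\<forall>x\<in>{0..1}. (f has_vector_derivative f1 x) (at x within {0..1}) \<and>
      (f1 has_vector_derivative f2 x) (at x within {0..1}) \<and>
      ((\<lambda>x. EI x *\<^sub>R f2 x) has_vector_derivative M1 x) (at x within {0..1}) \<and>
      (M1 has_vector_derivative - (rho x *\<^sub>R v x)) (at x within {0..1}) \<and>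
      (g has_vector_derivative g1 x) (at x within {0..1}) \<and>
      (g1 has_vector_derivative g2 x) (at x within {0..1})) \<and>
    continuous_on {0..1} f2 \<and> continuous_on {0..1} g2 \<and> continuous_on {0..1} v \<and>
    f 0 = 0 \<and> f1 0 = 0 \<and> g 0 = 0 \<and> g1 0 = 0 \<and>
    Z = (to_l2 f2, to_l2 g, g 1, g1 1) \<and>
    Y = (to_l2 g2, to_l2 v, (M1 1 - a *\<^sub>R g 1) /\<^sub>R m, (- (EI 1 *\<^sub>R f2 1) - b *\<^sub>R g1 1) /\<^sub>R J))"

text \<open>Polarised square of the state norm, so \<open>B Z Z\<close> is twice the physical
  energy; accordingly \<open>D\<close> below is twice the power dissipated at the tip.\<close>

definition B :: "beam_state \<Rightarrow> beam_state \<Rightarrow> real"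
  where "B Z Y = (case Z of (p, g, \<xi>, \<eta>) \<Rightarrow> case Y of (p', g', \<xi>', \<eta>') \<Rightarrow>
    inner (mul EI p) p' + inner (mul rho g) g' + m * inner \<xi> \<xi>' + J * inner \<eta> \<eta>')"

definition D :: "beam_state \<Rightarrow> real"
  where "D Z = (case Z of (p, g, \<xi>, \<eta>) \<Rightarrow> 2 * a * (norm \<xi>)\<^sup>2 + 2 * b * (norm \<eta>)\<^sup>2)"

text \<open>Two integrations by parts cancel the interior terms. The boundary terms at the tip
  cancel against the forces on the tip mass and inertia, leaving the damping.\<close>

lemma classical_dissipation:
  assumes "classical Z Y"
  shows "2 * B Z Y = - D Z"
proof -
  obtain f f1 f2 M1 g g1 g2 v where d:
    "\<And>x. x\<in>{0..1} \<Longrightarrow> ((\<lambda>x. EI x *\<^sub>R f2 x) has_vector_derivative M1 x) (at x within {0..1})"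
    "\<And>x. x\<in>{0..1} \<Longrightarrow> (M1 has_vector_derivative - (rho x *\<^sub>R v x)) (at x within {0..1})"
    "\<And>x. x\<in>{0..1} \<Longrightarrow> (g has_vector_derivative g1 x) (at x within {0..1})"
    "\<And>x. x\<in>{0..1} \<Longrightarrow> (g1 has_vector_derivative g2 x) (at x within {0..1})"
    and c: "continuous_on {0..1} f2" "continuous_on {0..1} g2" "continuous_on {0..1} v"
    and z: "g 0 = 0" "g1 0 = 0"
    and Z: "Z = (to_l2 f2, to_l2 g, g 1, g1 1)"
    and Y: "Y = (to_l2 g2, to_l2 v, (M1 1 - a *\<^sub>R g 1) /\<^sub>R m, (- (EI 1 *\<^sub>R f2 1) - b *\<^sub>R g1 1) /\<^sub>R J)"
    using assms unfolding classical_def by blast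
  have cg: "continuous_on {0..1} g" by (rule derivative_imp_continuous_on[OF d(3)])
  have cc: "continuous_on {0..1} (\<lambda>x. EI x *\<^sub>R f2 x)" "continuous_on {0..1} (\<lambda>x. rho x *\<^sub>R g x)"
    by (intro continuous_intros EI_cont rho_cont c cg)+
  have "((\<lambda>x. (inner (EI x *\<^sub>R f2 x) (g2 x) + inner (M1 x) (g1 x)) -
       (inner (M1 x) (g1 x) + inner (- (rho x *\<^sub>R v x)) (g x))) has_integral
      (inner (EI 1 *\<^sub>R f2 1) (g1 1) - inner (M1 1) (g 1)) - (inner (EI 0 *\<^sub>R f2 0) (g1 0) - inner (M1 0) (g 0))) {0..1}"
    by (intro FTC_unit_real DERIV_diff has_vector_derivative_inner d)
  then have "integral {0..1} (\<lambda>x. inner (EI x *\<^sub>R f2 x) (g2 x) + inner (rho x *\<^sub>R g x) (v x))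
      = inner (EI 1 *\<^sub>R f2 1) (g1 1) - inner (M1 1) (g 1)"
    by (simp add: z integral_unique inner_commute del: complex_scaleR)
  moreover have "integral {0..1} (\<lambda>x. inner (EI x *\<^sub>R f2 x) (g2 x) + inner (rho x *\<^sub>R g x) (v x))
      = inner (mul EI (to_l2 f2)) (to_l2 g2) + inner (mul rho (to_l2 g)) (to_l2 v)"
    using cc c cg EI_cont rho_cont
    by (simp add: mul_to_l2 L2_continuous to_l2_inner_continuous Henstock_Kurzweil_Integration.integral_add
        integrable_continuous_real continuous_on_inner del: complex_scaleR inner_scaleR_left)
  moreover have "m * inner (g 1) ((M1 1 - a *\<^sub>R g 1) /\<^sub>R m) = inner (M1 1) (g 1) - a * (norm (g 1))\<^sup>2"
    using m_pos by (simp add: inner_diff_right power2_norm_eq_inner inner_commute del: complex_scaleR)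
  moreover have "J * inner (g1 1) ((- (EI 1 *\<^sub>R f2 1) - b *\<^sub>R g1 1) /\<^sub>R J) = - inner (EI 1 *\<^sub>R f2 1) (g1 1) - b * (norm (g1 1))\<^sup>2"
    using J_pos by (simp add: inner_diff_right power2_norm_eq_inner inner_commute del: complex_scaleR)
  ultimately show ?thesis unfolding B_def D_def Z Y by simp
qed

text \<open>The tip equations express shear and moment at the tip as
  \<open>m *\<^sub>R \<xi>' + a *\<^sub>R \<xi>\<close> and
  \<open>- (J *\<^sub>R \<eta>' + b *\<^sub>R \<eta>)\<close>; integrating the beam equation inwards
  from these values gives the first formula. The velocity is integrated from the same end, so that
  the operators compose to a Volterra operator. The third formula starts from the clamped end and
  therefore has no tip data.\<close>

lemma classical_coupled:
  assumes "classical (p, u, \<xi>, \<eta>) (p', u', \<xi>', \<eta>')"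
  shows "mul EI p = (cst (- (J *\<^sub>R \<eta>' + b *\<^sub>R \<eta>)) - bwd (cst (m *\<^sub>R \<xi>' + a *\<^sub>R \<xi>))) - bwd (bwd (mul rho u'))"
    and "u = (cst \<xi> - bwd (cst \<eta>)) + bwd (bwd (mul (\<lambda>x. 1 / EI x) (mul EI p')))"
    and "u = fwd (fwd p')"
proof -
  obtain f f1 f2 M1 g g1 g2 v where d:
    "\<And>x. x\<in>{0..1} \<Longrightarrow> ((\<lambda>x. EI x *\<^sub>R f2 x) has_vector_derivative M1 x) (at x within {0..1})"
    "\<And>x. x\<in>{0..1} \<Longrightarrow> (M1 has_vector_derivative - (rho x *\<^sub>R v x)) (at x within {0..1})"
    "\<And>x. x\<in>{0..1} \<Longrightarrow> (g has_vector_derivative g1 x) (at x within {0..1})"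
    "\<And>x. x\<in>{0..1} \<Longrightarrow> (g1 has_vector_derivative g2 x) (at x within {0..1})"
    and c: "continuous_on {0..1} f2" "continuous_on {0..1} g2" "continuous_on {0..1} v"
    and z: "g 0 = 0" "g1 0 = 0"
    and Z: "p = to_l2 f2" "u = to_l2 g" "\<xi> = g 1" "\<eta> = g1 1"
    and Y: "p' = to_l2 g2" "u' = to_l2 v" "\<xi>' = (M1 1 - a *\<^sub>R g 1) /\<^sub>R m" "\<eta>' = (- (EI 1 *\<^sub>R f2 1) - b *\<^sub>R g1 1) /\<^sub>R J"
    using assms unfolding classical_def by blast
  have cM: "continuous_on {0..1} M1" by (rule derivative_imp_continuous_on[OF d(2)])
  have cg: "continuous_on {0..1} g1" by (rule derivative_imp_continuous_on[OF d(4)])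
  have cv: "continuous_on {0..1} (\<lambda>x. rho x *\<^sub>R v x)" by (intro continuous_intros rho_cont c)
  have ci: "continuous_on {0..1} (\<lambda>x. 1 / EI x)"
    using EI_pos by (intro continuous_intros EI_cont) (auto simp: less_imp_neq[symmetric])
  have 1: "to_l2 (\<lambda>x. - (rho x *\<^sub>R v x)) = - mul rho (to_l2 v)"
    using cv by (simp add: mul_to_l2 rho_cont L2_continuous c to_l2_uminus del: complex_scaleR)
  have "mul EI p = to_l2 (\<lambda>x. EI x *\<^sub>R f2 x)" by (simp add: Z mul_to_l2 EI_cont L2_continuous c)
  also have "\<dots> = cst (EI 1 *\<^sub>R f2 1) - bwd (to_l2 M1)" by (rule to_l2_backward[OF d(1) cM])
  also have "to_l2 M1 = cst (M1 1) + bwd (mul rho u')"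
    using to_l2_backward[OF d(2)] cv
    by (simp add: 1 Y linear_neg[OF bounded_linear.linear[OF bounded_linear_bwd]] continuous_on_minus del: complex_scaleR)
  also have "M1 1 = m *\<^sub>R \<xi>' + a *\<^sub>R \<xi>" using m_pos by (simp add: Y Z del: complex_scaleR)
  also have "EI 1 *\<^sub>R f2 1 = - (J *\<^sub>R \<eta>' + b *\<^sub>R \<eta>)" using J_pos by (simp add: Y Z del: complex_scaleR)
  finally show "mul EI p = (cst (- (J *\<^sub>R \<eta>' + b *\<^sub>R \<eta>)) - bwd (cst (m *\<^sub>R \<xi>' + a *\<^sub>R \<xi>))) - bwd (bwd (mul rho u'))"
    by (simp add: linear_add[OF bounded_linear.linear[OF bounded_linear_bwd]] del: complex_scaleR)
  have "mul (\<lambda>x. 1 / EI x) (mul EI p') = p'"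
  proof -
    have "mul (\<lambda>x. 1 / EI x) (mul EI p') = to_l2 (\<lambda>x. (1 / EI x) *\<^sub>R EI x *\<^sub>R g2 x)"
      by (simp add: Y mul_to_l2 EI_cont ci L2_continuous c L2_mult_continuous del: complex_scaleR scaleR_scaleR)
    also have "\<dots> = to_l2 g2"
      by (rule to_l2_cong(1)[symmetric, OF L2_continuous[OF c(2)]]) (use EI_pos in \<open>force simp: less_imp_neq[symmetric]\<close>)
    finally show ?thesis by (simp add: Y)
  qed
  moreover have "u = cst \<xi> - bwd (cst \<eta> - bwd p')"
    unfolding Z Y using to_l2_backward[OF d(3) cg] to_l2_backward[OF d(4) c(2)] by simp
  ultimately show "u = (cst \<xi> - bwd (cst \<eta>)) + bwd (bwd (mul (\<lambda>x. 1 / EI x) (mul EI p')))"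
    by (simp add: linear_diff[OF bounded_linear.linear[OF bounded_linear_bwd]])
  show "u = fwd (fwd p')"
    unfolding Z Y using to_l2_forward[OF d(3) cg z(1)] to_l2_forward[OF d(4) c(2) z(2)] by simp
qed

text \<open>Velocity of the first state against slope of the second, since \<open>fwd\<close> of the
  curvature is the slope. The form is not symmetric, so the time derivative of the functional along
  an orbit is the sum over both orders.\<close>

definition G :: "(real \<Rightarrow> real) \<Rightarrow> beam_state \<Rightarrow> beam_state \<Rightarrow> real"
  where "G z Z Y = inner (mul (\<lambda>x. rho x * z x) (fst (snd Z))) (fwd (fst Y))"

text \<open>The time derivative of the multiplier functional is a boundary term minus a positive definite
  quadratic form, up to the product of slope and curvature.\<close>

lemma multiplier_identity:
  assumes d: "\<And>x. x\<in>{0..1} \<Longrightarrow> (f has_vector_derivative f1 x) (at x within {0..1})"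
    "\<And>x. x\<in>{0..1} \<Longrightarrow> (f1 has_vector_derivative f2 x) (at x within {0..1})"
    "\<And>x. x\<in>{0..1} \<Longrightarrow> ((\<lambda>x. EI x *\<^sub>R f2 x) has_vector_derivative M1 x) (at x within {0..1})"
    "\<And>x. x\<in>{0..1} \<Longrightarrow> (M1 has_vector_derivative - (rho x *\<^sub>R v x)) (at x within {0..1})"
    "\<And>x. x\<in>{0..1} \<Longrightarrow> (g has_vector_derivative g1 x) (at x within {0..1})"
    and z: "\<And>x. (z has_real_derivative z1 x) (at x within {0..1})" "\<And>x. (z1 has_real_derivative z2 x) (at x within {0..1})"
    and z0: "z 0 = 0" "f1 0 = 0"
  shows "((\<lambda>x. rho x * z x * (inner (v x) (f1 x) + inner (g x) (g1 x))
      + (rho' x * z x + rho x * z1 x) / 2 * (norm (g x))\<^sup>2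
      + (3 * EI x * z1 x - EI' x * z x) / 2 * (norm (f2 x))\<^sup>2
      + EI x * z2 x * inner (f2 x) (f1 x))
    has_integral rho 1 * z 1 / 2 * (norm (g 1))\<^sup>2 - z 1 * inner (M1 1) (f1 1)
      + z1 1 * inner (EI 1 *\<^sub>R f2 1) (f1 1) + z 1 * EI 1 / 2 * (norm (f2 1))\<^sup>2) {0..1}"
proof -
  define M where "M x = EI x *\<^sub>R f2 x" for x
  \<comment> \<open>The first two terms come from the multiplier \<open>z * f1\<close>. The third
    removes the product of shear and slope, the last that of shear and curvature; together they
    produce the factor 3 in front of \<open>EI x * z1 x\<close>. The last term is written in the
    moment, whose derivative is the shear.\<close>
  define Hb where "Hb x = (rho x * z x / 2 * inner (g x) (g x) - z x * inner (M1 x) (f1 x)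
      + z1 x * inner (M x) (f1 x)) + z x / EI x / 2 * inner (M x) (M x)" for x
  define k where "k x = rho x * z x * (inner (v x) (f1 x) + inner (g x) (g1 x))
      + (rho' x * z x + rho x * z1 x) / 2 * (norm (g x))\<^sup>2
      + (3 * EI x * z1 x - EI' x * z x) / 2 * (norm (f2 x))\<^sup>2
      + EI x * z2 x * inner (f2 x) (f1 x)" for x
  have "(Hb has_real_derivative k x) (at x within {0..1})" if x: "x \<in> {0..1}" for x
  proof -
    note dM = d(3)[OF x, folded M_def]
    have EIx: "EI x \<noteq> 0" using EI_pos[OF x] by simp
    note t1 = DERIV_mult[OF DERIV_cdivide[OF DERIV_mult[OF rho_deriv[OF x] z(1)[of x]], of 2] has_vector_derivative_inner[OF d(5)[OF x] d(5)[OF x]]]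
    note t2 = DERIV_mult[OF z(1)[of x] has_vector_derivative_inner[OF d(4)[OF x] d(2)[OF x]]]
    note t3 = DERIV_mult[OF z(2)[of x] has_vector_derivative_inner[OF dM d(2)[OF x]]]
    note t4 = DERIV_mult[OF DERIV_cdivide[OF DERIV_divide[OF z(1)[of x] EI_deriv[OF x] EIx], of 2] has_vector_derivative_inner[OF dM dM]]
    show ?thesis unfolding Hb_def
    proof (rule DERIV_cong[OF DERIV_add[OF DERIV_add[OF DERIV_diff[OF t1 t2] t3] t4]])
      have M: "inner (M x) y = EI x * inner (f2 x) y" "inner y (M x) = EI x * inner (f2 x) y" for y
        by (simp_all add: M_def inner_commute del: complex_scaleR)
      show "(rho' x * z x + z1 x * rho x) / 2 * inner (g x) (g x) + (inner (g x) (g1 x) + inner (g1 x) (g x)) * (rho x * z x / 2) -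
        (z1 x * inner (M1 x) (f1 x) + (inner (M1 x) (f2 x) + inner (- (rho x *\<^sub>R v x)) (f1 x)) * z x) +
        (z2 x * inner (M x) (f1 x) + (inner (M x) (f2 x) + inner (M1 x) (f1 x)) * z1 x) +
        ((z1 x * EI x - z x * EI' x) / (EI x * EI x) / 2 * inner (M x) (M x) +
         (inner (M x) (M1 x) + inner (M1 x) (M x)) * (z x / EI x / 2)) = k x"
        using EIx
        by (simp add: k_def M inner_commute power2_norm_eq_inner field_simps del: complex_scaleR)
    qed
  qed
  then have "(k has_integral (Hb 1 - Hb 0)) {0..1}" by (rule FTC_unit_real)
  moreover have "Hb 0 = 0" by (simp add: Hb_def z0)
  moreover have "Hb 1 = rho 1 * z 1 / 2 * (norm (g 1))\<^sup>2 - z 1 * inner (M1 1) (f1 1)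
      + z1 1 * inner (EI 1 *\<^sub>R f2 1) (f1 1) + z 1 * EI 1 / 2 * (norm (f2 1))\<^sup>2"
    using EI_pos[of 1] by (simp add: Hb_def M_def power2_norm_eq_inner del: complex_scaleR)
  ultimately show ?thesis by (simp add: k_def[abs_def])
qed

end

lemma mul_form_bounds:
  assumes h: "continuous_on {0..1} h" "\<And>x. x \<in> {0..1} \<Longrightarrow> r \<le> h x \<and> h x \<le> H"
  shows "r * (norm u)\<^sup>2 \<le> inner (mul h u) u" "inner (mul h u) u \<le> H * (norm u)\<^sup>2"
proof -
  obtain f where f: "L2 f" "u = to_l2 f" by (rule l2_cases)
  have i: "integrable unit_measure (\<lambda>x. inner (h x *\<^sub>R f x) (f x))"
    by (intro L2_inner_integrable L2_mult_continuous f h)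
  have eq: "inner (mul h u) u = (LINT x|unit_measure. inner (h x *\<^sub>R f x) (f x))"
    using f h(1) by (simp add: mul_to_l2 to_l2_inner L2_mult_continuous del: complex_scaleR inner_scaleR_left)
  have n: "(LINT x|unit_measure. k * (norm (f x))\<^sup>2) = k * (norm u)\<^sup>2" for k
    using f by (simp add: to_l2_norm_sq)
  have s: "inner (h x *\<^sub>R f x) (f x) = h x * (norm (f x))\<^sup>2" for x
    by (simp add: power2_norm_eq_inner del: complex_scaleR)
  show "r * (norm u)\<^sup>2 \<le> inner (mul h u) u" unfolding eq n[symmetric] 
    by (intro integral_mono i integrable_mult_right L2_integrable_norm_sq f)
       (use h(2) in \<open>auto simp: s intro!: mult_right_mono simp del: complex_scaleR inner_scaleR_left\<close>)
  show "inner (mul h u) u \<le> H * (norm u)\<^sup>2" unfolding eq n[symmetric]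
    by (intro integral_mono i integrable_mult_right L2_integrable_norm_sq f)
       (use h(2) in \<open>auto simp: s intro!: mult_right_mono simp del: complex_scaleR inner_scaleR_left\<close>)
qed

lemma bounded_bilinear_add:
  assumes f: "bounded_bilinear f" and g: "bounded_bilinear g"
  shows "bounded_bilinear (\<lambda>x y. f x y + g x y)"
proof
  fix x x' y y' r
  show "f (x + x') y + g (x + x') y = f x y + g x y + (f x' y + g x' y)"
    by (simp add: bounded_bilinear.add_left[OF f] bounded_bilinear.add_left[OF g])
  show "f x (y + y') + g x (y + y') = f x y + g x y + (f x y' + g x y')"
    by (simp add: bounded_bilinear.add_right[OF f] bounded_bilinear.add_right[OF g])
  show "f (r *\<^sub>R x) y + g (r *\<^sub>R x) y = r *\<^sub>R (f x y + g x y)"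
    by (simp add: bounded_bilinear.scaleR_left[OF f] bounded_bilinear.scaleR_left[OF g] scaleR_add_right)
  show "f x (r *\<^sub>R y) + g x (r *\<^sub>R y) = r *\<^sub>R (f x y + g x y)"
    by (simp add: bounded_bilinear.scaleR_right[OF f] bounded_bilinear.scaleR_right[OF g] scaleR_add_right)
next
  obtain K L where K: "\<And>x y. norm (f x y) \<le> norm x * norm y * K"
    and L: "\<And>x y. norm (g x y) \<le> norm x * norm y * L"
    using bounded_bilinear.bounded[OF f] bounded_bilinear.bounded[OF g] by metis
  have "norm (f x y + g x y) \<le> norm x * norm y * (K + L)" for x y
    using norm_triangle_mono[OF K[of x y] L[of x y]] by (simp add: distrib_left)
  then show "\<exists>K. \<forall>x y. norm (f x y + g x y) \<le> norm x * norm y * K" by blast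
qed

lemma integral_weighted_sq:
  assumes "continuous_on {0..1} f"
  shows "((\<lambda>x. (norm (f x))\<^sup>2) has_integral (norm (to_l2 f))\<^sup>2) {0..1}"
proof -
  have "(norm (to_l2 f))\<^sup>2 = integral {0..1} (\<lambda>x. (norm (f x))\<^sup>2)"
    using to_l2_inner_continuous[OF assms assms] by (simp add: power2_norm_eq_inner)
  moreover have "(\<lambda>x. (norm (f x))\<^sup>2) integrable_on {0..1}"
    by (intro integrable_continuous_real continuous_intros assms)
  ultimately show ?thesis by (simp add: has_integral_integral)
qed

definition tips :: "beam_state \<Rightarrow> real"
  where "tips Z = (norm (fst (snd (snd Z))))\<^sup>2 + (norm (snd (snd (snd Z))))\<^sup>2"

lemma tips_nonneg: "tips Z \<ge> 0"
  by (simp add: tips_def)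

lemma norm_sq_beam_state:
  "(norm (Z :: beam_state))\<^sup>2 = (norm (fst Z))\<^sup>2 + (norm (fst (snd Z)))\<^sup>2 + tips Z"
  by (simp add: tips_def norm_prod_def)

context beam
begin

text \<open>Shear and moment at the tip are linear in the tip data of \<open>Z\<close> and
  \<open>Y\<close>. The slope at the tip is not, and neither is the product of slope and curvature
  in the interior; both are absorbed into the curvature, the latter at the price of the squared
  deflection. Of the available \<open>c / 2\<close> for the squared curvature, \<open>c / 4\<close>
  is spent.\<close>

lemma multiplier_estimate:
  obtains z c C where "continuous_on {0..1} z" "c > 0" "C \<ge> 0"
    "\<And>Z Y. classical Z Y \<Longrightarrow> G z Y Z + G z Z Y
      \<le> - c * ((norm (fst Z))\<^sup>2 + (norm (fst (snd Z)))\<^sup>2) + C * (tips Z + tips Y)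
        + C * (norm (fwd (fwd (fst Z))))\<^sup>2"
proof -
  obtain z z1 z2 c where c: "c > 0"
    and z: "\<And>x. (z has_real_derivative z1 x) (at x within {0..1})" "\<And>x. (z1 has_real_derivative z2 x) (at x within {0..1})"
      "continuous_on {0..1} z2" "z 0 = 0"
    and cr: "\<And>x. x \<in> {0..1} \<Longrightarrow> c \<le> rho' x * z x + rho x * z1 x"
    and ce: "\<And>x. x \<in> {0..1} \<Longrightarrow> c \<le> 3 * EI x * z1 x - EI' x * z x"
    using multiplier_exists by metis
  have cz: "continuous_on {0..1} z" "continuous_on {0..1} z1"
    using z(1,2) by (meson DERIV_continuous continuous_on_eq_continuous_within)+
  have crz: "continuous_on {0..1} (\<lambda>x. rho x * z x)" "continuous_on {0..1} (\<lambda>x. EI x * z2 x)"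
    by (intro continuous_intros rho_cont EI_cont cz z)+
  obtain K where K: "\<And>x. x \<in> {0..1} \<Longrightarrow> norm (EI x * z2 x) \<le> K" "K > 0"
    using continuous_unit_bounded[OF crz(2)] by metis
  have EI1: "EI 1 > 0" by (rule EI_pos) simp
  define K1 where "K1 = \<bar>rho 1 * z 1 / 2\<bar>"
  define K2 where "K2 = 8 / c * (z 1)\<^sup>2"
  define K3 where "K3 = 8 / c * (z1 1)\<^sup>2 + \<bar>z 1\<bar> / (2 * EI 1)"
  define K4 where "K4 = 4 / c * (12 * K\<^sup>2 / c)\<^sup>2"
  define C where "C = K1 + K2 * (2 * m\<^sup>2 + 2 * a\<^sup>2) + K3 * (2 * J\<^sup>2 + 2 * b\<^sup>2) + K4"
  have K0: "K1 \<ge> 0" "K2 \<ge> 0" "K3 \<ge> 0" "K4 \<ge> 0" using c EI1 by (auto simp: K1_def K2_def K3_def K4_def)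
  have C0: "C \<ge> 0" unfolding C_def using K0 by simp
  show ?thesis
  proof (rule that[of z "c / 4" C])
    fix Z Y assume "classical Z Y"
    then obtain f f1 f2 M1 g g1 g2 v where d:
      "\<And>x. x\<in>{0..1} \<Longrightarrow> (f has_vector_derivative f1 x) (at x within {0..1})"
      "\<And>x. x\<in>{0..1} \<Longrightarrow> (f1 has_vector_derivative f2 x) (at x within {0..1})"
      "\<And>x. x\<in>{0..1} \<Longrightarrow> ((\<lambda>x. EI x *\<^sub>R f2 x) has_vector_derivative M1 x) (at x within {0..1})"
      "\<And>x. x\<in>{0..1} \<Longrightarrow> (M1 has_vector_derivative - (rho x *\<^sub>R v x)) (at x within {0..1})"
      "\<And>x. x\<in>{0..1} \<Longrightarrow> (g has_vector_derivative g1 x) (at x within {0..1})"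
      "\<And>x. x\<in>{0..1} \<Longrightarrow> (g1 has_vector_derivative g2 x) (at x within {0..1})"
      and cn: "continuous_on {0..1} f2" "continuous_on {0..1} g2" "continuous_on {0..1} v"
      and zero: "f 0 = 0" "f1 0 = 0" "g 0 = 0" "g1 0 = 0"
      and Z: "Z = (to_l2 f2, to_l2 g, g 1, g1 1)"
      and Y: "Y = (to_l2 g2, to_l2 v, (M1 1 - a *\<^sub>R g 1) /\<^sub>R m, (- (EI 1 *\<^sub>R f2 1) - b *\<^sub>R g1 1) /\<^sub>R J)"
      unfolding classical_def by blast
    have cf: "continuous_on {0..1} f1" "continuous_on {0..1} g" "continuous_on {0..1} g1"
      by (rule derivative_imp_continuous_on[OF d(2)] derivative_imp_continuous_on[OF d(5)]
          derivative_imp_continuous_on[OF d(6)], assumption)+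
    define P Q A where "P = norm (to_l2 f2)" and "Q = norm (to_l2 f)" and "A = norm (to_l2 f1)"
    have Qeq: "norm (fwd (fwd (fst Z))) = Q"
      using to_l2_forward[OF d(1) cf(1) zero(1)] to_l2_forward[OF d(2) cn(1) zero(2)] by (simp add: Z Q_def)
    define X where "X = G z Y Z + G z Z Y"
    define I4 where "I4 = inner (mul (\<lambda>x. EI x * z2 x) (to_l2 f2)) (to_l2 f1)"
    define Bd where "Bd = rho 1 * z 1 / 2 * (norm (g 1))\<^sup>2 - z 1 * inner (M1 1) (f1 1)
      + z1 1 * inner (EI 1 *\<^sub>R f2 1) (f1 1) + z 1 * EI 1 / 2 * (norm (f2 1))\<^sup>2"
    have G1: "((\<lambda>x. k x * inner (u x) (w x)) has_integral inner (mul k (to_l2 u)) (to_l2 w)) {0..1}"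
      if "continuous_on {0..1} k" "continuous_on {0..1} u" "continuous_on {0..1} w" for k u w
    proof -
      have "inner (mul k (to_l2 u)) (to_l2 w) = integral {0..1} (\<lambda>x. k x * inner (u x) (w x))"
        using that by (simp add: mul_to_l2 L2_continuous to_l2_inner_continuous continuous_on_scaleR
            del: complex_scaleR)
      moreover have "(\<lambda>x. k x * inner (u x) (w x)) integrable_on {0..1}"
        by (intro integrable_continuous_real continuous_intros that)
      ultimately show ?thesis by (simp add: has_integral_integral)
    qed
    have X1: "((\<lambda>x. rho x * z x * (inner (v x) (f1 x) + inner (g x) (g1 x))) has_integral X) {0..1}"
    proof -
      have "fwd (to_l2 f2) = to_l2 f1" "fwd (to_l2 g2) = to_l2 g1"
        using to_l2_forward[OF d(2) cn(1) zero(2)] to_l2_forward[OF d(6) cn(2) zero(4)] by simp_all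
      then have "X = inner (mul (\<lambda>x. rho x * z x) (to_l2 v)) (to_l2 f1) + inner (mul (\<lambda>x. rho x * z x) (to_l2 g)) (to_l2 g1)"
        by (simp add: X_def G_def Z Y)
      then show ?thesis
        unfolding distrib_left by (simp only:) (intro has_integral_add G1 crz cn cf)
    qed
    have I41: "((\<lambda>x. EI x * z2 x * inner (f2 x) (f1 x)) has_integral I4) {0..1}"
      unfolding I4_def by (intro G1 crz cn cf)
    have "((\<lambda>x. (rho x * z x * (inner (v x) (f1 x) + inner (g x) (g1 x))
      + (rho' x * z x + rho x * z1 x) / 2 * (norm (g x))\<^sup>2
      + (3 * EI x * z1 x - EI' x * z x) / 2 * (norm (f2 x))\<^sup>2
      + EI x * z2 x * inner (f2 x) (f1 x)) - rho x * z x * (inner (v x) (f1 x) + inner (g x) (g1 x))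
      - EI x * z2 x * inner (f2 x) (f1 x)) has_integral Bd - X - I4) {0..1}"
      unfolding Bd_def
      by (intro has_integral_diff X1 I41 multiplier_identity[where f = f and g = g] d z zero)
    then have "((\<lambda>x. (rho' x * z x + rho x * z1 x) / 2 * (norm (g x))\<^sup>2
      + (3 * EI x * z1 x - EI' x * z x) / 2 * (norm (f2 x))\<^sup>2) has_integral Bd - X - I4) {0..1}"
      by (rule has_integral_eq[rotated]) simp
    moreover have "((\<lambda>x. c / 2 * (norm (g x))\<^sup>2 + c / 2 * (norm (f2 x))\<^sup>2) has_integral
        c / 2 * (norm (to_l2 g))\<^sup>2 + c / 2 * (norm (to_l2 f2))\<^sup>2) {0..1}"
      by (intro has_integral_add has_integral_mult_right integral_weighted_sq cf cn)
    ultimately have "c / 2 * (norm (to_l2 g))\<^sup>2 + c / 2 * (norm (to_l2 f2))\<^sup>2 \<le> Bd - X - I4"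
      using cr ce by (elim has_integral_le[rotated]) (auto intro!: add_mono mult_right_mono divide_right_mono)
    then have main: "X \<le> Bd - I4 - c / 2 * (norm (to_l2 g))\<^sup>2 - c / 2 * P\<^sup>2" by (simp add: P_def)
    \<comment> \<open>Young's inequality first isolates the squared slope; interpolation replaces it
      by curvature times deflection, and a second use of Young's inequality leaves only the
      deflection. The two applications spend \<open>c / 8\<close> and \<open>c / 16\<close> and
      produce \<open>K4\<close>.\<close>
    have b4: "- I4 \<le> c / 8 * P\<^sup>2 + c / 16 * P\<^sup>2 + K4 * Q\<^sup>2"
    proof -
      have "- I4 \<le> norm (mul (\<lambda>x. EI x * z2 x) (to_l2 f2)) * A"
        unfolding I4_def A_def using Cauchy_Schwarz_ineq2 by (metis abs_le_D2)
      also have "\<dots> \<le> (K * P) * A"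
        unfolding P_def A_def using K(1) by (intro mult_right_mono norm_mul_le crz) auto
      also have "\<dots> = P * (K * A)" by simp
      also have "\<dots> \<le> c / 8 * P\<^sup>2 + 1 / (4 * (c / 8)) * (K * A)\<^sup>2" using c by (intro young) simp
      also have "1 / (4 * (c / 8)) * (K * A)\<^sup>2 = 2 / c * K\<^sup>2 * A\<^sup>2" by (simp add: power_mult_distrib)
      also have "\<dots> \<le> 2 / c * K\<^sup>2 * (6 * (P * Q))"
        unfolding A_def P_def Q_def using c by (intro mult_left_mono derivative_interpolation d cn zero) auto
      also have "\<dots> = P * (12 * K\<^sup>2 / c * Q)" by simp
      also have "\<dots> \<le> c / 16 * P\<^sup>2 + 1 / (4 * (c / 16)) * (12 * K\<^sup>2 / c * Q)\<^sup>2" using c by (intro young) simp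
      also have "1 / (4 * (c / 16)) * (12 * K\<^sup>2 / c * Q)\<^sup>2 = K4 * Q\<^sup>2"
        unfolding K4_def power_mult_distrib[of "12 * K\<^sup>2 / c" Q] by simp
      finally show ?thesis by simp
    qed
    have F1: "norm (f1 1) \<le> P" unfolding P_def by (rule norm_endpoint_le(1)[OF d(2) cn(1) zero(2)])
    \<comment> \<open>The slope at the tip is bounded by the norm of the curvature. The lemma is
      used once for the shear and once for the moment, which accounts for the \<open>c / 16\<close>
      in the bound for \<open>Bd\<close>.\<close>
    have tip: "k * inner x (f1 1) \<le> c / 32 * P\<^sup>2 + 8 / c * k\<^sup>2 * (norm x)\<^sup>2" for k x
    proof -
      have "k * inner x (f1 1) \<le> \<bar>k\<bar> * (norm x * norm (f1 1))"
        using Cauchy_Schwarz_ineq2[of x "f1 1"]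
        by (metis abs_ge_self abs_ge_zero abs_mult mult_left_mono order_trans)
      also have "\<dots> \<le> \<bar>k\<bar> * (norm x * P)" using F1 by (intro mult_left_mono) auto
      also have "\<dots> = P * (\<bar>k\<bar> * norm x)" by simp
      also have "\<dots> \<le> c / 32 * P\<^sup>2 + 1 / (4 * (c / 32)) * (\<bar>k\<bar> * norm x)\<^sup>2" using c by (intro young) simp
      also have "1 / (4 * (c / 32)) * (\<bar>k\<bar> * norm x)\<^sup>2 = 8 / c * k\<^sup>2 * (norm x)\<^sup>2"
        by (simp add: power_mult_distrib)
      finally show ?thesis .
    qed
    define \<xi> \<eta> \<xi>' \<eta>' where "\<xi> = g 1" and "\<eta> = g1 1" and "\<xi>' = fst (snd (snd Y))" and "\<eta>' = snd (snd (snd Y))"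
    have tZ: "tips Z + tips Y = (norm \<xi>)\<^sup>2 + (norm \<eta>)\<^sup>2 + ((norm \<xi>')\<^sup>2 + (norm \<eta>')\<^sup>2)"
      by (simp add: tips_def Z \<xi>_def \<eta>_def \<xi>'_def \<eta>'_def)
    define tt where "tt = tips Z + tips Y"
    have tt: "(norm \<xi>)\<^sup>2 \<le> tt" "(norm \<eta>)\<^sup>2 \<le> tt" "(norm \<xi>')\<^sup>2 \<le> tt" "(norm \<eta>')\<^sup>2 \<le> tt" "tt \<ge> 0"
      unfolding tt_def tZ by simp_all
    have sq: "(norm (k *\<^sub>R x + l *\<^sub>R y))\<^sup>2 \<le> (2 * k\<^sup>2 + 2 * l\<^sup>2) * tt"
      if "(norm x)\<^sup>2 \<le> tt" "(norm y)\<^sup>2 \<le> tt" for k l and x y :: complex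
    proof -
      have "(norm (k *\<^sub>R x + l *\<^sub>R y))\<^sup>2 \<le> 2 * (norm (k *\<^sub>R x))\<^sup>2 + 2 * (norm (l *\<^sub>R y))\<^sup>2"
        using norm_add_sq_le[of 1 "k *\<^sub>R x" "l *\<^sub>R y"] by simp
      also have "\<dots> = 2 * k\<^sup>2 * (norm x)\<^sup>2 + 2 * l\<^sup>2 * (norm y)\<^sup>2" 
        unfolding norm_scaleR power_mult_distrib by simp
      also have "\<dots> \<le> 2 * k\<^sup>2 * tt + 2 * l\<^sup>2 * tt" using that by (intro add_mono mult_left_mono) auto
      finally show ?thesis by (simp add: algebra_simps)
    qed
    have M1: "(norm (M1 1))\<^sup>2 \<le> (2 * m\<^sup>2 + 2 * a\<^sup>2) * tt"
    proof -
      have "M1 1 = m *\<^sub>R \<xi>' + a *\<^sub>R \<xi>" using m_pos by (simp add: Y \<xi>'_def \<xi>_def del: complex_scaleR)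
      then show ?thesis using sq[OF tt(3) tt(1)] by simp
    qed
    have M: "(norm (EI 1 *\<^sub>R f2 1))\<^sup>2 \<le> (2 * J\<^sup>2 + 2 * b\<^sup>2) * tt"
    proof -
      have "EI 1 *\<^sub>R f2 1 = (- J) *\<^sub>R \<eta>' + (- b) *\<^sub>R \<eta>" using J_pos by (simp add: Y \<eta>'_def \<eta>_def del: complex_scaleR)
      then show ?thesis using sq[OF tt(4) tt(2), of "- J" "- b"] by simp
    qed
    have t1: "rho 1 * z 1 / 2 * (norm (g 1))\<^sup>2 \<le> K1 * tt"
      unfolding K1_def using tt(1) \<xi>_def by (intro mult_mono) auto
    have t2: "- (z 1) * inner (M1 1) (f1 1) \<le> c / 32 * P\<^sup>2 + K2 * ((2 * m\<^sup>2 + 2 * a\<^sup>2) * tt)"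
    proof -
      have "- (z 1) * inner (M1 1) (f1 1) \<le> c / 32 * P\<^sup>2 + K2 * (norm (M1 1))\<^sup>2"
        using tip[of "- z 1" "M1 1"] by (simp add: K2_def)
      then show ?thesis using mult_left_mono[OF M1 K0(2)] by linarith
    qed
    have t3: "z1 1 * inner (EI 1 *\<^sub>R f2 1) (f1 1) + z 1 * EI 1 / 2 * (norm (f2 1))\<^sup>2
        \<le> c / 32 * P\<^sup>2 + K3 * ((2 * J\<^sup>2 + 2 * b\<^sup>2) * tt)"
    proof -
      have "(norm (EI 1 *\<^sub>R f2 1))\<^sup>2 = (EI 1)\<^sup>2 * (norm (f2 1))\<^sup>2"
        unfolding norm_scaleR power_mult_distrib by simp
      then have "z 1 * EI 1 / 2 * (norm (f2 1))\<^sup>2 = z 1 / (2 * EI 1) * (norm (EI 1 *\<^sub>R f2 1))\<^sup>2"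
        using EI1 by (simp add: power2_eq_square)
      also have "\<dots> \<le> \<bar>z 1\<bar> / (2 * EI 1) * (norm (EI 1 *\<^sub>R f2 1))\<^sup>2"
        using EI1 by (intro mult_right_mono divide_right_mono) auto
      finally have "z1 1 * inner (EI 1 *\<^sub>R f2 1) (f1 1) + z 1 * EI 1 / 2 * (norm (f2 1))\<^sup>2
        \<le> c / 32 * P\<^sup>2 + K3 * (norm (EI 1 *\<^sub>R f2 1))\<^sup>2"
        using tip[of "z1 1" "EI 1 *\<^sub>R f2 1"] unfolding K3_def distrib_right by linarith
      then show ?thesis using mult_left_mono[OF M K0(3)] by linarith
    qed
    have "Bd \<le> c / 16 * P\<^sup>2 + (K1 * tt + K2 * ((2 * m\<^sup>2 + 2 * a\<^sup>2) * tt) + K3 * ((2 * J\<^sup>2 + 2 * b\<^sup>2) * tt))"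
      using t1 t2 t3 unfolding Bd_def by linarith
    also have "K1 * tt + K2 * ((2 * m\<^sup>2 + 2 * a\<^sup>2) * tt) + K3 * ((2 * J\<^sup>2 + 2 * b\<^sup>2) * tt) = (C - K4) * tt"
      by (simp add: C_def algebra_simps)
    also have "(C - K4) * tt \<le> C * tt" using K0 tt(5) by (intro mult_right_mono) auto
    finally have Bd: "Bd \<le> c / 16 * P\<^sup>2 + C * tt" by simp
    have "K4 * Q\<^sup>2 \<le> C * Q\<^sup>2" unfolding C_def using K0 by (intro mult_right_mono) auto
    moreover have "c / 4 * (norm (to_l2 g))\<^sup>2 \<ge> 0" using c by simp
    ultimately have "X \<le> - (c / 4 * P\<^sup>2) - c / 4 * (norm (to_l2 g))\<^sup>2 + C * tt + C * Q\<^sup>2"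
      using main b4 Bd by simp
    then show "G z Y Z + G z Z Y \<le> - (c / 4) * ((norm (fst Z))\<^sup>2 + (norm (fst (snd Z)))\<^sup>2) + C * (tips Z + tips Y)
        + C * (norm (fwd (fwd (fst Z))))\<^sup>2"
      unfolding Qeq X_def[symmetric] tt_def[symmetric] by (simp add: Z P_def algebra_simps)
  qed (use c cz C0 in auto)
qed


section \<open>The energy form and the multiplier form as bounded bilinear forms\<close>

lemma B_bilinear: "bounded_bilinear B"
proof -
  have 1: "bounded_bilinear (\<lambda>Z Y :: beam_state. inner (mul EI (fst Z)) (fst Y))"
    by (intro bounded_bilinear.comp[OF bounded_bilinear_inner] bounded_linear_fst
        bounded_linear_compose[OF bounded_linear_mul[OF EI_cont]])
  have 2: "bounded_bilinear (\<lambda>Z Y :: beam_state. inner (mul rho (fst (snd Z))) (fst (snd Y)))"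
    by (intro bounded_bilinear.comp[OF bounded_bilinear_inner] bounded_linear_compose[OF bounded_linear_fst bounded_linear_snd]
        bounded_linear_compose[OF bounded_linear_mul[OF rho_cont]])
  have 3: "bounded_bilinear (\<lambda>Z Y :: beam_state. inner (m *\<^sub>R fst (snd (snd Z))) (fst (snd (snd Y))))"
    by (intro bounded_bilinear.comp[OF bounded_bilinear_inner] bounded_linear_compose[OF bounded_linear_scaleR_right]
        bounded_linear_compose[OF bounded_linear_fst] bounded_linear_compose[OF bounded_linear_snd] bounded_linear_snd)
  have 4: "bounded_bilinear (\<lambda>Z Y :: beam_state. inner (J *\<^sub>R snd (snd (snd Z))) (snd (snd (snd Y))))"
    by (intro bounded_bilinear.comp[OF bounded_bilinear_inner] bounded_linear_compose[OF bounded_linear_scaleR_right]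
        bounded_linear_compose[OF bounded_linear_snd] bounded_linear_snd)
  have "B = (\<lambda>Z Y. inner (mul EI (fst Z)) (fst Y) + inner (mul rho (fst (snd Z))) (fst (snd Y))
      + inner (m *\<^sub>R fst (snd (snd Z))) (fst (snd (snd Y))) + inner (J *\<^sub>R snd (snd (snd Z))) (snd (snd (snd Y))))"
    by (intro ext) (simp add: B_def split: prod.splits del: complex_scaleR)
  then show ?thesis
    by (simp only:) (intro bounded_bilinear_add 1 2 3 4)
qed

lemma B_symmetric: "B Z Y = B Y Z"
proof -
  obtain p g \<xi> \<eta> where Z: "Z = (p, g, \<xi>, \<eta>)" by (cases Z)
  obtain p' g' \<xi>' \<eta>' where Y: "Y = (p', g', \<xi>', \<eta>')" by (cases Y)
  show ?thesis
    unfolding B_def Z Y using inner_mul_commute[OF EI_cont, of p p'] inner_mul_commute[OF rho_cont, of g g']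
    by (simp add: inner_commute[of \<xi>] inner_commute[of \<eta>])
qed

lemma B_bounds:
  obtains r H where "r > 0" "H > 0"
    "\<And>Z. r * ((norm (fst Z))\<^sup>2 + (norm (fst (snd Z)))\<^sup>2 + tips Z) \<le> B Z Z"
    "\<And>Z. B Z Z \<le> H * ((norm (fst Z))\<^sup>2 + (norm (fst (snd Z)))\<^sup>2 + tips Z)"
proof -
  obtain r0 H where r0: "r0 > 0" "\<And>x. x \<in> {0..1} \<Longrightarrow> r0 \<le> rho x \<and> r0 \<le> EI x"
    and H: "\<And>x. x \<in> {0..1} \<Longrightarrow> \<bar>rho x\<bar> \<le> H \<and> \<bar>EI x\<bar> \<le> H \<and> \<bar>rho' x\<bar> \<le> H \<and> \<bar>EI' x\<bar> \<le> H \<and> \<bar>1 / EI x\<bar> \<le> H"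
    using coefficient_bounds by metis
  have HH: "rho x \<le> H" "EI x \<le> H" if "x \<in> {0..1}" for x using H[OF that] by auto
  define r where "r = min r0 (min m J)"
  define H' where "H' = max H (max m J)"
  have r: "r > 0" "r \<le> r0" "r \<le> m" "r \<le> J" using r0(1) m_pos J_pos by (auto simp: r_def)
  have H': "H' > 0" "H \<le> H'" "m \<le> H'" "J \<le> H'" using m_pos by (auto simp: H'_def)
  have bE: "r \<le> EI x \<and> EI x \<le> H'" and bR: "r \<le> rho x \<and> rho x \<le> H'" if "x \<in> {0..1}" for x
    using HH[OF that] r0(2)[OF that] r(2) H'(2) by linarith+
  show ?thesis
  proof (rule that[OF r(1) H'(1)])
    fix Z :: beam_state
    obtain p g \<xi> \<eta> where Z: "Z = (p, g, \<xi>, \<eta>)" by (cases Z)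
    have BZ: "B Z Z = inner (mul EI p) p + inner (mul rho g) g + m * (norm \<xi>)\<^sup>2 + J * (norm \<eta>)\<^sup>2"
      by (simp add: B_def Z power2_norm_eq_inner)
    have "r * (norm p)\<^sup>2 \<le> inner (mul EI p) p" "r * (norm g)\<^sup>2 \<le> inner (mul rho g) g"
      by (rule mul_form_bounds(1)[OF EI_cont bE], assumption, rule mul_form_bounds(1)[OF rho_cont bR], assumption)
    moreover have "r * (norm \<xi>)\<^sup>2 \<le> m * (norm \<xi>)\<^sup>2" "r * (norm \<eta>)\<^sup>2 \<le> J * (norm \<eta>)\<^sup>2"
      using r by (auto intro!: mult_right_mono)
    ultimately show "r * ((norm (fst Z))\<^sup>2 + (norm (fst (snd Z)))\<^sup>2 + tips Z) \<le> B Z Z"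
      unfolding BZ by (simp add: Z tips_def distrib_left)
    have "inner (mul EI p) p \<le> H' * (norm p)\<^sup>2" "inner (mul rho g) g \<le> H' * (norm g)\<^sup>2"
      by (rule mul_form_bounds(2)[OF EI_cont bE], assumption, rule mul_form_bounds(2)[OF rho_cont bR], assumption)
    moreover have "m * (norm \<xi>)\<^sup>2 \<le> H' * (norm \<xi>)\<^sup>2" "J * (norm \<eta>)\<^sup>2 \<le> H' * (norm \<eta>)\<^sup>2"
      using H' by (auto intro!: mult_right_mono)
    ultimately show "B Z Z \<le> H' * ((norm (fst Z))\<^sup>2 + (norm (fst (snd Z)))\<^sup>2 + tips Z)"
      unfolding BZ by (simp add: Z tips_def distrib_left)
  qed
qed

lemma B_self_nonneg: "B Z Z \<ge> 0"
proof -
  obtain r H where "r > 0" "\<And>Z. r * ((norm (fst Z))\<^sup>2 + (norm (fst (snd Z)))\<^sup>2 + tips Z) \<le> B Z Z"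
    using B_bounds by metis
  moreover have "(norm (fst Z))\<^sup>2 + (norm (fst (snd Z)))\<^sup>2 + tips Z \<ge> 0"
    using tips_nonneg[of Z] by simp
  ultimately show ?thesis by (meson less_imp_le mult_nonneg_nonneg order_trans)
qed

lemma G_bilinear: "continuous_on {0..1} z \<Longrightarrow> bounded_bilinear (G z)"
  unfolding G_def[abs_def]
  by (intro bounded_bilinear.comp[OF bounded_bilinear_inner] bounded_linear_compose[OF bounded_linear_mul]
      bounded_linear_compose[OF bounded_linear_fst] bounded_linear_snd bounded_linear_fst
      bounded_linear_compose[OF bounded_linear_fwd] continuous_intros rho_cont)

end

section \<open>Integrability of the energy\<close>

lemma fact_add_ge: "(fact n :: real) * real n ^ k \<le> fact (n + k)"
proof (induction k)
  case (Suc k)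
  have "fact n * real n ^ Suc k = (fact n * real n ^ k) * real n" by simp
  also have "\<dots> \<le> fact (n + k) * real (Suc (n + k))"
    using Suc by (intro mult_mono) auto
  also have "\<dots> = fact (n + Suc k)" by (simp add: mult.commute)
  finally show ?case .
qed simp

text \<open>The factorial decay of iterated Volterra operators beats the growth \<^term>\<open>(4 * k / \<sigma>) ^ (2 * k)\<close> of the \<^term>\<open>2 * k\<close>-fold
  difference quotients with step \<^term>\<open>\<sigma> / (2 * k)\<close>.\<close>

lemma volterra_beats_quotients:
  fixes H \<sigma> e :: real
  assumes "H \<ge> 0" "\<sigma> > 0" "e > 0"
  obtains j where "((H\<^sup>2) ^ Suc j / fact (4 * j + 3))\<^sup>2 * (2 / (\<sigma> / real (2 * Suc j))) ^ (4 * Suc j) < e"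
proof -
  define X where "X = H\<^sup>2 * (4 / \<sigma>\<^sup>2)"
  have X0: "X \<ge> 0" unfolding X_def by simp
  define q where "q j = (H\<^sup>2) ^ Suc j / fact (4 * j + 3) * (2 / (\<sigma> / real (2 * Suc j))) ^ (2 * Suc j)" for j
  \<comment> \<open>Comparison with an exponential series: \<open>fact (4 * k)\<close> is at least
    \<open>fact (2 * k) * (2 * k) ^ (2 * k)\<close>. The power absorbs the growth of the quotients,
    and the other factor still leaves \<open>fact k\<close> against the geometric
    \<open>X ^ k\<close>. The index \<open>4 * j + 3\<close> is \<open>4 * k - 1\<close>, whence the
    extra factor \<open>4 * k\<close>.\<close>
  have le: "q j \<le> 4 * (inverse (fact (Suc j)) * X ^ Suc j)" for j
  proof -
    define k where "k = Suc j"
    have k: "k \<ge> 1" by (simp add: k_def)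
    have f1: "fact (2 * k) * real (2 * k) ^ (2 * k) \<le> real (4 * k) * fact (4 * j + 3)"
    proof -
      have "fact (2 * k) * real (2 * k) ^ (2 * k) \<le> fact (2 * k + 2 * k)" by (rule fact_add_ge)
      also have "2 * k + 2 * k = Suc (4 * j + 3)" by (simp add: k_def)
      also have "fact (Suc (4 * j + 3)) = real (4 * k) * fact (4 * j + 3)"
        unfolding fact_Suc by (simp add: k_def)
      finally show ?thesis .
    qed
    have f2: "real k * fact k \<le> fact (2 * k)"
    proof -
      have "fact k * real k ^ 1 \<le> fact k * real k ^ k"
        using k by (intro mult_left_mono power_increasing) auto
      also have "\<dots> \<le> fact (k + k)" by (rule fact_add_ge)
      finally show ?thesis unfolding mult_2[of k] by (simp add: mult.commute)
    qed
    have pk: "real (2 * k) ^ (2 * k) > 0" using k by simp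
    have "real k * fact k * real (2 * k) ^ (2 * k) \<le> fact (2 * k) * real (2 * k) ^ (2 * k)"
      using f2 pk by (intro mult_right_mono) auto
    also note f1
    finally have "real k * (fact k * real (2 * k) ^ (2 * k)) \<le> real k * (4 * fact (4 * j + 3))" by simp
    then have f3: "fact k * real (2 * k) ^ (2 * k) \<le> 4 * fact (4 * j + 3)" using k by simp
    have "(2 / (\<sigma> / real (2 * k))) ^ (2 * k) = (4 / \<sigma>\<^sup>2) ^ k * real (2 * k) ^ (2 * k)"
    proof -
      have "2 / (\<sigma> / real (2 * k)) = (2 / \<sigma>) * real (2 * k)" by simp
      then have "(2 / (\<sigma> / real (2 * k))) ^ (2 * k) = (2 / \<sigma>) ^ (2 * k) * real (2 * k) ^ (2 * k)"
        by (simp only: power_mult_distrib)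
      also have "(2 / \<sigma>) ^ (2 * k) = (4 / \<sigma>\<^sup>2) ^ k" by (simp add: power_mult power_divide)
      finally show ?thesis .
    qed
    moreover have "x / F * (y * R) = x * y * (R / F)" for x y F R :: real by simp
    ultimately have "q j = X ^ k * (real (2 * k) ^ (2 * k) / fact (4 * j + 3))"
      unfolding q_def k_def[symmetric] by (simp only: X_def power_mult_distrib)
    also have "\<dots> \<le> X ^ k * (4 / fact k)"
      using f3 X0 by (intro mult_left_mono) (auto simp: field_simps)
    finally show ?thesis by (simp add: k_def divide_inverse mult.commute mult.left_commute)
  qed
  have "(\<lambda>n. inverse (fact n) * X ^ n) \<longlonglongrightarrow> 0" by (rule summable_LIMSEQ_zero[OF summable_exp])
  then have "(\<lambda>j. 4 * (inverse (fact (Suc j)) * X ^ Suc j)) \<longlonglongrightarrow> 4 * 0"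
    by (intro tendsto_mult_left LIMSEQ_Suc)
  then have "\<forall>\<^sub>F j in sequentially. 4 * (inverse (fact (Suc j)) * X ^ Suc j) < sqrt e"
    by (rule order_tendstoD(2)) (use assms(3) in simp)
  then obtain j where j: "4 * (inverse (fact (Suc j)) * X ^ Suc j) < sqrt e"
    by (auto simp: eventually_sequentially)
  have q0: "q j \<ge> 0" unfolding q_def using assms by simp
  have "(q j)\<^sup>2 < (sqrt e)\<^sup>2" using le[of j] j q0 by (intro power_strict_mono) auto
  also have "(sqrt e)\<^sup>2 = e" using assms by simp
  finally have "(q j)\<^sup>2 < e" .
  moreover have "(q j)\<^sup>2 = ((H\<^sup>2) ^ Suc j / fact (4 * j + 3))\<^sup>2 * (2 / (\<sigma> / real (2 * Suc j))) ^ (4 * Suc j)"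
  proof -
    have "4 * Suc j = (2 * Suc j) * 2" by simp
    then show ?thesis unfolding q_def by (simp only: power_mult_distrib power_mult)
  qed
  ultimately show ?thesis using that by simp
qed

lemma norm_bwd_le: "norm (bwd u) \<le> norm u"
proof -
  have "tip_bounded 0 (norm u) (bwd u)" by (rule tip_bounded_bwd_0)
  from tip_bounded_norm[OF this] show ?thesis by simp
qed

lemma norm_cst_le: "norm (cst c) \<le> norm c"
  by (simp add: cst_def norm_to_l2_le L2_const)

lemma norm_sq_diff_le:
  fixes x y :: "'a::real_normed_vector"
  shows "(norm (x - y))\<^sup>2 \<le> 2 * (norm x)\<^sup>2 + 2 * (norm y)\<^sup>2"
  using norm_add_sq_le[of 1 x "- y"] by simp

lemma norm_sq_combination_le:
  fixes x y :: "'a::real_normed_vector"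
  shows "(norm (k *\<^sub>R x + l *\<^sub>R y))\<^sup>2 \<le> 2 * k\<^sup>2 * (norm x)\<^sup>2 + 2 * l\<^sup>2 * (norm y)\<^sup>2"
proof -
  have "(norm (k *\<^sub>R x + l *\<^sub>R y))\<^sup>2 \<le> 2 * (norm (k *\<^sub>R x))\<^sup>2 + 2 * (norm (l *\<^sub>R y))\<^sup>2"
    using norm_add_sq_le[of 1 "k *\<^sub>R x" "l *\<^sub>R y"] by simp
  then show ?thesis unfolding norm_scaleR power_mult_distrib by simp
qed

lemma tavg_iterate_linear:
  assumes L: "bounded_linear L" and u: "continuous_on {0..} u" and t: "0 \<le> t" and \<tau>: "\<tau> > 0"
  shows "(tavg \<tau> ^^ n) (\<lambda>s. L (u s)) t = L ((tavg \<tau> ^^ n) u t)"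
  using t
proof (induction n arbitrary: t)
  case (Suc n)
  have "(tavg \<tau> ^^ Suc n) (\<lambda>s. L (u s)) t = tavg \<tau> ((tavg \<tau> ^^ n) (\<lambda>s. L (u s))) t" by simp
  also have "\<dots> = tavg \<tau> (\<lambda>s. L ((tavg \<tau> ^^ n) u s)) t"
    by (rule tavg_cong[OF \<tau>]) (use Suc in auto)
  also have "\<dots> = L (tavg \<tau> ((tavg \<tau> ^^ n) u) t)"
    by (intro tavg_linear \<tau> L continuous_tavg_iterate u Suc.prems)
  finally show ?case by simp
qed simp

text \<open>The only link between the abstract semigroup and the beam. Two steps of the generator
  are required because \<open>y\<close> must lie in the domain itself for its second component, the
  acceleration, to be continuous.\<close>

locale beam_semigroup = beam + c0_semigroup S for S :: "real \<Rightarrow> beam_state \<Rightarrow> beam_state" +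
  assumes generates_classical: "\<And>h y w. generates h y \<Longrightarrow> generates y w \<Longrightarrow> classical h y"
begin

sublocale dissipative_semigroup S B D
proof (intro dissipative_semigroup.intro c0_semigroup_axioms dissipative_semigroup_axioms.intro)
  show "bounded_bilinear B" by (rule B_bilinear)
  fix h y w
  show "B h y = B y h" by (rule B_symmetric)
  show "B h h \<ge> 0" by (rule B_self_nonneg)
  show "D h \<ge> 0" using a_pos b_pos by (auto simp: D_def split: prod.splits)
  show "generates h y \<Longrightarrow> generates y w \<Longrightarrow> 2 * B h y = - D h"
    by (rule classical_dissipation[OF generates_classical])
qed

text \<open>The energy dissipated up to \<open>T\<close> never exceeds the initial energy, and
  positive damping in both tip variables makes the dissipation control the tip data.\<close>

lemma integral_tips_le:
  assumes "generates h y" "generates y w" "T \<ge> 0"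
  shows "integral {0..T} (\<lambda>t. tips (S t h)) \<le> B h h / (2 * min a b)"
proof -
  have "integral {0..T} (\<lambda>t. 2 * min a b * tips (S t h)) \<le> B (S 0 h) (S 0 h) - B (S T h) (S T h)"
  proof (rule has_integral_le[OF integrable_integral energy_balance[OF assms(1,2) order_refl assms(3)]])
    show "(\<lambda>t. 2 * min a b * tips (S t h)) integrable_on {0..T}"
      unfolding tips_def
      by (intro integrable_continuous_real continuous_intros continuous_orbit_Icc order_refl)
    fix t
    have "min a b * x\<^sup>2 \<le> a * x\<^sup>2" "min a b * x\<^sup>2 \<le> b * x\<^sup>2" for x :: real
      by (intro mult_right_mono; simp)+
    then show "2 * min a b * tips (S t h) \<le> D (S t h)"
      unfolding tips_def D_def by (simp add: distrib_left add_mono split: prod.splits)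
  qed
  then have "2 * min a b * integral {0..T} (\<lambda>t. tips (S t h)) \<le> B h h"
    using B_self_nonneg[of "S T h"] by simp
  then show ?thesis using a_pos b_pos by (simp add: field_simps)
qed

text \<open>The moment is taken as unknown instead of the curvature, so that both couplings are
  double backward integrals of a weighted time derivative. The second claim rests on the
  representation of the velocity from the clamped end: it says that the deflection has the velocity
  as its time derivative.\<close>

lemma orbit_coupled:
  assumes hy: "generates h y" "generates y w"
  shows "coupled (\<lambda>u. bwd (bwd (mul rho u))) (\<lambda>u. bwd (bwd (mul (\<lambda>x. 1 / EI x) u)))
    (\<lambda>t. mul EI (fst (S t h))) (\<lambda>t. mul EI (fst (S t y))) (\<lambda>t. fst (snd (S t h))) (\<lambda>t. fst (snd (S t y)))
    (\<lambda>t. cst (- (J *\<^sub>R snd (snd (snd (S t y))) + b *\<^sub>R snd (snd (snd (S t h)))))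
      - bwd (cst (m *\<^sub>R fst (snd (snd (S t y))) + a *\<^sub>R fst (snd (snd (S t h))))))
    (\<lambda>t. cst (fst (snd (snd (S t h)))) - bwd (cst (snd (snd (snd (S t h))))))"
    (is "coupled _ _ _ _ _ _ ?p ?q")
    and "\<And>t. t \<ge> 0 \<Longrightarrow> ((\<lambda>t. fwd (fwd (fst (S t h)))) has_vector_derivative fst (snd (S t h))) (at t within {0..})"
proof -
  have dS: "((\<lambda>t. S t h) has_vector_derivative S t y) (at t within {0..})" if "t \<ge> 0" for t
    by (rule orbit_has_vector_derivative[OF hy(1) that])
  have cl: "classical (S t h) (S t y)" if "t \<ge> 0" for t
    using generates_classical generates_orbit[OF hy(1) that] generates_orbit[OF hy(2) that] by blast
  have lin1: "bounded_linear (\<lambda>Z :: beam_state. mul EI (fst Z))"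
    by (intro bounded_linear_compose[OF bounded_linear_mul] EI_cont bounded_linear_fst)
  have lin2: "bounded_linear (\<lambda>Z :: beam_state. fst (snd Z))"
    by (intro bounded_linear_compose[OF bounded_linear_fst] bounded_linear_snd)
  have lin3: "bounded_linear (\<lambda>Z :: beam_state. fwd (fwd (fst Z)))"
    by (intro bounded_linear_compose[OF bounded_linear_fwd] bounded_linear_fst)
  note cS = continuous_orbit[of h] continuous_orbit[of y]
  have cp: "continuous_on {0..} ?p"
    by (intro continuous_intros cS bounded_linear.continuous_on[OF bounded_linear_bwd]
        bounded_linear.continuous_on[OF bounded_linear_cst])
  have cq: "continuous_on {0..} ?q"
    by (intro continuous_intros cS bounded_linear.continuous_on[OF bounded_linear_bwd]
        bounded_linear.continuous_on[OF bounded_linear_cst])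
  have sys: "mul EI (fst (S t h)) = ?p t - bwd (bwd (mul rho (fst (snd (S t y)))))"
    "fst (snd (S t h)) = ?q t + bwd (bwd (mul (\<lambda>x. 1 / EI x) (mul EI (fst (S t y)))))"
    "fst (snd (S t h)) = fwd (fwd (fst (S t y)))" if "t \<ge> 0" for t
  proof -
    have "classical (fst (S t h), fst (snd (S t h)), fst (snd (snd (S t h))), snd (snd (snd (S t h))))
      (fst (S t y), fst (snd (S t y)), fst (snd (snd (S t y))), snd (snd (snd (S t y))))"
      using cl[OF that] by (simp only: prod.collapse)
    note cc = classical_coupled[OF this]
    show "mul EI (fst (S t h)) = ?p t - bwd (bwd (mul rho (fst (snd (S t y)))))" by (rule cc(1))
    show "fst (snd (S t h)) = ?q t + bwd (bwd (mul (\<lambda>x. 1 / EI x) (mul EI (fst (S t y)))))" by (rule cc(2))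
    show "fst (snd (S t h)) = fwd (fwd (fst (S t y)))" by (rule cc(3))
  qed
  show "coupled (\<lambda>u. bwd (bwd (mul rho u))) (\<lambda>u. bwd (bwd (mul (\<lambda>x. 1 / EI x) u)))
    (\<lambda>t. mul EI (fst (S t h))) (\<lambda>t. mul EI (fst (S t y))) (\<lambda>t. fst (snd (S t h))) (\<lambda>t. fst (snd (S t y))) ?p ?q"
    unfolding coupled_def
    using bounded_linear.has_vector_derivative[OF lin1 dS] bounded_linear.has_vector_derivative[OF lin2 dS]
      bounded_linear.continuous_on[OF lin1 cS(2)] bounded_linear.continuous_on[OF lin2 cS(2)] cp cq sys(1,2)
    by blast
  show "((\<lambda>t. fwd (fwd (fst (S t h)))) has_vector_derivative fst (snd (S t h))) (at t within {0..})" if "t \<ge> 0" for t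
    unfolding sys(3)[OF that] by (rule bounded_linear.has_vector_derivative[OF lin3 dS[OF that]])
qed

lemma mul_inverse_EI: "mul (\<lambda>x. 1 / EI x) (mul EI p) = p"
proof -
  have ci: "continuous_on {0..1} (\<lambda>x. 1 / EI x)"
    using EI_pos by (intro continuous_intros EI_cont) (auto simp: less_imp_neq[symmetric])
  obtain f where f: "L2 f" "p = to_l2 f" by (rule l2_cases)
  have "mul (\<lambda>x. 1 / EI x) (mul EI p) = to_l2 (\<lambda>x. (1 / EI x) *\<^sub>R EI x *\<^sub>R f x)"
    by (simp add: f mul_to_l2 EI_cont ci L2_mult_continuous del: complex_scaleR scaleR_scaleR)
  also have "\<dots> = to_l2 f"
    by (rule to_l2_cong(1)[symmetric, OF f(1)]) (use EI_pos in \<open>force simp: less_imp_neq[symmetric]\<close>)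
  finally show ?thesis by (simp add: f)
qed

text \<open>Splitting the deflection into its time average, which is controlled by the tip data, and the
  remainder, which is small compared with the velocity, absorbs the lower-order term of the multiplier estimate.\<close>

theorem integral_energy_bound:
  obtains C where "C \<ge> 0" "\<And>h y w x T. generates h y \<Longrightarrow> generates y w \<Longrightarrow> generates w x \<Longrightarrow> T \<ge> 0 \<Longrightarrow>
    integral {0..T} (\<lambda>t. B (S t h) (S t h)) \<le> C * (B h h + B y y)"
proof -
  obtain r H where r: "r > 0" and H: "H > 0"
    and Br: "\<And>Z. r * ((norm (fst Z))\<^sup>2 + (norm (fst (snd Z)))\<^sup>2 + tips Z) \<le> B Z Z"
    and BH: "\<And>Z. B Z Z \<le> H * ((norm (fst Z))\<^sup>2 + (norm (fst (snd Z)))\<^sup>2 + tips Z)"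
    using B_bounds by metis
  obtain r0 H1 where H1: "\<And>x. x \<in> {0..1} \<Longrightarrow> \<bar>rho x\<bar> \<le> H1 \<and> \<bar>EI x\<bar> \<le> H1 \<and> \<bar>rho' x\<bar> \<le> H1 \<and> \<bar>EI' x\<bar> \<le> H1 \<and> \<bar>1 / EI x\<bar> \<le> H1"
    using coefficient_bounds by metis
  have H10: "H1 \<ge> 0" using H1[of 0] by auto
  obtain z c C where cz: "continuous_on {0..1} z" and c: "c > 0" and C: "C \<ge> 0"
    and est: "\<And>Z Y. classical Z Y \<Longrightarrow> G z Y Z + G z Z Y
      \<le> - c * ((norm (fst Z))\<^sup>2 + (norm (fst (snd Z)))\<^sup>2) + C * (tips Z + tips Y)
        + C * (norm (fwd (fwd (fst Z))))\<^sup>2"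
    using multiplier_estimate by metis
  have ci: "continuous_on {0..1} (\<lambda>x. 1 / EI x)"
    using EI_pos by (intro continuous_intros EI_cont) (auto simp: less_imp_neq[symmetric])
  define Lf where "Lf = (\<lambda>u. fwd (fwd (mul (\<lambda>x. 1 / EI x) u)))"
  have Lf: "bounded_linear Lf"
    unfolding Lf_def by (intro bounded_linear_compose[OF bounded_linear_fwd] bounded_linear_mul ci)
  obtain F where F: "\<And>u. norm (Lf u) \<le> F * norm u"
    using bounded_linear.bounded[OF Lf] by (metis mult.commute)
  obtain KG where KG: "\<And>Z Y. norm (G z Z Y) \<le> norm Z * norm Y * KG" "KG \<ge> 0"
    using bounded_bilinear.nonneg_bounded[OF G_bilinear[OF cz]] by metis
  \<comment> \<open>Total averaging time, determined by the multiplier constants alone: the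
    remainder of the averages, with the factor 2 from the squared triangle inequality, uses at most
    \<open>c / 4\<close>.\<close>
  define \<sigma> where "\<sigma> = sqrt (c / (8 * (C + 1)))"
  have \<sigma>: "\<sigma> > 0" "\<sigma>\<^sup>2 = c / (8 * (C + 1))" using c C by (auto simp: \<sigma>_def)
  have \<sigma>C: "C * (2 * \<sigma>\<^sup>2) \<le> c / 4"
    unfolding \<sigma>(2) using c C by (simp add: field_simps)
  \<comment> \<open>Tolerance for the quotient term, which may use another \<open>c / 4\<close>. The
    factor \<open>F\<close> leads from moment to deflection and \<open>H1\<close> from curvature to
    moment; the summand 1 keeps the denominator positive.\<close>
  define e where "e = c / (16 * (C * F\<^sup>2 * H1\<^sup>2 + 1))"
  have e: "e > 0" unfolding e_def using c C by (intro divide_pos_pos) (auto intro!: add_nonneg_pos)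
  obtain j where j: "((H1\<^sup>2) ^ Suc j / fact (4 * j + 3))\<^sup>2 * (2 / (\<sigma> / real (2 * Suc j))) ^ (4 * Suc j) < e"
    using volterra_beats_quotients[OF H10 \<sigma>(1) e] by metis
  define k where "k = Suc j"
  \<comment> \<open>The \<open>2 * k\<close> windows add up to the fixed length
    \<open>\<sigma>\<close>.\<close>
  define \<tau> where "\<tau> = \<sigma> / real (2 * k)"
  have \<tau>: "\<tau> > 0" "real (2 * k) * \<tau> = \<sigma>" using \<sigma>(1) by (auto simp: \<tau>_def k_def)
  define q where "q = ((H1\<^sup>2) ^ k / fact (4 * j + 3))\<^sup>2 * (2 / \<tau>) ^ (4 * k)"
  have "q < e" using j by (simp only: q_def k_def \<tau>_def)
  moreover have "q \<ge> 0" unfolding q_def using \<tau>(1) by (intro mult_nonneg_nonneg zero_le_power) auto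
  ultimately have q: "q \<le> e" "q \<ge> 0" by auto
  have eC: "C * (2 * F\<^sup>2 * (2 * q * H1\<^sup>2)) \<le> c / 4"
  proof -
    have "C * (2 * F\<^sup>2 * (2 * q * H1\<^sup>2)) = 4 * (C * F\<^sup>2 * H1\<^sup>2) * q" by simp
    also have "\<dots> \<le> 4 * (C * F\<^sup>2 * H1\<^sup>2) * e" using C q by (intro mult_left_mono) auto
    also have "\<dots> \<le> 4 * (C * F\<^sup>2 * H1\<^sup>2 + 1) * e" using e by (intro mult_right_mono) auto
    also have "\<dots> = c / 4"
    proof -
      have "C * F\<^sup>2 * H1\<^sup>2 + 1 > 0" using C by (intro add_nonneg_pos) auto
      moreover have "4 * x * (c / (16 * x)) = c / 4" if "x > 0" for x using that by simp
      ultimately show ?thesis unfolding e_def by blast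
    qed
    finally show ?thesis .
  qed
  define A1 where "A1 = (\<lambda>u. bwd (bwd (mul rho u)))"
  define A2 where "A2 = (\<lambda>u. bwd (bwd (mul (\<lambda>x. 1 / EI x) u)))"
  have A: "bounded_linear A1" "bounded_linear A2"
    unfolding A1_def A2_def by (intro bounded_linear_compose[OF bounded_linear_bwd] bounded_linear_mul rho_cont ci)+
  have \<kappa>: "norm (((\<lambda>x. - A1 (A2 x)) ^^ k) x) \<le> (H1\<^sup>2) ^ k / fact (4 * j + 3) * norm x" for x
    unfolding A1_def A2_def k_def using H1 by (intro volterra_iterate_bound rho_cont ci) auto
  obtain CL where CL: "CL \<ge> 0" "\<And>u u' v v' p s T. coupled A1 A2 u u' v v' p s \<Longrightarrow> T \<ge> 0 \<Longrightarrow>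
      energy T ((tavg \<tau> ^^ (2 * k)) u) \<le> CL * (energy (T + \<sigma>) p + energy (T + \<sigma>) s) + 2 * q * energy (T + \<sigma>) u"
    using low_frequency_bound[OF \<tau>(1) A \<kappa>] unfolding \<tau>(2) q_def by metis
  define mn where "mn = 2 * min a b"
  have mn: "mn > 0" using a_pos b_pos by (simp add: mn_def)
  define Kp where "Kp = 4 * (J\<^sup>2 + b\<^sup>2 + m\<^sup>2 + a\<^sup>2)"
  have Kp: "Kp \<ge> 0" by (simp add: Kp_def)
  \<comment> \<open>The three summands bound the multiplier functional at times 0 and
    \<open>T\<close>, the tip data in the multiplier estimate, and the tip data in the averaged
    moment. \<open>K2\<close> arises by solving for the time integral after absorption.\<close>
  define K1 where "K1 = 2 * KG / r + C / mn + C * (2 * F\<^sup>2 * (CL * ((Kp + 2) / mn)))"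
  have K10: "K1 \<ge> 0" unfolding K1_def using KG(2) r C CL(1) Kp mn by (intro add_nonneg_nonneg) auto
  define K2 where "K2 = 2 / c * (K1 + c / 2 * (\<sigma> / r))"
  have K20: "K2 \<ge> 0" unfolding K2_def using K10 c \<sigma>(1) r by simp
  show ?thesis
  proof (rule that[of "H * (K2 + 1 / mn)"])
    show "H * (K2 + 1 / mn) \<ge> 0" using H K20 mn by simp
    fix h y w x and T :: real
    assume hy: "generates h y" and yw: "generates y w" and wx: "generates w x" and T: "T \<ge> 0"
    define E0 where "E0 = B h h + B y y"
    have E0: "B h h \<le> E0" "E0 \<ge> 0" using B_self_nonneg[of h] B_self_nonneg[of y] by (auto simp: E0_def)
    have T\<sigma>: "T + \<sigma> \<ge> 0" using T \<sigma> by simp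
    define p where "p t = fst (S t h)" for t
    define u where "u t = fst (snd (S t h))" for t
    define f where "f t = fwd (fwd (p t))" for t
    define M where "M t = mul EI (p t)" for t
    define pd where "pd t = cst (- (J *\<^sub>R snd (snd (snd (S t y))) + b *\<^sub>R snd (snd (snd (S t h)))))
      - bwd (cst (m *\<^sub>R fst (snd (snd (S t y))) + a *\<^sub>R fst (snd (snd (S t h)))))" for t
    define qd where "qd t = cst (fst (snd (snd (S t h)))) - bwd (cst (snd (snd (snd (S t h)))))" for t
    have coup: "coupled A1 A2 M (\<lambda>t. mul EI (fst (S t y))) u (\<lambda>t. fst (snd (S t y))) pd qd"
      using orbit_coupled(1)[OF hy yw] unfolding A1_def A2_def M_def p_def u_def pd_def qd_def .
    have fd: "(f has_vector_derivative u t) (at t within {0..})" if "t \<ge> 0" for t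
      using orbit_coupled(2)[OF hy yw that] unfolding f_def p_def u_def .
    have cS: "continuous_on {0..} (\<lambda>t. S t h)" "continuous_on {0..} (\<lambda>t. S t y)" by (rule continuous_orbit)+
    have cp: "continuous_on {0..} p" and cu: "continuous_on {0..} u"
      unfolding p_def u_def by (intro continuous_intros cS)+
    have cM: "continuous_on {0..} M" by (rule continuous_on_halfline[OF coupledD(1)[OF coup]])
    have cf: "continuous_on {0..} f" by (rule continuous_on_halfline[OF fd])
    note cpd = coupledD(5)[OF coup] and cqd = coupledD(6)[OF coup]
    define tt where "tt t = tips (S t h) + tips (S t y)" for t
    have ct: "continuous_on {0..} (\<lambda>t. tips (S t h))" "continuous_on {0..} (\<lambda>t. tips (S t y))"
      unfolding tips_def by (intro continuous_intros cS)+
    have ctt: "continuous_on {0..} tt" unfolding tt_def by (intro continuous_intros ct)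
    have itt: "integral {0..T'} tt \<le> E0 / mn" if "T' \<ge> 0" for T'
    proof -
      have "integral {0..T'} tt = integral {0..T'} (\<lambda>t. tips (S t h)) + integral {0..T'} (\<lambda>t. tips (S t y))"
        unfolding tt_def by (intro Henstock_Kurzweil_Integration.integral_add integrable_Icc ct) auto
      also have "\<dots> \<le> B h h / mn + B y y / mn"
        unfolding mn_def by (intro add_mono integral_tips_le[OF hy yw] integral_tips_le[OF yw wx] that)
      finally show ?thesis by (simp add: E0_def add_divide_distrib)
    qed
    have energy_tt: "energy T' v \<le> K * (E0 / mn)"
      if v: "continuous_on {0..} v" "\<And>t. t \<ge> 0 \<Longrightarrow> (norm (v t))\<^sup>2 \<le> K * tt t" and "K \<ge> 0" "T' \<ge> 0" for v :: "real \<Rightarrow> l2" and K T'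
    proof -
      have "energy T' v \<le> integral {0..T'} (\<lambda>t. K * tt t)"
        unfolding energy_def using v by (intro integral_le integrable_norm_sq integrable_on_mult_right integrable_Icc ctt) auto
      also have "\<dots> \<le> K * (E0 / mn)" using mult_left_mono[OF itt[OF that(4)] that(3)] by simp
      finally show ?thesis .
    qed
    have pd_le: "energy (T + \<sigma>) pd \<le> Kp * (E0 / mn)"
    proof (rule energy_tt[OF cpd _ Kp T\<sigma>])
      fix t :: real
      define \<xi> \<eta> \<xi>' \<eta>' where "\<xi> = fst (snd (snd (S t h)))" and "\<eta> = snd (snd (snd (S t h)))"
        and "\<xi>' = fst (snd (snd (S t y)))" and "\<eta>' = snd (snd (snd (S t y)))"
      have le: "(norm \<xi>)\<^sup>2 \<le> tt t" "(norm \<eta>)\<^sup>2 \<le> tt t" "(norm \<xi>')\<^sup>2 \<le> tt t" "(norm \<eta>')\<^sup>2 \<le> tt t"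
        by (simp_all add: tt_def tips_def \<xi>_def \<eta>_def \<xi>'_def \<eta>'_def)
      have "(norm (pd t))\<^sup>2 \<le> 2 * (norm (cst (- (J *\<^sub>R \<eta>' + b *\<^sub>R \<eta>))))\<^sup>2 + 2 * (norm (bwd (cst (m *\<^sub>R \<xi>' + a *\<^sub>R \<xi>))))\<^sup>2"
        unfolding pd_def \<xi>_def \<eta>_def \<xi>'_def \<eta>'_def by (rule norm_sq_diff_le)
      also have "\<dots> \<le> 2 * (norm (- (J *\<^sub>R \<eta>' + b *\<^sub>R \<eta>)))\<^sup>2 + 2 * (norm (m *\<^sub>R \<xi>' + a *\<^sub>R \<xi>))\<^sup>2"
        by (intro add_mono mult_left_mono power_mono norm_cst_le order_trans[OF norm_bwd_le norm_cst_le]) auto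
      also have "\<dots> \<le> 2 * (2 * J\<^sup>2 * (norm \<eta>')\<^sup>2 + 2 * b\<^sup>2 * (norm \<eta>)\<^sup>2) + 2 * (2 * m\<^sup>2 * (norm \<xi>')\<^sup>2 + 2 * a\<^sup>2 * (norm \<xi>)\<^sup>2)"
        unfolding norm_minus_cancel by (intro add_mono mult_left_mono norm_sq_combination_le) auto
      also have "\<dots> \<le> 2 * (2 * J\<^sup>2 * tt t + 2 * b\<^sup>2 * tt t) + 2 * (2 * m\<^sup>2 * tt t + 2 * a\<^sup>2 * tt t)"
        using le by (intro add_mono mult_left_mono) auto
      also have "\<dots> = Kp * tt t" by (simp add: Kp_def algebra_simps)
      finally show "(norm (pd t))\<^sup>2 \<le> Kp * tt t" .
    qed
    have qd_le: "energy (T + \<sigma>) qd \<le> 2 * (E0 / mn)"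
    proof (rule energy_tt[OF cqd _ _ T\<sigma>])
      fix t :: real
      have "(norm (qd t))\<^sup>2 \<le> 2 * (norm (cst (fst (snd (snd (S t h))))))\<^sup>2 + 2 * (norm (bwd (cst (snd (snd (snd (S t h)))))))\<^sup>2"
        unfolding qd_def by (rule norm_sq_diff_le)
      also have "\<dots> \<le> 2 * (norm (fst (snd (snd (S t h)))))\<^sup>2 + 2 * (norm (snd (snd (snd (S t h)))))\<^sup>2"
        by (intro add_mono mult_left_mono power_mono norm_cst_le order_trans[OF norm_bwd_le norm_cst_le]) auto
      also have "\<dots> \<le> 2 * tt t" using tips_nonneg[of "S t y"] by (simp add: tt_def tips_def)
      finally show "(norm (qd t))\<^sup>2 \<le> 2 * tt t" .
    qed simp
    define et where "et T' = energy T' p + energy T' u" for T'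
    have deflection: "energy T f \<le> 2 * (\<sigma>\<^sup>2 * et (T + \<sigma>))
        + 2 * (F\<^sup>2 * (CL * ((Kp + 2) / mn * E0) + 2 * q * (H1\<^sup>2 * et (T + \<sigma>))))"
    proof -
      have cfa: "continuous_on {0..} ((tavg \<tau> ^^ (2 * k)) f)" by (intro continuous_tavg_iterate \<tau> cf)
      have cMa: "continuous_on {0..} ((tavg \<tau> ^^ (2 * k)) M)" by (intro continuous_tavg_iterate \<tau> cM)
      have "energy T f = energy T (\<lambda>t. (f t - (tavg \<tau> ^^ (2 * k)) f t) + (tavg \<tau> ^^ (2 * k)) f t)" by simp
      also have "\<dots> \<le> 2 * energy T (\<lambda>t. f t - (tavg \<tau> ^^ (2 * k)) f t) + 2 * energy T ((tavg \<tau> ^^ (2 * k)) f)"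
        by (intro energy_add_le2 continuous_intros cf cfa)
      also have "energy T (\<lambda>t. f t - (tavg \<tau> ^^ (2 * k)) f t) \<le> \<sigma>\<^sup>2 * energy (T + \<sigma>) u"
        using energy_minus_tavg_iterate[OF \<tau>(1) fd cu T, of "2 * k"] unfolding \<tau>(2) by simp
      also have "\<sigma>\<^sup>2 * energy (T + \<sigma>) u \<le> \<sigma>\<^sup>2 * et (T + \<sigma>)"
        unfolding et_def by (intro mult_left_mono) (auto simp: energy_nonneg)
      also have "energy T ((tavg \<tau> ^^ (2 * k)) f) = energy T (\<lambda>t. Lf ((tavg \<tau> ^^ (2 * k)) M t))"
      proof (rule energy_cong)
        fix t :: real assume t: "0 \<le> t"
        \<comment> \<open>The deflection is a bounded linear image of the moment, so averaging in
          time commutes with this map and the low-frequency bound transfers from \<open>M\<close> to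
          \<open>f\<close>.\<close>
        have "f = (\<lambda>t. Lf (M t))" by (simp add: f_def Lf_def M_def mul_inverse_EI fun_eq_iff)
        then show "(tavg \<tau> ^^ (2 * k)) f t = Lf ((tavg \<tau> ^^ (2 * k)) M t)"
          using tavg_iterate_linear[OF Lf cM t \<tau>(1)] by simp
      qed
      also have "\<dots> \<le> F\<^sup>2 * energy T ((tavg \<tau> ^^ (2 * k)) M)"
        by (intro energy_le bounded_linear.continuous_on[OF Lf] cMa F)
      also have "energy T ((tavg \<tau> ^^ (2 * k)) M) \<le> CL * ((Kp + 2) / mn * E0) + 2 * q * (H1\<^sup>2 * et (T + \<sigma>))"
      proof -
        have "energy T ((tavg \<tau> ^^ (2 * k)) M) \<le> CL * (energy (T + \<sigma>) pd + energy (T + \<sigma>) qd) + 2 * q * energy (T + \<sigma>) M"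
          by (rule CL(2)[OF coup T])
        also have "\<dots> \<le> CL * (Kp * (E0 / mn) + 2 * (E0 / mn)) + 2 * q * (H1\<^sup>2 * et (T + \<sigma>))"
        proof (intro add_mono mult_left_mono pd_le qd_le)
          have "energy (T + \<sigma>) M \<le> H1\<^sup>2 * energy (T + \<sigma>) p"
            using H1 by (intro energy_le cM cp) (auto simp: M_def intro!: norm_mul_le EI_cont)
          also have "\<dots> \<le> H1\<^sup>2 * et (T + \<sigma>)" unfolding et_def by (intro mult_left_mono) (auto simp: energy_nonneg)
          finally show "energy (T + \<sigma>) M \<le> H1\<^sup>2 * et (T + \<sigma>)" .
        qed (use CL(1) q in auto)
        also have "Kp * (E0 / mn) + 2 * (E0 / mn) = (Kp + 2) / mn * E0" using mn by (simp add: field_simps)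
        finally show ?thesis .
      qed
      finally show ?thesis by (simp add: mult_left_mono)
    qed
    have "c * et T \<le> 2 * KG / r * E0 + C * (E0 / mn) + C * energy T f"
    proof -
      define g where "g t = G z (S t h) (S t h)" for t
      \<comment> \<open>The multiplier functional is dominated by the energy, which never exceeds
        its initial value; the end values of the integrated estimate are thus bounded uniformly in
        \<open>T\<close>.\<close>
      have gb: "\<bar>g t\<bar> \<le> KG / r * E0" if "t \<ge> 0" for t
      proof -
        have "(norm (S t h))\<^sup>2 \<le> E0 / r"
        proof -
          have "r * (norm (S t h))\<^sup>2 \<le> B (S t h) (S t h)" using Br[of "S t h"] by (simp add: norm_sq_beam_state)
          also have "\<dots> \<le> E0" using energy_decreasing_0[OF that, of h] E0 by linarith
          finally show ?thesis using r by (simp add: field_simps)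
        qed
        then have "(norm (S t h))\<^sup>2 * KG \<le> E0 / r * KG" using KG(2) by (rule mult_right_mono)
        then show ?thesis using KG(1)[of "S t h" "S t h"] by (simp add: g_def power2_eq_square mult.commute)
      qed
      have I: "((\<lambda>t. G z (S t h) (S t y) + G z (S t y) (S t h)) has_integral (g T - g 0)) {0..T}"
      proof (rule fundamental_theorem_of_calculus[OF T])
        fix t assume t: "t \<in> {0..T}"
        have "((\<lambda>t. S t h) has_vector_derivative S t y) (at t within {0..T})"
          by (rule has_vector_derivative_within_subset[OF orbit_has_vector_derivative[OF hy]]) (use t in auto)
        then show "(g has_vector_derivative G z (S t h) (S t y) + G z (S t y) (S t h)) (at t within {0..T})"
          unfolding g_def by (intro bounded_bilinear.has_vector_derivative[OF G_bilinear[OF cz]])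
      qed
      have ip: "(\<lambda>t. (norm (p t))\<^sup>2) integrable_on {0..T}" "(\<lambda>t. (norm (u t))\<^sup>2) integrable_on {0..T}"
        "(\<lambda>t. (norm (f t))\<^sup>2) integrable_on {0..T}" "tt integrable_on {0..T}"
        by (intro integrable_norm_sq integrable_Icc cp cu cf ctt order_refl)+
      have J: "((\<lambda>t. - c * ((norm (p t))\<^sup>2 + (norm (u t))\<^sup>2) + C * tt t + C * (norm (f t))\<^sup>2)
        has_integral - c * et T + C * integral {0..T} tt + C * energy T f) {0..T}"
        unfolding et_def energy_def
        by (intro has_integral_add has_integral_mult_right integrable_integral ip)
      have le: "g T - g 0 \<le> - c * et T + C * integral {0..T} tt + C * energy T f"
      proof (rule has_integral_le[OF I J])
        fix t assume t: "t \<in> {0..T}"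
        then have t0: "t \<ge> 0" by simp
        have "classical (S t h) (S t y)"
          by (rule generates_classical[OF generates_orbit[OF hy t0] generates_orbit[OF yw t0]])
        from est[OF this] show "G z (S t h) (S t y) + G z (S t y) (S t h)
          \<le> - c * ((norm (p t))\<^sup>2 + (norm (u t))\<^sup>2) + C * tt t + C * (norm (f t))\<^sup>2"
          by (simp add: p_def u_def f_def tt_def)
      qed
      have le2: "C * integral {0..T} tt \<le> C * (E0 / mn)" using itt[OF T] C by (rule mult_left_mono)
      have combine: "\<alpha> \<le> (\<kappa> + \<kappa>) + \<mu> + \<nu>"
        if "u - v \<le> - \<alpha> + \<beta> + \<nu>" "\<beta> \<le> \<mu>" "- u \<le> \<kappa>" "v \<le> \<kappa>" for \<alpha> \<beta> \<kappa> \<mu> \<nu> u v :: real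
        using that by linarith
      have "c * et T \<le> (KG / r * E0 + KG / r * E0) + C * (E0 / mn) + C * energy T f"
        by (rule combine[OF _ le2 abs_le_D2[OF gb[OF T]] abs_le_D1[OF gb[OF order_refl]]]) (use le in simp)
      also have "KG / r * E0 + KG / r * E0 = 2 * KG / r * E0" by (simp add: field_simps)
      finally show ?thesis .
    qed
    also have "C * energy T f \<le> C * (2 * (\<sigma>\<^sup>2 * et (T + \<sigma>))
        + 2 * (F\<^sup>2 * (CL * ((Kp + 2) / mn * E0) + 2 * q * (H1\<^sup>2 * et (T + \<sigma>)))))"
      using deflection C by (rule mult_left_mono)
    also have "\<dots> = C * (2 * F\<^sup>2 * (CL * ((Kp + 2) / mn))) * E0 + C * (2 * \<sigma>\<^sup>2) * et (T + \<sigma>)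
        + C * (2 * F\<^sup>2 * (2 * q * H1\<^sup>2)) * et (T + \<sigma>)" by (simp add: algebra_simps)
    also have "\<dots> \<le> C * (2 * F\<^sup>2 * (CL * ((Kp + 2) / mn))) * E0 + c / 4 * et (T + \<sigma>) + c / 4 * et (T + \<sigma>)"
      by (intro add_mono[OF add_mono[OF order_refl]] mult_right_mono \<sigma>C eC) (simp_all add: et_def energy_nonneg)
    finally have "c * et T \<le> K1 * E0 + c / 2 * et (T + \<sigma>)"
      by (simp add: K1_def algebra_simps)
    \<comment> \<open>The windows look ahead by \<open>\<sigma>\<close>. By monotonicity of the
      energy the overhang costs a fixed multiple of \<open>E0\<close>, and the remaining
      \<open>c / 2 * et T\<close>, a finite quantity, moves to the left.\<close>
    also have "et (T + \<sigma>) \<le> et T + \<sigma> / r * E0"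
    proof -
      have cn: "continuous_on {0..} (\<lambda>t. (norm (p t))\<^sup>2 + (norm (u t))\<^sup>2)" by (intro continuous_intros cp cu)
      have eq: "et T' = integral {0..T'} (\<lambda>t. (norm (p t))\<^sup>2 + (norm (u t))\<^sup>2)" for T'
        unfolding et_def energy_def
        by (intro Henstock_Kurzweil_Integration.integral_add[symmetric] integrable_norm_sq cp cu order_refl)
      have "et (T + \<sigma>) - et T = integral {T..T + \<sigma>} (\<lambda>t. (norm (p t))\<^sup>2 + (norm (u t))\<^sup>2)"
        unfolding eq using integral_window[OF cn T, of "T + \<sigma>"] \<sigma>(1) by simp
      also have "\<dots> \<le> integral {T..T + \<sigma>} (\<lambda>t. E0 / r)"
      proof (rule integral_le)
        show "(\<lambda>t. (norm (p t))\<^sup>2 + (norm (u t))\<^sup>2) integrable_on {T..T + \<sigma>}" by (rule integrable_Icc[OF cn T])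
        fix t assume t: "t \<in> {T..T + \<sigma>}"
        have "r * ((norm (p t))\<^sup>2 + (norm (u t))\<^sup>2) \<le> r * ((norm (p t))\<^sup>2 + (norm (u t))\<^sup>2 + tips (S t h))"
          using r tips_nonneg[of "S t h"] by (intro mult_left_mono) auto
        also have "\<dots> \<le> B (S t h) (S t h)" unfolding p_def u_def by (rule Br)
        also have "\<dots> \<le> E0" using energy_decreasing_0[of t h] t T E0 by auto
        finally show "(norm (p t))\<^sup>2 + (norm (u t))\<^sup>2 \<le> E0 / r" using r by (simp add: field_simps)
      qed (rule integrable_const_ivl)
      also have "\<dots> = \<sigma> / r * E0" using \<sigma>(1) by simp
      finally show ?thesis by simp
    qed
    finally have "c * et T \<le> K1 * E0 + c / 2 * (et T + \<sigma> / r * E0)" using c by simp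
    then have "c / 2 * et T \<le> (K1 + c / 2 * (\<sigma> / r)) * E0" by (simp add: algebra_simps)
    then have etT: "et T \<le> K2 * E0" using c by (simp add: K2_def field_simps)
    have "integral {0..T} (\<lambda>t. B (S t h) (S t h)) \<le> H * (et T + integral {0..T} (\<lambda>t. tips (S t h)))"
    proof -
      have "((\<lambda>t. H * ((norm (p t))\<^sup>2 + (norm (u t))\<^sup>2 + tips (S t h)))
        has_integral H * (et T + integral {0..T} (\<lambda>t. tips (S t h)))) {0..T}"
        unfolding et_def energy_def
        by (intro has_integral_add has_integral_mult_right integrable_integral integrable_norm_sq integrable_Icc
            cp cu ct order_refl)
      from has_integral_le[OF integrable_integral[OF integrable_energy[OF order_refl]] this]
      show ?thesis using BH unfolding p_def u_def by blast
    qed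
    also have "\<dots> \<le> H * (K2 * E0 + E0 / mn)"
    proof (intro mult_left_mono add_mono etT)
      have "integral {0..T} (\<lambda>t. tips (S t h)) \<le> B h h / mn"
        unfolding mn_def by (rule integral_tips_le[OF hy yw T])
      also have "\<dots> \<le> E0 / mn" using E0 mn by (intro divide_right_mono) auto
      finally show "integral {0..T} (\<lambda>t. tips (S t h)) \<le> E0 / mn" .
    qed (use H in simp)
    also have "\<dots> = H * (K2 + 1 / mn) * (B h h + B y y)" by (simp add: E0_def algebra_simps add_divide_distrib)
    finally show "integral {0..T} (\<lambda>t. B (S t h) (S t h)) \<le> H * (K2 + 1 / mn) * (B h h + B y y)" .
  qed
qed

text \<open>The integral bound uses the dissipation along the orbit of \<open>y\<close> and
  therefore three steps of the generator. Averaging the initial state removes one step per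
  application and doubles the constant each time, until a bound on the domain itself is
  reached.\<close>

theorem beam_energy_decay:
  shows "((\<lambda>t. B (S t h) (S t h)) \<longlongrightarrow> 0) at_top"
    and "generates h y \<Longrightarrow> ((\<lambda>t. t * B (S t h) (S t h)) \<longlongrightarrow> 0) at_top"
proof -
  obtain C where C: "\<And>h y w x T. generates h y \<Longrightarrow> generates y w \<Longrightarrow> generates w x \<Longrightarrow> T \<ge> 0 \<Longrightarrow>
    integral {0..T} (\<lambda>t. B (S t h) (S t h)) \<le> C * (B h h + B y y)"
    by (rule integral_energy_bound) blast
  have 2: "integral {0..T} (\<lambda>t. B (S t h) (S t h)) \<le> 2 * C * (B h h + B y y)"
    if "generates h y" "generates y w" "T \<ge> 0" for h y w T
  proof (rule integral_energy_extend[OF _ that(3)])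
    fix r :: real assume r: "r > 0"
    show "integral {0..T} (\<lambda>t. B (S t (avg r h)) (S t (avg r h))) \<le> C * (B (avg r h) (avg r h) + B (avg r y) (avg r y))"
      by (rule C[OF generates_avg_avg(1)[OF that(1) r] generates_avg_avg(1)[OF that(2) r] generates_avg[OF r] that(3)])
  qed
  have 1: "integral {0..T} (\<lambda>t. B (S t h) (S t h)) \<le> 2 * (2 * C) * (B h h + B y y)"
    if "generates h y" "T \<ge> 0" for h y T
  proof (rule integral_energy_extend[OF _ that(2)])
    fix r :: real assume r: "r > 0"
    show "integral {0..T} (\<lambda>t. B (S t (avg r h)) (S t (avg r h))) \<le> 2 * C * (B (avg r h) (avg r h) + B (avg r y) (avg r y))"
      by (rule 2[OF generates_avg_avg(1)[OF that(1) r] generates_avg[OF r] that(2)])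
  qed
  show "((\<lambda>t. B (S t h) (S t h)) \<longlongrightarrow> 0) at_top" by (rule energy_decay) (rule 1)
  show "((\<lambda>t. t * B (S t h) (S t h)) \<longlongrightarrow> 0) at_top" if "generates h y"
    by (rule energy_decay_domain) (rule 1[OF that])
qed

end

section \<open>The tower model\<close>

lemma dw_works:
  "f differentiable (at x within {0..1}) \<Longrightarrow> (f has_vector_derivative dw f x) (at x within {0..1})"
  unfolding dw_def by (simp add: vector_derivative_works)

lemma dw_eq:
  "(f has_vector_derivative D) (at x within {0..1}) \<Longrightarrow> x \<in> {0..1} \<Longrightarrow> dw f x = D"
  unfolding dw_def using vector_derivative_within_cbox[of 0 1 x f D] by simp

lemma has_vector_derivative_unit_cong:
  assumes "\<And>x. x \<in> {0..1} \<Longrightarrow> f x = g x" "x \<in> {0..1}" "(f has_vector_derivative D) (at x within {0..1})"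
  shows "(g has_vector_derivative D) (at x within {0..1})"
  using has_vector_derivative_transform[OF assms(2) _ assms(3), of g] assms(1) by simp

lemma Ck_Suc_D:
  assumes "Ck (Suc n) h"
  shows "\<And>x. x \<in> {0..1} \<Longrightarrow> (h has_real_derivative dw h x) (at x within {0..1})" "Ck n (dw h)"
proof -
  show "(h has_real_derivative dw h x) (at x within {0..1})" if "x \<in> {0..1}" for x
    unfolding has_real_derivative_iff_has_vector_derivative using assms that by (intro dw_works) simp
  show "Ck n (dw h)" using assms by simp
qed

lemma Ck_continuous: "Ck n h \<Longrightarrow> continuous_on {0..1} h"
proof (induction n)
  case (Suc n)
  show ?case
    using derivative_imp_continuous_on[of "{0..1}" h "dw h"] Ck_Suc_D(1)[OF Suc.prems]
    by (simp add: has_real_derivative_iff_has_vector_derivative)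
qed simp

lemma is_L2_antideriv_iff:
  "is_L2_antideriv f g \<longleftrightarrow> L2 g \<and> (\<forall>x\<in>{0..1}. f x = f 0 + integral {0..x} g)"
  unfolding is_L2_antideriv_def using L2_integrable(2)[of g 0] by auto

lemma is_L2_antiderivD:
  assumes "is_L2_antideriv f g"
  shows "L2 g" "x \<in> {0..1} \<Longrightarrow> f x = f 0 + integral {0..x} g"
  using assms unfolding is_L2_antideriv_iff by blast+

lemma is_L2_antideriv_wd:
  assumes "H1 f"
  shows "is_L2_antideriv f (wd f)"
proof -
  obtain g where "is_L2_antideriv f g" using assms unfolding H1_def by blast
  then show ?thesis unfolding wd_def by (rule someI[of "is_L2_antideriv f" g])
qed

text \<open>\<open>wd\<close> is an arbitrary choice among weak derivatives. Its class does not
  depend on the choice, so any derivative computed explicitly may take its place.\<close>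

lemma to_l2_wd:
  assumes "is_L2_antideriv f g"
  shows "to_l2 (wd f) = to_l2 g" "L2 (wd f)"
proof -
  have "H1 f" using assms unfolding H1_def by blast
  then have w: "is_L2_antideriv f (wd f)" by (rule is_L2_antideriv_wd)
  then show L: "L2 (wd f)" by (rule is_L2_antiderivD)
  show "to_l2 (wd f) = to_l2 g"
  proof (rule L2_eq_if_primitives_eq[OF L is_L2_antiderivD(1)[OF assms]])
    fix x :: real assume "x \<in> {0..1}"
    then show "integral {0..x} (wd f) = integral {0..x} g"
      using is_L2_antiderivD(2)[OF w, of x] is_L2_antiderivD(2)[OF assms, of x] by simp
  qed
qed

lemma is_L2_antideriv_C1:
  assumes "\<And>x. x \<in> {0..1} \<Longrightarrow> (f has_vector_derivative f' x) (at x within {0..1})" "continuous_on {0..1} f'"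
  shows "is_L2_antideriv f f'"
  unfolding is_L2_antideriv_iff
proof (intro conjI ballI L2_continuous assms(2))
  fix x :: real assume "x \<in> {0..1}"
  then show "f x = f 0 + integral {0..x} f'"
    using FTC_unit[OF assms(1), of 0 x] by (simp add: integral_unique)
qed

lemma H2l_D:
  assumes "H2l f"
  shows "\<And>x. x \<in> {0..1} \<Longrightarrow> (f has_vector_derivative dw f x) (at x within {0..1})"
    "H1 (dw f)" "f 0 = 0" "dw f 0 = 0" "continuous_on {0..1} f" "L2 f" "L2 (wd (dw f))"
proof -
  have h: "\<forall>x\<in>{0..1}. f differentiable (at x within {0..1})" "H1 (dw f)" "f 0 = 0" "dw f 0 = 0"
    using assms by (auto simp: H2l_def numeral_2_eq_2)
  then show d: "\<And>x. x \<in> {0..1} \<Longrightarrow> (f has_vector_derivative dw f x) (at x within {0..1})"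
    and "H1 (dw f)" "f 0 = 0" "dw f 0 = 0" by (auto intro!: dw_works)
  show c: "continuous_on {0..1} f" by (rule derivative_imp_continuous_on[OF d])
  show "L2 f" by (rule L2_continuous[OF c])
  show "L2 (wd (dw f))" by (rule is_L2_antiderivD(1)[OF is_L2_antideriv_wd[OF h(2)]])
qed

lemma H2l_I:
  assumes "\<And>x. x \<in> {0..1} \<Longrightarrow> (f has_vector_derivative f1 x) (at x within {0..1})"
    and "is_L2_antideriv f1 q" "f 0 = 0" "f1 0 = 0"
  shows "H2l f" "to_l2 (wd (dw f)) = to_l2 q"
proof -
  have eq: "dw f x = f1 x" if "x \<in> {0..1}" for x using dw_eq[OF assms(1)[OF that] that] .
  have q: "is_L2_antideriv (dw f) q" unfolding is_L2_antideriv_iff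
  proof (intro conjI ballI)
    show "L2 q" by (rule is_L2_antiderivD(1)[OF assms(2)])
    fix x :: real assume "x \<in> {0..1}"
    then show "dw f x = dw f 0 + integral {0..x} q"
      using is_L2_antiderivD(2)[OF assms(2), of x] eq[of x] eq[of 0] by simp
  qed
  show "to_l2 (wd (dw f)) = to_l2 q" by (rule to_l2_wd(1)[OF q])
  have "f differentiable (at x within {0..1})" if "x \<in> {0..1}" for x
    using assms(1)[OF that] by (auto simp: differentiable_def has_vector_derivative_def)
  then show "H2l f" using q assms(3,4) eq[of 0] by (auto simp: H2l_def numeral_2_eq_2 H1_def)
qed

text \<open>Two integrations from the clamped end recover slope and deflection from the class of the
  curvature. The conclusion is pointwise, so it transfers derivatives and tip values from one
  function to the other.\<close>

lemma H2l_determined: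
  assumes f: "H2l f" and g: "H2l g" and eq: "to_l2 (wd (dw f)) = to_l2 (wd (dw g))" and x: "x \<in> {0..1}"
  shows "dw f x = dw g x" "f x = g x"
proof -
  have d: "dw f y = dw g y" if "y \<in> {0..1}" for y
  proof -
    have "dw f y = integral {0..y} (wd (dw f))" "dw g y = integral {0..y} (wd (dw g))"
      using is_L2_antiderivD(2)[OF is_L2_antideriv_wd[OF H2l_D(2)[OF f]] that] H2l_D(4)[OF f]
        is_L2_antiderivD(2)[OF is_L2_antideriv_wd[OF H2l_D(2)[OF g]] that] H2l_D(4)[OF g] by simp_all
    then show ?thesis using L2_integral_cong[OF H2l_D(7)[OF f] H2l_D(7)[OF g] eq, of 0 y] that by simp
  qed
  show "dw f x = dw g x" by (rule d[OF x])
  have "f x = integral {0..x} (dw f)" "g x = integral {0..x} (dw g)"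
    using FTC_unit[OF H2l_D(1)[OF f], of 0 x] FTC_unit[OF H2l_D(1)[OF g], of 0 x] x H2l_D(3)[OF f] H2l_D(3)[OF g]
    by (simp_all add: integral_unique)
  moreover have "integral {0..x} (dw f) = integral {0..x} (dw g)"
    using x by (intro integral_cong d) auto
  ultimately show "f x = g x" by simp
qed

text \<open>The quotient map by the null elements of the seminorm: it turns vanishing seminorm
  distance into equality.\<close>

definition embed :: "state \<Rightarrow> beam_state"
  where "embed z = (case z of (f, g, \<xi>, \<eta>) \<Rightarrow> (to_l2 (wd (dw f)), to_l2 g, \<xi>, \<eta>))"

text \<open>A section of \<open>embed\<close>: some representative of the curvature, integrated
  twice from the clamped end. Concrete states are needed because \<open>T\<close> acts on
  functions.\<close>

definition realize :: "beam_state \<Rightarrow> state"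
  where "realize h = (case h of (p, g, \<xi>, \<eta>) \<Rightarrow>
    (\<lambda>x. integral {0..x} (\<lambda>y. integral {0..y} (of_l2 p)), of_l2 g, \<xi>, \<eta>))"

lemma embed_realize: "realize h \<in> stateX" "embed (realize h) = h"
proof -
  obtain p g \<xi> \<eta> where h: "h = (p, g, \<xi>, \<eta>)" by (cases h)
  define f1 where "f1 y = integral {0..y} (of_l2 p)" for y
  define f where "f x = integral {0..x} f1" for x
  have c: "continuous_on {0..1} f1" unfolding f1_def by (rule continuous_forward[OF L2_of_l2])
  have d: "(f has_vector_derivative f1 x) (at x within {0..1})" if "x \<in> {0..1}" for x
    unfolding f_def by (rule integral_has_vector_derivative[OF c that])
  have a: "is_L2_antideriv f1 (of_l2 p)" by (simp add: is_L2_antideriv_iff L2_of_l2 f1_def)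
  have "f 0 = 0" "f1 0 = 0" by (simp_all add: f_def f1_def)
  note H = H2l_I[OF d a this]
  have r: "realize h = (f, of_l2 g, \<xi>, \<eta>)" by (simp add: realize_def h f_def[abs_def] f1_def[abs_def])
  show "realize h \<in> stateX" using H by (simp add: r stateX_def L2_of_l2)
  show "embed (realize h) = h" unfolding r using H by (simp add: embed_def h)
qed

lemma embed_combination:
  fixes r s :: real
  assumes "z1 \<in> stateX" "z2 \<in> stateX"
  defines "z \<equiv> st_add (st_scale (complex_of_real r) z1) (st_scale (complex_of_real s) z2)"
  shows "z \<in> stateX" "embed z = r *\<^sub>R embed z1 + s *\<^sub>R embed z2"
proof -
  obtain f1 g1 x1 y1 where z1: "z1 = (f1, g1, x1, y1)" by (cases z1)
  obtain f2 g2 x2 y2 where z2: "z2 = (f2, g2, x2, y2)" by (cases z2)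
  have H: "H2l f1" "L2 g1" "H2l f2" "L2 g2" using assms(1,2) by (auto simp: stateX_def z1 z2)
  define f where "f x = r *\<^sub>R f1 x + s *\<^sub>R f2 x" for x
  define g where "g x = r *\<^sub>R g1 x + s *\<^sub>R g2 x" for x
  have z: "z = (f, g, r *\<^sub>R x1 + s *\<^sub>R x2, r *\<^sub>R y1 + s *\<^sub>R y2)"
    by (simp add: z_def z1 z2 st_add_def st_scale_def f_def[abs_def] g_def[abs_def] scaleR_conv_of_real)
  have d: "(f has_vector_derivative (r *\<^sub>R dw f1 x + s *\<^sub>R dw f2 x)) (at x within {0..1})" if "x \<in> {0..1}" for x
    unfolding f_def
    by (intro has_vector_derivative_add bounded_linear.has_vector_derivative[OF bounded_linear_scaleR_right] H2l_D(1) H that)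
  note w1 = is_L2_antideriv_wd[OF H2l_D(2)[OF H(1)]] and w2 = is_L2_antideriv_wd[OF H2l_D(2)[OF H(3)]]
  have L: "L2 (wd (dw f1))" "L2 (wd (dw f2))" by (intro H2l_D H)+
  have a: "is_L2_antideriv (\<lambda>x. r *\<^sub>R dw f1 x + s *\<^sub>R dw f2 x) (\<lambda>x. r *\<^sub>R wd (dw f1) x + s *\<^sub>R wd (dw f2) x)"
    unfolding is_L2_antideriv_iff
  proof (intro conjI ballI L2_add L2_scaleR L)
    fix x :: real assume x: "x \<in> {0..1}"
    have i: "integral {0..x} (\<lambda>x. r *\<^sub>R wd (dw f1) x + s *\<^sub>R wd (dw f2) x)
        = r *\<^sub>R integral {0..x} (wd (dw f1)) + s *\<^sub>R integral {0..x} (wd (dw f2))"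
    proof -
      have "integral {0..x} (\<lambda>x. r *\<^sub>R wd (dw f1) x + s *\<^sub>R wd (dw f2) x)
          = integral {0..x} (\<lambda>x. r *\<^sub>R wd (dw f1) x) + integral {0..x} (\<lambda>x. s *\<^sub>R wd (dw f2) x)"
        by (intro Henstock_Kurzweil_Integration.integral_add integrable_cmul L2_integrable L) (use x in auto)
      then show ?thesis by (simp del: complex_scaleR)
    qed
    have "dw f1 x = dw f1 0 + integral {0..x} (wd (dw f1))" "dw f2 x = dw f2 0 + integral {0..x} (wd (dw f2))"
      by (rule is_L2_antiderivD(2)[OF w1 x], rule is_L2_antiderivD(2)[OF w2 x])
    then show "r *\<^sub>R dw f1 x + s *\<^sub>R dw f2 x = r *\<^sub>R dw f1 0 + s *\<^sub>R dw f2 0 +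
      integral {0..x} (\<lambda>x. r *\<^sub>R wd (dw f1) x + s *\<^sub>R wd (dw f2) x)"
      unfolding i by (simp add: scaleR_add_right del: complex_scaleR)
  qed
  have "f 0 = 0" "r *\<^sub>R dw f1 0 + s *\<^sub>R dw f2 0 = 0" using H2l_D(3,4)[OF H(1)] H2l_D(3,4)[OF H(3)] by (simp_all add: f_def)
  note HH = H2l_I[OF d a this]
  show "z \<in> stateX" using HH(1) H unfolding z stateX_def g_def by (auto intro!: L2_add L2_scaleR simp del: complex_scaleR)
  show "embed z = r *\<^sub>R embed z1 + s *\<^sub>R embed z2"
    using HH(2) H L by (simp add: z z1 z2 embed_def g_def[abs_def] to_l2_add to_l2_scaleR L2_scaleR del: complex_scaleR)
qed

lemma st_diff_eq: "st_diff z1 z2 = st_add (st_scale (complex_of_real 1) z1) (st_scale (complex_of_real (-1)) z2)"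
  by (simp add: st_diff_def st_add_def st_scale_def fun_eq_iff split: prod.splits)

lemma embed_diff:
  assumes "z1 \<in> stateX" "z2 \<in> stateX"
  shows "st_diff z1 z2 \<in> stateX" "embed (st_diff z1 z2) = embed z1 - embed z2"
  using embed_combination[OF assms, of 1 "-1"] by (simp_all only: st_diff_eq) simp

lemma st_scale_eq: "st_scale c z = st_add (st_scale c z) (st_scale (complex_of_real 0) z)"
  by (simp add: st_add_def st_scale_def fun_eq_iff split: prod.splits)

lemma embed_scale:
  assumes "z \<in> stateX"
  shows "st_scale (complex_of_real r) z \<in> stateX" "embed (st_scale (complex_of_real r) z) = r *\<^sub>R embed z"
  using embed_combination[OF assms assms, of r 0] st_scale_eq[of "complex_of_real r" z] by simp_all

lemma st_add_eq: "st_add z1 z2 = st_add z1 (st_scale (complex_of_real 1) z2)"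
  by (simp add: st_add_def st_scale_def fun_eq_iff split: prod.splits)

lemma embed_scale_add:
  assumes "z1 \<in> stateX" "z2 \<in> stateX"
  shows "st_add (st_scale (complex_of_real r) z1) z2 \<in> stateX"
    "embed (st_add (st_scale (complex_of_real r) z1) z2) = r *\<^sub>R embed z1 + embed z2"
  using embed_combination[OF assms, of r 1] st_add_eq[of "st_scale (complex_of_real r) z1" z2] by simp_all

section \<open>Regularity of states in the domain of the generator\<close>

lemma Hs4_D:
  assumes "Hs 4 f"
  shows "\<And>x. x \<in> {0..1} \<Longrightarrow> (f has_vector_derivative dw f x) (at x within {0..1})"
    "\<And>x. x \<in> {0..1} \<Longrightarrow> (dw f has_vector_derivative dw (dw f) x) (at x within {0..1})"
    "\<And>x. x \<in> {0..1} \<Longrightarrow> (dw (dw f) has_vector_derivative dw (dw (dw f)) x) (at x within {0..1})"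
    "H1 (dw (dw (dw f)))" "continuous_on {0..1} (dw (dw f))"
proof -
  have "Hs (Suc (Suc (Suc (Suc 0)))) f" using assms by (simp add: eval_nat_numeral)
  then have h: "\<forall>x\<in>{0..1}. f differentiable (at x within {0..1})"
    "\<forall>x\<in>{0..1}. dw f differentiable (at x within {0..1})"
    "\<forall>x\<in>{0..1}. dw (dw f) differentiable (at x within {0..1})" "H1 (dw (dw (dw f)))" by auto
  then show "\<And>x. x \<in> {0..1} \<Longrightarrow> (f has_vector_derivative dw f x) (at x within {0..1})"
    "\<And>x. x \<in> {0..1} \<Longrightarrow> (dw f has_vector_derivative dw (dw f) x) (at x within {0..1})"
    "H1 (dw (dw (dw f)))" by (auto intro!: dw_works)
  show d: "\<And>x. x \<in> {0..1} \<Longrightarrow> (dw (dw f) has_vector_derivative dw (dw (dw f)) x) (at x within {0..1})"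
    using h by (auto intro!: dw_works)
  show "continuous_on {0..1} (dw (dw f))" by (rule derivative_imp_continuous_on[OF d])
qed

lemma Hs4_H2l:
  assumes "Hs 4 f" "f 0 = 0" "dw f 0 = 0"
  shows "H2l f" "to_l2 (wd (dw f)) = to_l2 (dw (dw f))"
  by (rule H2l_I[OF Hs4_D(1)[OF assms(1)] is_L2_antideriv_C1[OF Hs4_D(2)[OF assms(1)] Hs4_D(5)[OF assms(1)]] assms(2,3)],
      assumption+)+

lemma domA_stateX: "z \<in> domA \<Longrightarrow> z \<in> stateX"
  using Hs4_H2l(1) H2l_D(6) by (auto simp: domA_def stateX_def)

text \<open>The shear contains \<open>EI\<close> times a third derivative that is merely in H1,
  where the classical product rule fails; \<open>absolutely_continuous_by_parts\<close> supplies the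
  primitive of the product instead.\<close>

lemma bending_moment_H1:
  assumes EI: "Ck 4 EI" and f: "Hs 4 f"
  defines "M \<equiv> \<lambda>x. complex_of_real (EI x) * dw (dw f) x"
  shows "\<And>x. x \<in> {0..1} \<Longrightarrow> (M has_vector_derivative dw M x) (at x within {0..1})" "H1 (dw M)"
proof -
  have E: "Ck (Suc (Suc (Suc (Suc 0)))) EI" using EI by (simp add: eval_nat_numeral)
  note E1 = Ck_Suc_D[OF E] 
  note E2 = Ck_Suc_D[OF E1(2)]
  have cE: "continuous_on {0..1} EI" "continuous_on {0..1} (dw EI)" "continuous_on {0..1} (dw (dw EI))"
    using Ck_continuous[OF E] Ck_continuous[OF E1(2)] Ck_continuous[OF E2(2)] .
  note d = Hs4_D(3)[OF f] 
  have M: "M = (\<lambda>x. EI x *\<^sub>R dw (dw f) x)" by (simp add: M_def scaleR_conv_of_real)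
  define f2 where "f2 = dw (dw f)"
  define f3 where "f3 = dw (dw (dw f))"
  define q where "q = wd f3"
  have f3: "L2 q" "\<And>x. x \<in> {0..1} \<Longrightarrow> f3 x = f3 0 + integral {0..x} q"
    unfolding q_def f3_def using is_L2_antiderivD[OF is_L2_antideriv_wd[OF Hs4_D(4)[OF f]]] by blast+
  have cf3: "continuous_on {0..1} f3"
  proof (rule continuous_on_eq)
    show "continuous_on {0..1} (\<lambda>x. f3 0 + integral {0..x} q)"
      by (intro continuous_intros continuous_forward f3(1))
  qed (simp add: f3(2)[symmetric])
  have cf2: "continuous_on {0..1} f2" unfolding f2_def by (rule Hs4_D(5)[OF f])
  have dM: "(M has_vector_derivative (EI x *\<^sub>R f3 x + dw EI x *\<^sub>R f2 x)) (at x within {0..1})" if "x \<in> {0..1}" for x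
    unfolding M f3_def f2_def by (rule has_vector_derivative_scaleR[OF E1(1)[OF that] d[OF that]])
  have eq: "dw M x = EI x *\<^sub>R f3 x + dw EI x *\<^sub>R f2 x" if "x \<in> {0..1}" for x
    by (rule dw_eq[OF dM[OF that] that])
  then show "(M has_vector_derivative dw M x) (at x within {0..1})" if "x \<in> {0..1}" for x
    using dM that by simp
  \<comment> \<open>The weak derivative of the shear, grouped by the way each part integrates: the
    primitive of \<open>q\<close> by the product rule for absolutely continuous functions, the
    constant \<open>f3 0\<close> by the fundamental theorem, and \<open>dw EI *\<^sub>R f2\<close>
    by the classical product rule.\<close>
  define k where "k x = (EI x *\<^sub>R q x + dw EI x *\<^sub>R integral {0..x} q) + (dw EI x *\<^sub>R f3 0 + (dw EI x *\<^sub>R f3 x + dw (dw EI) x *\<^sub>R f2 x))" for x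
  have "is_L2_antideriv (dw M) k" unfolding is_L2_antideriv_iff
  proof (intro conjI ballI)
    show "L2 k" unfolding k_def
      by (intro L2_add L2_mult_continuous cE f3(1) L2_continuous continuous_forward continuous_on_scaleR cf3 cf2 L2_const
          continuous_on_add continuous_on_const)
    fix x :: real assume x: "x \<in> {0..1}"
    have i1: "((\<lambda>x. EI x *\<^sub>R q x + dw EI x *\<^sub>R integral {0..x} q) has_integral EI x *\<^sub>R integral {0..x} q) {0..x}"
      by (rule absolutely_continuous_by_parts[OF f3(1) _ cE(2) x])
         (use E1(1) in \<open>simp add: has_real_derivative_iff_has_vector_derivative\<close>)
    have i2: "((\<lambda>x. dw EI x *\<^sub>R f3 0) has_integral (EI x - EI 0) *\<^sub>R f3 0) {0..x}"
      using x E1(1) by (intro has_integral_scaleR_left FTC_unit) (auto simp: has_real_derivative_iff_has_vector_derivative)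
    have i3: "((\<lambda>x. dw EI x *\<^sub>R f3 x + dw (dw EI) x *\<^sub>R f2 x) has_integral (dw EI x *\<^sub>R f2 x - dw EI 0 *\<^sub>R f2 0)) {0..x}"
      using x by (intro FTC_unit[where f = "\<lambda>x. dw EI x *\<^sub>R f2 x"] has_vector_derivative_scaleR E2(1))
        (auto simp: f2_def f3_def intro: d)
    have "integral {0..x} k = EI x *\<^sub>R integral {0..x} q + ((EI x - EI 0) *\<^sub>R f3 0 + (dw EI x *\<^sub>R f2 x - dw EI 0 *\<^sub>R f2 0))"
      unfolding k_def by (intro integral_unique has_integral_add i1 i2 i3)
    then show "dw M x = dw M 0 + integral {0..x} k"
      using f3(2)[OF x] x by (simp add: eq scaleR_add_right scaleR_diff_left del: complex_scaleR)
  qed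
  then show "H1 (dw M)" by (auto simp: H1_def)
qed

section \<open>The semigroup induced on the Hilbert space and its generator\<close>

locale beam_problem =
  fixes rho EI :: "real \<Rightarrow> real" and m J a b :: real and T :: "real \<Rightarrow> state \<Rightarrow> state"
  assumes rho_C4: "Ck 4 rho" and EI_C4: "Ck 4 EI"
    and rho_positive: "\<forall>x\<in>{0..1}. rho x > 0" and EI_positive: "\<forall>x\<in>{0..1}. EI x > 0"
    and constants: "m > 0" "J > 0" "a > 0" "b > 0"
    and semigroup: "C0_semigroup_gen (sqnorm rho EI m J) stateX domA (opA rho EI m J a b) T"
begin

lemma rho_C1: "Ck (Suc (Suc (Suc (Suc 0)))) rho" using rho_C4 by (simp add: eval_nat_numeral)
lemma EI_C1: "Ck (Suc (Suc (Suc (Suc 0)))) EI" using EI_C4 by (simp add: eval_nat_numeral)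

sublocale beam rho "dw rho" EI "dw EI" m J a b
proof (rule beam.intro)
  show "continuous_on {0..1} (dw rho)" "continuous_on {0..1} (dw EI)"
    by (rule Ck_continuous[OF Ck_Suc_D(2)[OF rho_C1]], rule Ck_continuous[OF Ck_Suc_D(2)[OF EI_C1]])
  fix x :: real assume x: "x \<in> {0..1}"
  show "(rho has_real_derivative dw rho x) (at x within {0..1})" by (rule Ck_Suc_D(1)[OF rho_C1 x])
  show "(EI has_real_derivative dw EI x) (at x within {0..1})" by (rule Ck_Suc_D(1)[OF EI_C1 x])
  show "rho x > 0" "EI x > 0" using rho_positive EI_positive x by blast+
qed (rule constants)+

lemma sqnorm_embed:
  assumes "z \<in> stateX"
  shows "sqnorm rho EI m J z = B (embed z) (embed z)"
proof -
  obtain f g \<xi> \<eta> where z: "z = (f, g, \<xi>, \<eta>)" by (cases z)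
  define p where "p = wd (dw f)"
  have L: "L2 p" "L2 g" using assms H2l_D(7) by (auto simp: z stateX_def p_def)
  have s: "inner (h x *\<^sub>R u x) (u x) = h x * (cmod (u x))\<^sup>2" for h :: "real \<Rightarrow> real" and u :: cfun and x
    by (simp add: power2_norm_eq_inner del: complex_scaleR)
  have i: "inner (mul h (to_l2 u)) (to_l2 u) = (LINT x|unit_measure. h x * (cmod (u x))\<^sup>2)"
    "integrable unit_measure (\<lambda>x. h x * (cmod (u x))\<^sup>2)"
    if "continuous_on {0..1} h" "L2 u" for h u
    using that L2_inner_integrable[OF L2_mult_continuous[OF that] that(2)] unfolding s[symmetric]
    by (simp_all add: mul_to_l2 to_l2_inner L2_mult_continuous del: complex_scaleR inner_scaleR_left)
  have "(LINT x:{0..1}|lborel. EI x * (cmod (p x))\<^sup>2 + rho x * (cmod (g x))\<^sup>2)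
      = inner (mul EI (to_l2 p)) (to_l2 p) + inner (mul rho (to_l2 g)) (to_l2 g)"
    unfolding set_integral_unit_measure using i(2)[OF EI_cont L(1)] i(2)[OF rho_cont L(2)]
    by (simp add: i(1)[OF EI_cont L(1)] i(1)[OF rho_cont L(2)])
  then show ?thesis by (simp add: z sqnorm_def embed_def B_def p_def power2_norm_eq_inner)
qed

lemma B_norm_bounds:
  obtains r H where "r > 0" "H > 0" "\<And>Z. r * (norm Z)\<^sup>2 \<le> B Z Z" "\<And>Z. B Z Z \<le> H * (norm Z)\<^sup>2"
  using B_bounds unfolding norm_sq_beam_state by metis

text \<open>The energy form is equivalent to the squared norm; this transfers the limits in the
  definition of the semigroup from the seminorm to the topology of
  \<open>beam_state\<close>.\<close>

lemma B_tendsto_0_iff: "((\<lambda>t. B (W t) (W t)) \<longlongrightarrow> 0) F \<longleftrightarrow> (W \<longlongrightarrow> 0) F"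
proof
  obtain r H where r: "r > 0" "\<And>Z. r * (norm Z)\<^sup>2 \<le> B Z Z" using B_norm_bounds by metis
  assume "((\<lambda>t. B (W t) (W t)) \<longlongrightarrow> 0) F"
  then have "((\<lambda>t. sqrt (B (W t) (W t) / r)) \<longlongrightarrow> sqrt (0 / r)) F" by (intro tendsto_intros) (use r in auto)
  moreover have "norm (W t) \<le> sqrt (B (W t) (W t) / r)" for t
    using r(1) r(2)[of "W t"] by (intro real_le_rsqrt) (simp add: field_simps)
  ultimately show "(W \<longlongrightarrow> 0) F"
    by (intro Lim_null_comparison[of W "\<lambda>t. sqrt (B (W t) (W t) / r)"]) (auto intro: always_eventually)
next
  assume "(W \<longlongrightarrow> 0) F"
  then have "((\<lambda>t. B (W t) (W t)) \<longlongrightarrow> B 0 0) F" by (intro bounded_bilinear.tendsto[OF B_bilinear])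
  then show "((\<lambda>t. B (W t) (W t)) \<longlongrightarrow> 0) F" by (simp add: bounded_bilinear.zero_left[OF B_bilinear])
qed

lemma B_eq_0_iff: "B Z Z = 0 \<longleftrightarrow> Z = 0"
  using B_norm_bounds bounded_bilinear.zero_left[OF B_bilinear]
  by (metis mult_pos_pos norm_eq_zero zero_less_power2 not_le)

lemma sqnorm_diff_eq_0_iff:
  "z1 \<in> stateX \<Longrightarrow> z2 \<in> stateX \<Longrightarrow> sqnorm rho EI m J (st_diff z1 z2) = 0 \<longleftrightarrow> embed z1 = embed z2"
  by (simp add: sqnorm_embed embed_diff B_eq_0_iff)

lemma
  T_stateX: "\<And>t z. t \<ge> 0 \<Longrightarrow> z \<in> stateX \<Longrightarrow> T t z \<in> stateX"
  and T_bounded: "\<And>t. t \<ge> 0 \<Longrightarrow> \<exists>C. \<forall>z\<in>stateX. sqnorm rho EI m J (T t z) \<le> C * sqnorm rho EI m J z"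
  and T_linear: "\<And>t z1 z2 c. t \<ge> 0 \<Longrightarrow> z1 \<in> stateX \<Longrightarrow> z2 \<in> stateX \<Longrightarrow>
    sqnorm rho EI m J (st_diff (T t (st_add (st_scale c z1) z2)) (st_add (st_scale c (T t z1)) (T t z2))) = 0"
  and T_0: "\<And>z. z \<in> stateX \<Longrightarrow> sqnorm rho EI m J (st_diff (T 0 z) z) = 0"
  and T_add: "\<And>s t z. s \<ge> 0 \<Longrightarrow> t \<ge> 0 \<Longrightarrow> z \<in> stateX \<Longrightarrow>
    sqnorm rho EI m J (st_diff (T (s + t) z) (T s (T t z))) = 0"
  and T_continuous: "\<And>z. z \<in> stateX \<Longrightarrow> ((\<lambda>t. sqnorm rho EI m J (st_diff (T t z) z)) \<longlongrightarrow> 0) (at_right 0)"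
  and T_domain: "\<And>z y. z \<in> stateX \<Longrightarrow> y \<in> stateX \<Longrightarrow>
    ((\<lambda>h. sqnorm rho EI m J (st_diff (st_scale (complex_of_real (1 / h)) (st_diff (T h z) z)) y)) \<longlongrightarrow> 0) (at_right 0) \<Longrightarrow>
    \<exists>z'\<in>domA. sqnorm rho EI m J (st_diff z z') = 0"
  and T_generator: "\<And>z. z \<in> domA \<Longrightarrow>
    ((\<lambda>h. sqnorm rho EI m J (st_diff (st_scale (complex_of_real (1 / h)) (st_diff (T h z) z)) (opA rho EI m J a b z))) \<longlongrightarrow> 0) (at_right 0)"
proof -
  note sg = semigroup[unfolded C0_semigroup_gen_def]
  note sg1 = sg[THEN conjunct1] and sg' = sg[THEN conjunct2]
  note sg2 = sg'[THEN conjunct1] and sg' = sg'[THEN conjunct2]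
  note sg3 = sg'[THEN conjunct1] and sg' = sg'[THEN conjunct2]
  note sg4 = sg'[THEN conjunct1] and sg' = sg'[THEN conjunct2]
  note sg5 = sg'[THEN conjunct1] and sg' = sg'[THEN conjunct2]
  note sg6 = sg'[THEN conjunct1] and sg' = sg'[THEN conjunct2]
  note sg7 = sg'[THEN conjunct1] and sg8 = sg'[THEN conjunct2]
  show "T t z \<in> stateX" if "t \<ge> 0" "z \<in> stateX" for t z using sg1 that by blast
  show "\<exists>C. \<forall>z\<in>stateX. sqnorm rho EI m J (T t z) \<le> C * sqnorm rho EI m J z" if "t \<ge> 0" for t
    using sg2 that by blast
  show "sqnorm rho EI m J (st_diff (T t (st_add (st_scale c z1) z2)) (st_add (st_scale c (T t z1)) (T t z2))) = 0"
    if "t \<ge> 0" "z1 \<in> stateX" "z2 \<in> stateX" for t z1 z2 c using sg3 that by blast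
  show "sqnorm rho EI m J (st_diff (T 0 z) z) = 0" if "z \<in> stateX" for z using sg4 that by blast
  show "sqnorm rho EI m J (st_diff (T (s + t) z) (T s (T t z))) = 0"
    if "s \<ge> 0" "t \<ge> 0" "z \<in> stateX" for s t z using sg5 that by blast
  show "((\<lambda>t. sqnorm rho EI m J (st_diff (T t z) z)) \<longlongrightarrow> 0) (at_right 0)" if "z \<in> stateX" for z
    using sg6 that by blast
  show "\<exists>z'\<in>domA. sqnorm rho EI m J (st_diff z z') = 0"
    if "z \<in> stateX" "y \<in> stateX"
      "((\<lambda>h. sqnorm rho EI m J (st_diff (st_scale (complex_of_real (1 / h)) (st_diff (T h z) z)) y)) \<longlongrightarrow> 0) (at_right 0)"
    for z y
  proof -
    have "\<exists>y\<in>stateX. ((\<lambda>h. sqnorm rho EI m J (st_diff (st_scale (complex_of_real (1 / h)) (st_diff (T h z) z)) y))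
        \<longlongrightarrow> 0) (at_right 0)"
      by (rule bexI[of _ y]) (rule that)+
    then show ?thesis by (rule iffD1[OF sg7[THEN bspec, OF that(1)]])
  qed
  show "((\<lambda>h. sqnorm rho EI m J (st_diff (st_scale (complex_of_real (1 / h)) (st_diff (T h z) z))
      (opA rho EI m J a b z))) \<longlongrightarrow> 0) (at_right 0)" if "z \<in> domA" for z
    by (rule sg8[THEN bspec, OF that])
qed

text \<open>The chosen representative is immaterial, as \<open>embed_T\<close> shows, and the laws
  of a semigroup hold as equations.\<close>

definition S :: "real \<Rightarrow> beam_state \<Rightarrow> beam_state"
  where "S t h = embed (T t (realize h))"

lemma embed_T_linear:
  assumes "t \<ge> 0" "z1 \<in> stateX" "z2 \<in> stateX"
  shows "embed (T t (st_add (st_scale (complex_of_real r) z1) z2)) = r *\<^sub>R embed (T t z1) + embed (T t z2)"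
  using T_linear[OF assms, of "complex_of_real r"]
    sqnorm_diff_eq_0_iff[OF T_stateX[OF assms(1) embed_scale_add(1)[OF assms(2,3)]]
      embed_scale_add(1)[OF T_stateX[OF assms(1,2)] T_stateX[OF assms(1,3)]], of r r]
    embed_scale_add(2)[OF T_stateX[OF assms(1,2)] T_stateX[OF assms(1,3)]]
  by simp

text \<open>Two representatives of the same class differ by a null state. Boundedness of
  \<open>T t\<close> in the seminorm sends it to a null state, and linearity, valid up to null
  elements, separates the two.\<close>

lemma embed_T:
  assumes t: "t \<ge> 0" and z: "z \<in> stateX"
  shows "embed (T t z) = S t (embed z)"
proof -
  define z' where "z' = realize (embed z)"
  have z': "z' \<in> stateX" "embed z' = embed z" by (simp_all add: z'_def embed_realize)
  define d where "d = st_add (st_scale (complex_of_real (-1)) z) z'"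
  have d: "d \<in> stateX" "embed d = 0" unfolding d_def using embed_scale_add[OF z z'(1), of "-1"] z'(2) by auto
  obtain C where C: "\<And>z. z \<in> stateX \<Longrightarrow> sqnorm rho EI m J (T t z) \<le> C * sqnorm rho EI m J z"
    using T_bounded[OF t] by blast
  have "B (embed (T t d)) (embed (T t d)) \<le> C * B 0 0"
    using C[OF d(1)] d by (simp add: sqnorm_embed T_stateX t)
  then have "B (embed (T t d)) (embed (T t d)) = 0"
    using B_self_nonneg[of "embed (T t d)"] by (simp add: bounded_bilinear.zero_left[OF B_bilinear])
  then have "embed (T t d) = 0" by (simp add: B_eq_0_iff)
  then have "- embed (T t z) + embed (T t z') = 0"
    unfolding d_def using embed_T_linear[OF t z z'(1), of "-1"] by simp
  then show ?thesis by (simp add: S_def z'_def)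
qed

lemma S_linear:
  assumes "t \<ge> 0"
  shows "S t (r *\<^sub>R h + k) = r *\<^sub>R S t h + S t k"
proof -
  have "S t (r *\<^sub>R h + k) = S t (embed (st_add (st_scale (complex_of_real r) (realize h)) (realize k)))"
    by (simp add: embed_scale_add embed_realize)
  also have "\<dots> = embed (T t (st_add (st_scale (complex_of_real r) (realize h)) (realize k)))"
    by (intro embed_T[symmetric] assms embed_scale_add embed_realize)
  also have "\<dots> = r *\<^sub>R S t h + S t k"
    unfolding S_def by (intro embed_T_linear assms embed_realize)
  finally show ?thesis .
qed

lemma S_bounded_linear:
  assumes t: "t \<ge> 0"
  shows "bounded_linear (S t)"
proof -
  obtain r H where r: "r > 0" "\<And>Z. r * (norm Z)\<^sup>2 \<le> B Z Z" and H: "H > 0" "\<And>Z. B Z Z \<le> H * (norm Z)\<^sup>2"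
    using B_norm_bounds by metis
  obtain C where C: "\<And>z. z \<in> stateX \<Longrightarrow> sqnorm rho EI m J (T t z) \<le> C * sqnorm rho EI m J z"
    using T_bounded[OF t] by blast
  have zero: "S t 0 = 0" using S_linear[OF t, of 0 0 0] S_linear[OF t, of "-1" 0 0] by simp
  show ?thesis
  proof (rule bounded_linear_intro[where K = "sqrt (\<bar>C\<bar> * H / r)"])
    show "S t (x + y) = S t x + S t y" for x y using S_linear[OF t, of 1 x y] by simp
    show "S t (c *\<^sub>R x) = c *\<^sub>R S t x" for c x using S_linear[OF t, of c x 0] zero by simp
    fix h
    have "r * (norm (S t h))\<^sup>2 \<le> B (S t h) (S t h)" by (rule r(2))
    also have "\<dots> \<le> C * B h h"
      using C[OF embed_realize(1)[of h]] by (simp add: sqnorm_embed T_stateX t embed_realize S_def)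
    also have "\<dots> \<le> \<bar>C\<bar> * B h h" using B_self_nonneg[of h] by (intro mult_right_mono) auto
    also have "\<dots> \<le> \<bar>C\<bar> * (H * (norm h)\<^sup>2)" using H(2) by (intro mult_left_mono) auto
    finally have "(norm (S t h))\<^sup>2 \<le> \<bar>C\<bar> * H / r * (norm h)\<^sup>2" using r(1) by (simp add: field_simps)
    also have "\<dots> = (norm h * sqrt (\<bar>C\<bar> * H / r))\<^sup>2" using r(1) H(1) by (simp add: power_mult_distrib)
    finally show "norm (S t h) \<le> norm h * sqrt (\<bar>C\<bar> * H / r)"
      by (rule power2_le_imp_le) (use r(1) H(1) in simp)
  qed
qed

sublocale c0_semigroup S
proof (rule c0_semigroup.intro)
  show "bounded_linear (S t)" if "t \<ge> 0" for t by (rule S_bounded_linear[OF that])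
  show "S 0 h = h" for h
    using T_0[OF embed_realize(1)[of h]] by (simp add: sqnorm_diff_eq_0_iff T_stateX embed_realize S_def)
  show "S (s + t) h = S s (S t h)" if "s \<ge> 0" "t \<ge> 0" for s t h
  proof -
    have "S (s + t) h = embed (T s (T t (realize h)))"
      using T_add[OF that embed_realize(1)[of h]] that
      by (simp add: sqnorm_diff_eq_0_iff T_stateX embed_realize S_def)
    also have "\<dots> = S s (S t h)" using that by (simp add: embed_T T_stateX embed_realize)
    finally show ?thesis .
  qed
  show "((\<lambda>t. S t h) \<longlongrightarrow> h) (at_right 0)" for h
  proof -
    have "\<forall>\<^sub>F t in at_right 0. sqnorm rho EI m J (st_diff (T t (realize h)) (realize h)) = B (S t h - h) (S t h - h)"
      unfolding eventually_at_right_field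
      by (intro exI[of _ 1]) (auto simp: sqnorm_embed embed_diff T_stateX embed_realize S_def)
    with T_continuous[OF embed_realize(1)[of h]]
    have "((\<lambda>t. B (S t h - h) (S t h - h)) \<longlongrightarrow> 0) (at_right 0)" by (rule Lim_transform_eventually)
    then show ?thesis unfolding B_tendsto_0_iff by (rule LIM_zero_cancel)
  qed
qed

lemma generates_iff:
  assumes "z \<in> stateX" "y \<in> stateX"
  shows "generates (embed z) (embed y) \<longleftrightarrow>
    ((\<lambda>h. sqnorm rho EI m J (st_diff (st_scale (complex_of_real (1 / h)) (st_diff (T h z) z)) y)) \<longlongrightarrow> 0) (at_right 0)"
proof -
  define W where "W r = (1 / r) *\<^sub>R (S r (embed z) - embed z) - embed y" for r
  have "\<forall>\<^sub>F h in at_right 0. sqnorm rho EI m J (st_diff (st_scale (complex_of_real (1 / h)) (st_diff (T h z) z)) y) = B (W h) (W h)"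
    unfolding eventually_at_right_field
    by (intro exI[of _ 1])
       (auto simp: W_def sqnorm_embed embed_diff embed_scale T_stateX assms embed_T simp del: of_real_divide)
  then have "((\<lambda>h. sqnorm rho EI m J (st_diff (st_scale (complex_of_real (1 / h)) (st_diff (T h z) z)) y)) \<longlongrightarrow> 0) (at_right 0)
    \<longleftrightarrow> ((\<lambda>h. B (W h) (W h)) \<longlongrightarrow> 0) (at_right 0)"
    by (rule tendsto_cong)
  also have "\<dots> \<longleftrightarrow> (W \<longlongrightarrow> 0) (at_right 0)" by (rule B_tendsto_0_iff)
  also have "\<dots> \<longleftrightarrow> generates (embed z) (embed y)"
    unfolding generates_def W_def by (rule Lim_null[symmetric])
  finally show ?thesis by blast
qed

lemma opA_stateX:
  assumes "z \<in> domA"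
  shows "opA rho EI m J a b z \<in> stateX"
proof -
  obtain f g \<xi> \<eta> where z: "z = (f, g, \<xi>, \<eta>)" by (cases z)
  have f: "Hs 4 f" and g: "H2l g" using assms by (auto simp: z domA_def)
  define M where "M = (\<lambda>x. complex_of_real (EI x) * dw (dw f) x)"
  have "L2 (wd (dw M))"
    unfolding M_def by (rule is_L2_antiderivD(1)[OF is_L2_antideriv_wd[OF bending_moment_H1(2)[OF EI_C4 f]]])
  moreover have "continuous_on {0..1} (\<lambda>x. - (1 / rho x))"
    using rho_pos by (intro continuous_intros rho_cont) (auto simp: less_imp_neq[symmetric])
  ultimately have "L2 (\<lambda>x. (- (1 / rho x)) *\<^sub>R wd (dw M) x)" by (rule L2_mult_continuous[rotated])
  then have "L2 (\<lambda>x. - wd (dw M) x / complex_of_real (rho x))"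
    by (simp add: scaleR_conv_of_real divide_inverse mult.commute)
  with g show ?thesis by (simp add: z opA_def stateX_def M_def Let_def)
qed

lemma domA_generates: "z \<in> domA \<Longrightarrow> generates (embed z) (embed (opA rho EI m J a b z))"
  using generates_iff[OF domA_stateX opA_stateX] T_generator by blast

text \<open>The assumption on the domain of \<open>T\<close> provides a concrete state in
  \<open>domA\<close>, and uniqueness of limits identifies the derivative as the class of
  \<open>opA\<close> at this state.\<close>

lemma generates_domA:
  assumes "generates h y"
  obtains z where "z \<in> domA" "embed z = h" "embed (opA rho EI m J a b z) = y"
proof -
  have "generates (embed (realize h)) (embed (realize y))" using assms by (simp add: embed_realize)
  then obtain z where z: "z \<in> domA" "sqnorm rho EI m J (st_diff (realize h) z) = 0"
    using T_domain[OF embed_realize(1) embed_realize(1)] generates_iff[OF embed_realize(1) embed_realize(1)] by blast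
  then have e: "embed z = h"
    using sqnorm_diff_eq_0_iff[OF embed_realize(1) domA_stateX[OF z(1)], of h] by (simp add: embed_realize)
  have "embed (opA rho EI m J a b z) = y"
    using domA_generates[OF z(1)] assms unfolding e generates_def
    by (rule tendsto_unique[rotated]) simp
  with z(1) e that show ?thesis by blast
qed

text \<open>The time derivative \<open>y\<close> has two descriptions: as the operator applied to
  \<open>z\<close>, with weak derivatives only, and as the class of a state in \<open>domA\<close>,
  whose components are regular. Comparing them lifts the weak beam equation to a pointwise
  one.\<close>

lemma generates_classical:
  assumes "generates h y" "generates y w"
  shows "classical h y"
proof -
  obtain z where z: "z \<in> domA" "embed z = h" "embed (opA rho EI m J a b z) = y"
    using assms(1) by (rule generates_domA)
  obtain z' where z': "z' \<in> domA" "embed z' = y" using assms(2) by (rule generates_domA)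
  obtain f g \<xi> \<eta> where zf: "z = (f, g, \<xi>, \<eta>)" by (cases z)
  obtain g' v \<xi>' \<eta>' where zg: "z' = (g', v, \<xi>', \<eta>')" by (cases z')
  have f: "Hs 4 f" "f 0 = 0" "dw f 0 = 0" "H2l g" "\<xi> = g 1" "\<eta> = dw g 1" using z(1) by (auto simp: zf domA_def)
  have g': "Hs 4 g'" "g' 0 = 0" "dw g' 0 = 0" "H2l v" using z'(1) by (auto simp: zg domA_def)
  define M where "M = (\<lambda>x. EI x *\<^sub>R dw (dw f) x)"
  have M: "M = (\<lambda>x. complex_of_real (EI x) * dw (dw f) x)" by (simp add: M_def scaleR_conv_of_real)
  note MH = bending_moment_H1[OF EI_C4 f(1), folded M]
  define k where "k = (\<lambda>x. - wd (dw M) x / complex_of_real (rho x))"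
  have y1: "y = (to_l2 (wd (dw g)), to_l2 k, (dw M 1 - complex_of_real a * \<xi>) / complex_of_real m,
      (- M 1 - complex_of_real b * \<eta>) / complex_of_real J)"
    using z(3)[symmetric] by (simp add: zf opA_def embed_def Let_def k_def M)
  have y2: "y = (to_l2 (wd (dw g')), to_l2 v, \<xi>', \<eta>')" using z'(2) by (simp add: zg embed_def)
  have Hg': "H2l g'" by (rule Hs4_H2l(1)[OF g'(1-3)])
  \<comment> \<open>Both functions are clamped and their curvatures have the same class, so the
    velocity \<open>g\<close> coincides with the H4 function \<open>g'\<close> and inherits its
    continuous second derivative.\<close>
  have gg: "dw g x = dw g' x" "g x = g' x" if "x \<in> {0..1}" for x
    using H2l_determined[OF f(4) Hg' _ that] y1 y2 by auto
  have cv: "continuous_on {0..1} v" by (rule H2l_D(5)[OF g'(4)])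
  have crv: "continuous_on {0..1} (\<lambda>x. - (rho x *\<^sub>R v x))" by (intro continuous_intros rho_cont cv)
  have Lw: "L2 (wd (dw M))" and wM: "\<And>x. x \<in> {0..1} \<Longrightarrow> dw M x = dw M 0 + integral {0..x} (wd (dw M))"
    using is_L2_antiderivD[OF is_L2_antideriv_wd[OF MH(2)]] by blast+
  \<comment> \<open>Comparison of the second components of \<open>y\<close>: multiplying
    \<open>k = v\<close> by the density, almost everywhere, replaces the weak derivative of the
    shear by a continuous function.\<close>
  have kw: "to_l2 (wd (dw M)) = to_l2 (\<lambda>x. - (rho x *\<^sub>R v x))"
  proof -
    have Lk: "L2 k" using opA_stateX[OF z(1)] by (simp add: zf opA_def Let_def stateX_def k_def M)
    have "to_l2 k = to_l2 v" using y1 y2 by simp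
    then have "AE x in unit_measure. k x = v x"
      by (subst (asm) to_l2_eq_iff[OF Lk H2l_D(6)[OF g'(4)]])
    moreover have "AE x in unit_measure. rho x \<noteq> 0" using rho_pos by (intro AE_I2) force
    ultimately have "AE x in unit_measure. wd (dw M) x = - (rho x *\<^sub>R v x)"
    proof eventually_elim
      case (elim x)
      then have "v x = - wd (dw M) x / complex_of_real (rho x)" by (simp add: k_def)
      then show ?case using elim by (simp add: scaleR_conv_of_real)
    qed
    then show ?thesis by (subst to_l2_eq_iff[OF Lw L2_continuous[OF crv]])
  qed
  \<comment> \<open>The shear is the primitive of its weak derivative, hence of this continuous
    function, and is therefore differentiable at every point.\<close>
  have dM: "(dw M has_vector_derivative - (rho x *\<^sub>R v x)) (at x within {0..1})" if x: "x \<in> {0..1}" for x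
  proof -
    define N where "N u = dw M 0 + integral {0..u} (\<lambda>x. - (rho x *\<^sub>R v x))" for u
    have "(N has_vector_derivative 0 + - (rho x *\<^sub>R v x)) (at x within {0..1})"
      unfolding N_def
      by (intro has_vector_derivative_add has_vector_derivative_const integral_has_vector_derivative crv x)
    then have dN: "(N has_vector_derivative - (rho x *\<^sub>R v x)) (at x within {0..1})" by simp
    have "N u = dw M u" if "u \<in> {0..1}" for u
      unfolding N_def using wM[OF that] L2_integral_cong[OF Lw L2_continuous[OF crv] kw, of 0 u] that by simp
    from has_vector_derivative_unit_cong[OF this x dN] show ?thesis .
  qed
  have dg1: "(dw g has_vector_derivative dw (dw g') x) (at x within {0..1})" if "x \<in> {0..1}" for x
    by (rule has_vector_derivative_unit_cong[OF _ that Hs4_D(2)[OF g'(1) that]]) (simp add: gg)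
  have Z: "h = (to_l2 (dw (dw f)), to_l2 g, g 1, dw g 1)"
    using z(2) Hs4_H2l(2)[OF f(1-3)] by (simp add: zf embed_def f)
  have "\<xi>' = (dw M 1 - a *\<^sub>R g 1) /\<^sub>R m" "\<eta>' = (- (EI 1 *\<^sub>R dw (dw f) 1) - b *\<^sub>R dw g 1) /\<^sub>R J"
    using y1 y2 constants by (simp_all add: f M_def scaleR_conv_of_real divide_inverse mult.commute)
  then have Y: "y = (to_l2 (dw (dw g')), to_l2 v, (dw M 1 - a *\<^sub>R g 1) /\<^sub>R m, (- (EI 1 *\<^sub>R dw (dw f) 1) - b *\<^sub>R dw g 1) /\<^sub>R J)"
    using y2 Hs4_H2l(2)[OF g'(1-3)] by simp
  show ?thesis unfolding classical_def
  proof (intro exI conjI ballI)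
    fix x :: real assume x: "x \<in> {0..1}"
    show "(f has_vector_derivative dw f x) (at x within {0..1})"
      "(dw f has_vector_derivative dw (dw f) x) (at x within {0..1})" by (intro Hs4_D f x)+
    show "((\<lambda>x. EI x *\<^sub>R dw (dw f) x) has_vector_derivative dw M x) (at x within {0..1})"
      using MH(1)[OF x] by (simp only: M_def)
    show "(dw M has_vector_derivative - (rho x *\<^sub>R v x)) (at x within {0..1})" by (rule dM[OF x])
    show "(g has_vector_derivative dw g x) (at x within {0..1})" by (intro H2l_D f x)
    show "(dw g has_vector_derivative dw (dw g') x) (at x within {0..1})" by (rule dg1[OF x])
  next
    show "continuous_on {0..1} (dw (dw f))" "continuous_on {0..1} (dw (dw g'))" by (intro Hs4_D f g')+
    show "continuous_on {0..1} v" by (rule cv)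
    show "f 0 = 0" "dw f 0 = 0" "g 0 = 0" "dw g 0 = 0" using f H2l_D(3,4)[OF f(4)] by auto
  qed (rule Z, rule Y)
qed

sublocale beam_semigroup rho "dw rho" EI "dw EI" m J a b S
  by unfold_locales (rule generates_classical)

lemma energy_tendsto_0:
  assumes "z \<in> stateX"
  shows "((\<lambda>t. sqnorm rho EI m J (T t z) / 2) \<longlongrightarrow> 0) at_top"
proof -
  have "((\<lambda>t. B (S t (embed z)) (S t (embed z)) / 2) \<longlongrightarrow> 0 / 2) at_top"
    by (intro tendsto_intros beam_energy_decay(1)) simp
  moreover have "\<forall>\<^sub>F t in at_top. B (S t (embed z)) (S t (embed z)) / 2 = sqnorm rho EI m J (T t z) / 2"
    using eventually_ge_at_top[of "0::real"]
    by eventually_elim (simp add: sqnorm_embed T_stateX assms embed_T)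
  ultimately show ?thesis using Lim_transform_eventually by fastforce
qed

lemma energy_smallo:
  assumes "z \<in> domA"
  shows "(\<lambda>t. sqnorm rho EI m J (T t z) / 2) \<in> o[at_top](\<lambda>t. 1 / t)"
proof (rule smalloI_tendsto)
  have "((\<lambda>t. t * B (S t (embed z)) (S t (embed z)) / 2) \<longlongrightarrow> 0 / 2) at_top"
    by (intro tendsto_intros beam_energy_decay(2)[OF domA_generates[OF assms]]) simp
  moreover have "\<forall>\<^sub>F t in at_top. t * B (S t (embed z)) (S t (embed z)) / 2 = sqnorm rho EI m J (T t z) / 2 / (1 / t)"
    using eventually_ge_at_top[of "0::real"]
    by eventually_elim (simp add: sqnorm_embed T_stateX domA_stateX[OF assms] embed_T)
  ultimately show "((\<lambda>t. sqnorm rho EI m J (T t z) / 2 / (1 / t)) \<longlongrightarrow> 0) at_top"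
    using Lim_transform_eventually by fastforce
  show "\<forall>\<^sub>F t in at_top. 1 / t \<noteq> (0::real)"
    using eventually_gt_at_top[of "0::real"] by eventually_elim simp
qed

end

theorem theorem3p1:
  fixes rho EI :: "real \<Rightarrow> real" and m J a b :: real
    and T :: "real \<Rightarrow> state \<Rightarrow> state"
  assumes "Ck 4 rho" and "Ck 4 EI"
    and "\<forall>x\<in>{0..1}. rho x > 0" and "\<forall>x\<in>{0..1}. EI x > 0"
    and "m > 0" and "J > 0" and "a > 0" and "b > 0"
    and "\<exists>\<epsilon>>0. \<exists>\<delta>>0. \<exists>zeta :: real \<Rightarrow> real. Ck 2 zeta \<and> zeta 0 = 0 \<and>
           (\<forall>x\<in>{0..1}.
              2 * (1 - \<epsilon>) * rho x - dw (\<lambda>y. rho y * zeta y) x < - \<delta>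
            \<and> EI x * ((1 - \<epsilon>) - 2 * dw zeta x) + 1/2 * dw (\<lambda>y. EI y * zeta y) x < - \<delta>)"
    and "C0_semigroup_gen (sqnorm rho EI m J) stateX domA (opA rho EI m J a b) T"
  shows "(\<forall>z0\<in>stateX. ((\<lambda>t. sqnorm rho EI m J (T t z0) / 2) \<longlongrightarrow> 0) at_top)
       \<and> (\<forall>z0\<in>domA. (\<lambda>t. sqnorm rho EI m J (T t z0) / 2) \<in> o[at_top](\<lambda>t. 1 / t))"
proof -
  interpret beam_problem rho EI m J a b T
    by unfold_locales (use assms in blast)+
  show ?thesis using energy_tendsto_0 energy_smallo by blast
qed

end
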